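(* Let $\sigma$ be a signature. For all sets $\Gamma\subseteq\mathrm{Sent}_\sigma$ and $\Delta\subseteq\mathrm{Form}_\sigma$: $\Gamma\vdash_{\mathsf{QBK}^\circ}\Delta$ if and only if $\Gamma\vDash_{\mathsf{QBK}^\circ}\Delta$.
   Context: Syntax. Signature $\sigma$: predicate symbols (with arities) and constants, no function symbols; terms are variables (fixed countable set) and constants. $\mathrm{Form}_\sigma$: formulas built from atomic formulas and $\bot$ by $\rightarrow,\wedge,\vee$, strong negation $\sim$, $\Box,\Diamond$, $\forall x,\exists x$; $\mathrm{Sent}_\sigma$: sentences. Abbreviations: $\neg\Phi:=\Phi\rightarrow\bot$, $\Phi\leftrightarrow\Psi:=(\Phi\rightarrow\Psi)\wedge(\Psi\rightarrow\Phi)$, $\Phi\Leftrightarrow\Psi:=(\Phi\leftrightarrow\Psi)\wedge({\sim\Phi}\leftrightarrow{\sim\Psi})$. Calculus. $\mathsf{QBK}^\circ_\sigma$ is the smallest set of $\sigma$-formulas containing all instances of the following schemes and closed under the rules below: $\Phi\rightarrow(\Psi\rightarrow\Phi)$; $(\Phi\rightarrow(\Psi\rightarrow\Theta))\rightarrow((\Phi\rightarrow\Psi)\rightarrow(\Phi\rightarrow\Theta))$; $\Phi\wedge\Psi\rightarrow\Phi$; $\Phi\wedge\Psi\rightarrow\Psi$; $\Phi\rightarrow(\Psi\rightarrow\Phi\wedge\Psi)$; $\Phi\rightarrow\Phi\vee\Psi$; $\Psi\rightarrow\Phi\vee\Psi$; $(\Phi\rightarrow\Theta)\rightarrow((\Psi\rightarrow\Theta)\rightarrow(\Phi\vee\Psi\rightarrow\Theta))$;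 $\Phi\vee(\Phi\rightarrow\bot)$; $\bot\rightarrow\Phi$; ${\sim\sim\Phi}\leftrightarrow\Phi$; ${\sim(\Phi\rightarrow\Psi)}\leftrightarrow(\Phi\wedge{\sim\Psi})$; ${\sim(\Phi\vee\Psi)}\leftrightarrow({\sim\Phi}\wedge{\sim\Psi})$; ${\sim(\Phi\wedge\Psi)}\leftrightarrow({\sim\Phi}\vee{\sim\Psi})$; ${\sim\bot}$; $(\Box\Phi\wedge\Box\Psi)\rightarrow\Box(\Phi\wedge\Psi)$; $\Box(\Phi\rightarrow\Phi)$; $\neg\Box\Phi\leftrightarrow\Diamond\neg\Phi$; $\neg\Diamond\Phi\leftrightarrow\Box\neg\Phi$; $\Box\Phi\Leftrightarrow{\sim\Diamond{\sim\Phi}}$; $\Diamond\Phi\Leftrightarrow{\sim\Box{\sim\Phi}}$; $\forall x\Phi\rightarrow\Phi(x/t)$, $\Phi(x/t)\rightarrow\exists x\Phi$ ($t$ free for $x$ in $\Phi$); ${\sim\forall x\Phi}\leftrightarrow\exists x{\sim\Phi}$; ${\sim\exists x\Phi}\leftrightarrow\forall x{\sim\Phi}$; and additionally $\Phi\vee{\sim\Phi}$. Rules: MP (from $\Phi,\Phi\rightarrow\Psi$ infer $\Psi$), MB (from $\Phi\rightarrow\Psi$ infer $\Box\Phi\rightarrow\Box\Psi$), MD (from $\Phi\rightarrow\Psi$ infer $\Diamond\Phi\rightarrow\Diamond\Psi$), BR1 (from $\Phi\rightarrow\Psi$ infer $\Phi\rightarrow\forall x\Psi$, $x$ not free in $\Phi$),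 BR2 (from $\Phi\rightarrow\Psi$ infer $\exists x\Phi\rightarrow\Psi$, $x$ not free in $\Psi$). $\mathrm{Disj}(\Delta)$: disjunctions of finitely many elements of $\Delta$ (empty $=\bot$). $\Gamma\vdash_{\mathsf{QBK}^\circ}\Delta$ iff some element of $\mathrm{Disj}(\Delta)$ is obtainable from $\Gamma\cup\mathsf{QBK}^\circ_\sigma$ using only MP, BR1, BR2. Semantics. A $\mathsf{QBK}_\sigma$-model is $\mathcal M=\langle\langle W,R\rangle,(\mathfrak A^+_w),(\mathfrak A^-_w)\rangle$ ($W\ne\emptyset$, $R\subseteq W\times W$), $\mathfrak A^\pm_w$ $\sigma$-structures with common domain $A_w$ and equal interpretation of constants, with $uRv\Rightarrow A_u\subseteq A_v$ and constants of $\sigma$ interpreted equally in $\mathfrak A^+_u,\mathfrak A^+_v$. A $\mathsf{QBK}^\circ_\sigma$-model is a $\mathsf{QBK}_\sigma$-model such that for every $w$ and every atomic $A_w$-sentence $\Phi$, $\mathfrak A^+_w\models\Phi$ or $\mathfrak A^-_w\models\Phi$. $A$-sentences: sentences over $\sigma$ plus constants $\underline a$ ($a\in A$) naming $a$; ground $A$-substitutions map variables to such constants. Verification/falsification at $w$: atomic by $\mathfrak A^+_w$ / $\mathfrak A^-_w$; $\bot$ never verified, always falsified; $\wedge$: verified iff both verified, falsified iff one falsified; $\vee$ dually; $\Phi\rightarrow\Psi$: verified iff $\Phi$ not verified or $\Psi$ verified, falsified iff $\Phi$ verified and $\Psi$ falsified; $\sim$ swaps; $\Box\Phi$: verified iff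 $\Phi$ verified at all $R$-successors, falsified iff falsified at some $R$-successor; $\Diamond\Phi$: verified iff verified at some $R$-successor, falsified iff falsified at all; $\forall x\Phi$: verified iff $\Phi(x/\underline a)$ verified for all $a\in A_w$, falsified iff falsified for some; $\exists x\Phi$: verified iff verified for some $a\in A_w$, falsified iff falsified for all. $\Gamma\vDash_{\mathsf{QBK}^\circ}\Delta$ iff for every $\mathsf{QBK}^\circ_\sigma$-model $\mathcal M$, world $w$, ground $A_w$-substitution $\lambda$: if all of $\Gamma$ is verified at $w$ then $\lambda\Psi$ is verified at $w$ for some $\Psi\in\Delta$. *)

theory Defs
  imports "HOL-Library.Equipollence"
begin

text \<open>Symbols are carved out of the types \<open>'p\<close> and \<open>'c\<close> by sets, so that a signature may have no
  constants or no predicate symbols.\<close>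

record ('p, 'c) signature =
  psyms :: "'p set"
  arity :: "'p \<Rightarrow> nat"
  csyms :: "'c set"

datatype 'c trm = Var nat | Const 'c

datatype ('p, 'c) fm =
    Atom 'p "'c trm list"
  | Bot (\<open>\<^bold>\<bottom>\<close>)
  | Imp "('p, 'c) fm" "('p, 'c) fm" (infixr \<open>\<^bold>\<rightarrow>\<close> 55)
  | Con "('p, 'c) fm" "('p, 'c) fm" (infixr \<open>\<^bold>\<and>\<close> 65)
  | Dis "('p, 'c) fm" "('p, 'c) fm" (infixr \<open>\<^bold>\<or>\<close> 60)
  | SNeg "('p, 'c) fm" (\<open>\<^bold>\<sim> _\<close> [70] 70)
  | Box "('p, 'c) fm" (\<open>\<^bold>\<box> _\<close> [70] 70)
  | Dia "('p, 'c) fm" (\<open>\<^bold>\<diamond> _\<close> [70] 70)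
  | Forall nat "('p, 'c) fm"
  | Exists nat "('p, 'c) fm"

abbreviation Neg :: "('p, 'c) fm \<Rightarrow> ('p, 'c) fm" (\<open>\<^bold>\<not> _\<close> [70] 70) where
  "\<^bold>\<not> \<Phi> \<equiv> \<Phi> \<^bold>\<rightarrow> \<^bold>\<bottom>"

abbreviation Iff :: "('p, 'c) fm \<Rightarrow> ('p, 'c) fm \<Rightarrow> ('p, 'c) fm" (infix \<open>\<^bold>\<leftrightarrow>\<close> 50) where
  "\<Phi> \<^bold>\<leftrightarrow> \<Psi> \<equiv> (\<Phi> \<^bold>\<rightarrow> \<Psi>) \<^bold>\<and> (\<Psi> \<^bold>\<rightarrow> \<Phi>)"

abbreviation SIff :: "('p, 'c) fm \<Rightarrow> ('p, 'c) fm \<Rightarrow> ('p, 'c) fm" (infix \<open>\<^bold>\<Leftrightarrow>\<close> 50) where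
  "\<Phi> \<^bold>\<Leftrightarrow> \<Psi> \<equiv> (\<Phi> \<^bold>\<leftrightarrow> \<Psi>) \<^bold>\<and> (\<^bold>\<sim> \<Phi> \<^bold>\<leftrightarrow> \<^bold>\<sim> \<Psi>)"

primrec tvars :: "'c trm \<Rightarrow> nat set" where
  "tvars (Var x) = {x}"
| "tvars (Const c) = {}"

primrec fv :: "('p, 'c) fm \<Rightarrow> nat set" where
  "fv (Atom p ts) = (\<Union>t\<in>set ts. tvars t)"
| "fv \<^bold>\<bottom> = {}"
| "fv (\<Phi> \<^bold>\<rightarrow> \<Psi>) = fv \<Phi> \<union> fv \<Psi>"
| "fv (\<Phi> \<^bold>\<and> \<Psi>) = fv \<Phi> \<union> fv \<Psi>"
| "fv (\<Phi> \<^bold>\<or> \<Psi>) = fv \<Phi> \<union> fv \<Psi>"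
| "fv (\<^bold>\<sim> \<Phi>) = fv \<Phi>"
| "fv (\<^bold>\<box> \<Phi>) = fv \<Phi>"
| "fv (\<^bold>\<diamond> \<Phi>) = fv \<Phi>"
| "fv (Forall x \<Phi>) = fv \<Phi> - {x}"
| "fv (Exists x \<Phi>) = fv \<Phi> - {x}"

primrec wf_trm :: "('p, 'c) signature \<Rightarrow> 'c trm \<Rightarrow> bool" where
  "wf_trm \<sigma> (Var x) \<longleftrightarrow> True"
| "wf_trm \<sigma> (Const c) \<longleftrightarrow> c \<in> csyms \<sigma>"

primrec wf_fm :: "('p, 'c) signature \<Rightarrow> ('p, 'c) fm \<Rightarrow> bool" where
  "wf_fm \<sigma> (Atom p ts) \<longleftrightarrow>
     p \<in> psyms \<sigma> \<and> length ts = arity \<sigma> p \<and> (\<forall>t\<in>set ts. wf_trm \<sigma> t)"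
| "wf_fm \<sigma> \<^bold>\<bottom> \<longleftrightarrow> True"
| "wf_fm \<sigma> (\<Phi> \<^bold>\<rightarrow> \<Psi>) \<longleftrightarrow> wf_fm \<sigma> \<Phi> \<and> wf_fm \<sigma> \<Psi>"
| "wf_fm \<sigma> (\<Phi> \<^bold>\<and> \<Psi>) \<longleftrightarrow> wf_fm \<sigma> \<Phi> \<and> wf_fm \<sigma> \<Psi>"
| "wf_fm \<sigma> (\<Phi> \<^bold>\<or> \<Psi>) \<longleftrightarrow> wf_fm \<sigma> \<Phi> \<and> wf_fm \<sigma> \<Psi>"
| "wf_fm \<sigma> (\<^bold>\<sim> \<Phi>) \<longleftrightarrow> wf_fm \<sigma> \<Phi>"
| "wf_fm \<sigma> (\<^bold>\<box> \<Phi>) \<longleftrightarrow> wf_fm \<sigma> \<Phi>"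
| "wf_fm \<sigma> (\<^bold>\<diamond> \<Phi>) \<longleftrightarrow> wf_fm \<sigma> \<Phi>"
| "wf_fm \<sigma> (Forall x \<Phi>) \<longleftrightarrow> wf_fm \<sigma> \<Phi>"
| "wf_fm \<sigma> (Exists x \<Phi>) \<longleftrightarrow> wf_fm \<sigma> \<Phi>"

definition Form :: "('p, 'c) signature \<Rightarrow> ('p, 'c) fm set" where
  "Form \<sigma> = {\<Phi>. wf_fm \<sigma> \<Phi>}"

definition Sent :: "('p, 'c) signature \<Rightarrow> ('p, 'c) fm set" where
  "Sent \<sigma> = {\<Phi> \<in> Form \<sigma>. fv \<Phi> = {}}"

primrec tsubst :: "(nat \<Rightarrow> 'c trm) \<Rightarrow> 'c trm \<Rightarrow> 'c trm" where
  "tsubst s (Var x) = s x"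
| "tsubst s (Const c) = Const c"

text \<open>Simultaneous replacement of the free occurrences of variables, without renaming of bound
  variables.\<close>

primrec subst :: "(nat \<Rightarrow> 'c trm) \<Rightarrow> ('p, 'c) fm \<Rightarrow> ('p, 'c) fm" where
  "subst s (Atom p ts) = Atom p (map (tsubst s) ts)"
| "subst s \<^bold>\<bottom> = \<^bold>\<bottom>"
| "subst s (\<Phi> \<^bold>\<rightarrow> \<Psi>) = subst s \<Phi> \<^bold>\<rightarrow> subst s \<Psi>"
| "subst s (\<Phi> \<^bold>\<and> \<Psi>) = subst s \<Phi> \<^bold>\<and> subst s \<Psi>"
| "subst s (\<Phi> \<^bold>\<or> \<Psi>) = subst s \<Phi> \<^bold>\<or> subst s \<Psi>"
| "subst s (\<^bold>\<sim> \<Phi>) = \<^bold>\<sim> (subst s \<Phi>)"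
| "subst s (\<^bold>\<box> \<Phi>) = \<^bold>\<box> (subst s \<Phi>)"
| "subst s (\<^bold>\<diamond> \<Phi>) = \<^bold>\<diamond> (subst s \<Phi>)"
| "subst s (Forall x \<Phi>) = Forall x (subst (s(x := Var x)) \<Phi>)"
| "subst s (Exists x \<Phi>) = Exists x (subst (s(x := Var x)) \<Phi>)"

definition inst :: "('p, 'c) fm \<Rightarrow> nat \<Rightarrow> 'c trm \<Rightarrow> ('p, 'c) fm" where
  "inst \<Phi> x t = subst (Var(x := t)) \<Phi>"

primrec free_for :: "'c trm \<Rightarrow> nat \<Rightarrow> ('p, 'c) fm \<Rightarrow> bool" where
  "free_for t x (Atom p ts) \<longleftrightarrow> True"
| "free_for t x \<^bold>\<bottom> \<longleftrightarrow> True"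
| "free_for t x (\<Phi> \<^bold>\<rightarrow> \<Psi>) \<longleftrightarrow> free_for t x \<Phi> \<and> free_for t x \<Psi>"
| "free_for t x (\<Phi> \<^bold>\<and> \<Psi>) \<longleftrightarrow> free_for t x \<Phi> \<and> free_for t x \<Psi>"
| "free_for t x (\<Phi> \<^bold>\<or> \<Psi>) \<longleftrightarrow> free_for t x \<Phi> \<and> free_for t x \<Psi>"
| "free_for t x (\<^bold>\<sim> \<Phi>) \<longleftrightarrow> free_for t x \<Phi>"
| "free_for t x (\<^bold>\<box> \<Phi>) \<longleftrightarrow> free_for t x \<Phi>"
| "free_for t x (\<^bold>\<diamond> \<Phi>) \<longleftrightarrow> free_for t x \<Phi>"
| "free_for t x (Forall y \<Phi>) \<longleftrightarrow> x \<notin> fv (Forall y \<Phi>) \<or> (y \<notin> tvars t \<and> free_for t x \<Phi>)"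
| "free_for t x (Exists y \<Phi>) \<longleftrightarrow> x \<notin> fv (Exists y \<Phi>) \<or> (y \<notin> tvars t \<and> free_for t x \<Phi>)"

inductive_set QBKo_axioms :: "('p, 'c) signature \<Rightarrow> ('p, 'c) fm set"
  for \<sigma> :: "('p, 'c) signature" where
  ImpK: "\<lbrakk>\<Phi> \<in> Form \<sigma>; \<Psi> \<in> Form \<sigma>\<rbrakk> \<Longrightarrow> \<Phi> \<^bold>\<rightarrow> (\<Psi> \<^bold>\<rightarrow> \<Phi>) \<in> QBKo_axioms \<sigma>"
| ImpS: "\<lbrakk>\<Phi> \<in> Form \<sigma>; \<Psi> \<in> Form \<sigma>; \<Theta> \<in> Form \<sigma>\<rbrakk> \<Longrightarrow>
    (\<Phi> \<^bold>\<rightarrow> (\<Psi> \<^bold>\<rightarrow> \<Theta>)) \<^bold>\<rightarrow> ((\<Phi> \<^bold>\<rightarrow> \<Psi>) \<^bold>\<rightarrow> (\<Phi> \<^bold>\<rightarrow> \<Theta>)) \<in> QBKo_axioms \<sigma>"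
| ConE1: "\<lbrakk>\<Phi> \<in> Form \<sigma>; \<Psi> \<in> Form \<sigma>\<rbrakk> \<Longrightarrow> (\<Phi> \<^bold>\<and> \<Psi>) \<^bold>\<rightarrow> \<Phi> \<in> QBKo_axioms \<sigma>"
| ConE2: "\<lbrakk>\<Phi> \<in> Form \<sigma>; \<Psi> \<in> Form \<sigma>\<rbrakk> \<Longrightarrow> (\<Phi> \<^bold>\<and> \<Psi>) \<^bold>\<rightarrow> \<Psi> \<in> QBKo_axioms \<sigma>"
| ConI: "\<lbrakk>\<Phi> \<in> Form \<sigma>; \<Psi> \<in> Form \<sigma>\<rbrakk> \<Longrightarrow> \<Phi> \<^bold>\<rightarrow> (\<Psi> \<^bold>\<rightarrow> (\<Phi> \<^bold>\<and> \<Psi>)) \<in> QBKo_axioms \<sigma>"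
| DisI1: "\<lbrakk>\<Phi> \<in> Form \<sigma>; \<Psi> \<in> Form \<sigma>\<rbrakk> \<Longrightarrow> \<Phi> \<^bold>\<rightarrow> (\<Phi> \<^bold>\<or> \<Psi>) \<in> QBKo_axioms \<sigma>"
| DisI2: "\<lbrakk>\<Phi> \<in> Form \<sigma>; \<Psi> \<in> Form \<sigma>\<rbrakk> \<Longrightarrow> \<Psi> \<^bold>\<rightarrow> (\<Phi> \<^bold>\<or> \<Psi>) \<in> QBKo_axioms \<sigma>"
| DisE: "\<lbrakk>\<Phi> \<in> Form \<sigma>; \<Psi> \<in> Form \<sigma>; \<Theta> \<in> Form \<sigma>\<rbrakk> \<Longrightarrow>
    (\<Phi> \<^bold>\<rightarrow> \<Theta>) \<^bold>\<rightarrow> ((\<Psi> \<^bold>\<rightarrow> \<Theta>) \<^bold>\<rightarrow> ((\<Phi> \<^bold>\<or> \<Psi>) \<^bold>\<rightarrow> \<Theta>)) \<in> QBKo_axioms \<sigma>"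
| EM: "\<Phi> \<in> Form \<sigma> \<Longrightarrow> \<Phi> \<^bold>\<or> (\<Phi> \<^bold>\<rightarrow> \<^bold>\<bottom>) \<in> QBKo_axioms \<sigma>"
| BotE: "\<Phi> \<in> Form \<sigma> \<Longrightarrow> \<^bold>\<bottom> \<^bold>\<rightarrow> \<Phi> \<in> QBKo_axioms \<sigma>"
| SNegSNeg: "\<Phi> \<in> Form \<sigma> \<Longrightarrow> (\<^bold>\<sim> \<^bold>\<sim> \<Phi> \<^bold>\<leftrightarrow> \<Phi>) \<in> QBKo_axioms \<sigma>"
| SNegImp: "\<lbrakk>\<Phi> \<in> Form \<sigma>; \<Psi> \<in> Form \<sigma>\<rbrakk> \<Longrightarrow>
    (\<^bold>\<sim> (\<Phi> \<^bold>\<rightarrow> \<Psi>) \<^bold>\<leftrightarrow> (\<Phi> \<^bold>\<and> \<^bold>\<sim> \<Psi>)) \<in> QBKo_axioms \<sigma>"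
| SNegDis: "\<lbrakk>\<Phi> \<in> Form \<sigma>; \<Psi> \<in> Form \<sigma>\<rbrakk> \<Longrightarrow>
    (\<^bold>\<sim> (\<Phi> \<^bold>\<or> \<Psi>) \<^bold>\<leftrightarrow> (\<^bold>\<sim> \<Phi> \<^bold>\<and> \<^bold>\<sim> \<Psi>)) \<in> QBKo_axioms \<sigma>"
| SNegCon: "\<lbrakk>\<Phi> \<in> Form \<sigma>; \<Psi> \<in> Form \<sigma>\<rbrakk> \<Longrightarrow>
    (\<^bold>\<sim> (\<Phi> \<^bold>\<and> \<Psi>) \<^bold>\<leftrightarrow> (\<^bold>\<sim> \<Phi> \<^bold>\<or> \<^bold>\<sim> \<Psi>)) \<in> QBKo_axioms \<sigma>"
| SNegBot: "\<^bold>\<sim> \<^bold>\<bottom> \<in> QBKo_axioms \<sigma>"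
| BoxCon: "\<lbrakk>\<Phi> \<in> Form \<sigma>; \<Psi> \<in> Form \<sigma>\<rbrakk> \<Longrightarrow>
    (\<^bold>\<box> \<Phi> \<^bold>\<and> \<^bold>\<box> \<Psi>) \<^bold>\<rightarrow> \<^bold>\<box> (\<Phi> \<^bold>\<and> \<Psi>) \<in> QBKo_axioms \<sigma>"
| BoxId: "\<Phi> \<in> Form \<sigma> \<Longrightarrow> \<^bold>\<box> (\<Phi> \<^bold>\<rightarrow> \<Phi>) \<in> QBKo_axioms \<sigma>"
| NegBox: "\<Phi> \<in> Form \<sigma> \<Longrightarrow> (\<^bold>\<not> \<^bold>\<box> \<Phi> \<^bold>\<leftrightarrow> \<^bold>\<diamond> \<^bold>\<not> \<Phi>) \<in> QBKo_axioms \<sigma>"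
| NegDia: "\<Phi> \<in> Form \<sigma> \<Longrightarrow> (\<^bold>\<not> \<^bold>\<diamond> \<Phi> \<^bold>\<leftrightarrow> \<^bold>\<box> \<^bold>\<not> \<Phi>) \<in> QBKo_axioms \<sigma>"
| BoxDia: "\<Phi> \<in> Form \<sigma> \<Longrightarrow> (\<^bold>\<box> \<Phi> \<^bold>\<Leftrightarrow> \<^bold>\<sim> \<^bold>\<diamond> \<^bold>\<sim> \<Phi>) \<in> QBKo_axioms \<sigma>"
| DiaBox: "\<Phi> \<in> Form \<sigma> \<Longrightarrow> (\<^bold>\<diamond> \<Phi> \<^bold>\<Leftrightarrow> \<^bold>\<sim> \<^bold>\<box> \<^bold>\<sim> \<Phi>) \<in> QBKo_axioms \<sigma>"
| AllE: "\<lbrakk>\<Phi> \<in> Form \<sigma>; wf_trm \<sigma> t; free_for t x \<Phi>\<rbrakk> \<Longrightarrow> Forall x \<Phi> \<^bold>\<rightarrow> inst \<Phi> x t \<in> QBKo_axioms \<sigma>"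
| ExI: "\<lbrakk>\<Phi> \<in> Form \<sigma>; wf_trm \<sigma> t; free_for t x \<Phi>\<rbrakk> \<Longrightarrow> inst \<Phi> x t \<^bold>\<rightarrow> Exists x \<Phi> \<in> QBKo_axioms \<sigma>"
| SNegAll: "\<Phi> \<in> Form \<sigma> \<Longrightarrow> (\<^bold>\<sim> (Forall x \<Phi>) \<^bold>\<leftrightarrow> Exists x (\<^bold>\<sim> \<Phi>)) \<in> QBKo_axioms \<sigma>"
| SNegEx: "\<Phi> \<in> Form \<sigma> \<Longrightarrow> (\<^bold>\<sim> (Exists x \<Phi>) \<^bold>\<leftrightarrow> Forall x (\<^bold>\<sim> \<Phi>)) \<in> QBKo_axioms \<sigma>"
| SEM: "\<Phi> \<in> Form \<sigma> \<Longrightarrow> \<Phi> \<^bold>\<or> \<^bold>\<sim> \<Phi> \<in> QBKo_axioms \<sigma>"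

inductive_set QBKo :: "('p, 'c) signature \<Rightarrow> ('p, 'c) fm set"
  for \<sigma> :: "('p, 'c) signature" where
  Ax: "\<Phi> \<in> QBKo_axioms \<sigma> \<Longrightarrow> \<Phi> \<in> QBKo \<sigma>"
| MP: "\<lbrakk>\<Phi> \<in> QBKo \<sigma>; \<Phi> \<^bold>\<rightarrow> \<Psi> \<in> QBKo \<sigma>\<rbrakk> \<Longrightarrow> \<Psi> \<in> QBKo \<sigma>"
| MB: "\<Phi> \<^bold>\<rightarrow> \<Psi> \<in> QBKo \<sigma> \<Longrightarrow> \<^bold>\<box> \<Phi> \<^bold>\<rightarrow> \<^bold>\<box> \<Psi> \<in> QBKo \<sigma>"
| MD: "\<Phi> \<^bold>\<rightarrow> \<Psi> \<in> QBKo \<sigma> \<Longrightarrow> \<^bold>\<diamond> \<Phi> \<^bold>\<rightarrow> \<^bold>\<diamond> \<Psi> \<in> QBKo \<sigma>"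
| BR1: "\<lbrakk>\<Phi> \<^bold>\<rightarrow> \<Psi> \<in> QBKo \<sigma>; x \<notin> fv \<Phi>\<rbrakk> \<Longrightarrow> \<Phi> \<^bold>\<rightarrow> Forall x \<Psi> \<in> QBKo \<sigma>"
| BR2: "\<lbrakk>\<Phi> \<^bold>\<rightarrow> \<Psi> \<in> QBKo \<sigma>; x \<notin> fv \<Psi>\<rbrakk> \<Longrightarrow> Exists x \<Phi> \<^bold>\<rightarrow> \<Psi> \<in> QBKo \<sigma>"

inductive_set QBKo_closure :: "('p, 'c) signature \<Rightarrow> ('p, 'c) fm set \<Rightarrow> ('p, 'c) fm set"
  for \<sigma> :: "('p, 'c) signature" and \<Gamma> :: "('p, 'c) fm set" where
  Hyp: "\<Phi> \<in> \<Gamma> \<union> QBKo \<sigma> \<Longrightarrow> \<Phi> \<in> QBKo_closure \<sigma> \<Gamma>"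
| MP: "\<lbrakk>\<Phi> \<in> QBKo_closure \<sigma> \<Gamma>; \<Phi> \<^bold>\<rightarrow> \<Psi> \<in> QBKo_closure \<sigma> \<Gamma>\<rbrakk> \<Longrightarrow> \<Psi> \<in> QBKo_closure \<sigma> \<Gamma>"
| BR1: "\<lbrakk>\<Phi> \<^bold>\<rightarrow> \<Psi> \<in> QBKo_closure \<sigma> \<Gamma>; x \<notin> fv \<Phi>\<rbrakk> \<Longrightarrow> \<Phi> \<^bold>\<rightarrow> Forall x \<Psi> \<in> QBKo_closure \<sigma> \<Gamma>"
| BR2: "\<lbrakk>\<Phi> \<^bold>\<rightarrow> \<Psi> \<in> QBKo_closure \<sigma> \<Gamma>; x \<notin> fv \<Psi>\<rbrakk> \<Longrightarrow> Exists x \<Phi> \<^bold>\<rightarrow> \<Psi> \<in> QBKo_closure \<sigma> \<Gamma>"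

fun disj :: "('p, 'c) fm list \<Rightarrow> ('p, 'c) fm" where
  "disj [] = \<^bold>\<bottom>"
| "disj [\<Phi>] = \<Phi>"
| "disj (\<Phi> # \<Psi> # \<Theta>s) = \<Phi> \<^bold>\<or> disj (\<Psi> # \<Theta>s)"

definition Disj :: "('p, 'c) fm set \<Rightarrow> ('p, 'c) fm set" where
  "Disj \<Delta> = {disj \<Phi>s | \<Phi>s. set \<Phi>s \<subseteq> \<Delta>}"

definition QBKo_derives :: "('p, 'c) signature \<Rightarrow> ('p, 'c) fm set \<Rightarrow> ('p, 'c) fm set \<Rightarrow> bool" where
  "QBKo_derives \<sigma> \<Gamma> \<Delta> \<longleftrightarrow> (\<exists>\<Phi>\<in>Disj \<Delta>. \<Phi> \<in> QBKo_closure \<sigma> \<Gamma>)"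

record ('p, 'c, 'a) struc =
  univ :: "'a set"
  cint :: "'c \<Rightarrow> 'a"
  pint :: "'p \<Rightarrow> 'a list set"

definition is_struc :: "('p, 'c) signature \<Rightarrow> ('p, 'c, 'a) struc \<Rightarrow> bool" where
  "is_struc \<sigma> \<AA> \<longleftrightarrow>
     univ \<AA> \<noteq> {} \<and>
     (\<forall>c\<in>csyms \<sigma>. cint \<AA> c \<in> univ \<AA>) \<and>
     (\<forall>p\<in>psyms \<sigma>. pint \<AA> p \<subseteq> {as. length as = arity \<sigma> p \<and> set as \<subseteq> univ \<AA>})"

text \<open>The language with names for the elements of \<open>A\<close>: a constant \<open>c\<close> of \<open>\<sigma>\<close> becomes \<open>Inl c\<close>, and
  \<open>Inr a\<close> is the name of \<open>a\<close>.\<close>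

definition expand_sig :: "('p, 'c) signature \<Rightarrow> 'a set \<Rightarrow> ('p, 'c + 'a) signature" where
  "expand_sig \<sigma> A =
     \<lparr>psyms = psyms \<sigma>, arity = arity \<sigma>, csyms = Inl ` csyms \<sigma> \<union> Inr ` A\<rparr>"

abbreviation embed :: "('p, 'c) fm \<Rightarrow> ('p, 'c + 'a) fm" where
  "embed \<equiv> map_fm id Inl"

text \<open>The clause for variables is irrelevant: only closed terms are evaluated.\<close>

primrec tval :: "('p, 'c, 'a) struc \<Rightarrow> ('c + 'a) trm \<Rightarrow> 'a" where
  "tval \<AA> (Var x) = undefined"
| "tval \<AA> (Const d) = (case d of Inl c \<Rightarrow> cint \<AA> c | Inr a \<Rightarrow> a)"

definition atom_true :: "('p, 'c, 'a) struc \<Rightarrow> 'p \<Rightarrow> ('c + 'a) trm list \<Rightarrow> bool" where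
  "atom_true \<AA> p ts \<longleftrightarrow> map (tval \<AA>) ts \<in> pint \<AA> p"

record ('w, 'p, 'c, 'a) model =
  worlds :: "'w set"
  acc :: "('w \<times> 'w) set"
  pos :: "'w \<Rightarrow> ('p, 'c, 'a) struc"
  neg :: "'w \<Rightarrow> ('p, 'c, 'a) struc"

definition QBK_model :: "('p, 'c) signature \<Rightarrow> ('w, 'p, 'c, 'a) model \<Rightarrow> bool" where
  "QBK_model \<sigma> M \<longleftrightarrow>
     worlds M \<noteq> {} \<and> acc M \<subseteq> worlds M \<times> worlds M \<and>
     (\<forall>w\<in>worlds M.
        is_struc \<sigma> (pos M w) \<and> is_struc \<sigma> (neg M w) \<and>
        univ (pos M w) = univ (neg M w) \<and>
        (\<forall>c\<in>csyms \<sigma>. cint (pos M w) c = cint (neg M w) c)) \<and>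
     (\<forall>(u, v)\<in>acc M.
        univ (pos M u) \<subseteq> univ (pos M v) \<and>
        (\<forall>c\<in>csyms \<sigma>. cint (pos M u) c = cint (pos M v) c))"

definition QBKo_model :: "('p, 'c) signature \<Rightarrow> ('w, 'p, 'c, 'a) model \<Rightarrow> bool" where
  "QBKo_model \<sigma> M \<longleftrightarrow>
     QBK_model \<sigma> M \<and>
     (\<forall>w\<in>worlds M. \<forall>p ts. Atom p ts \<in> Sent (expand_sig \<sigma> (univ (pos M w))) \<longrightarrow>
        atom_true (pos M w) p ts \<or> atom_true (neg M w) p ts)"

primrec rank :: "('p, 'c) fm \<Rightarrow> nat" where
  "rank (Atom p ts) = 0"
| "rank \<^bold>\<bottom> = 0"
| "rank (\<Phi> \<^bold>\<rightarrow> \<Psi>) = Suc (rank \<Phi> + rank \<Psi>)"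
| "rank (\<Phi> \<^bold>\<and> \<Psi>) = Suc (rank \<Phi> + rank \<Psi>)"
| "rank (\<Phi> \<^bold>\<or> \<Psi>) = Suc (rank \<Phi> + rank \<Psi>)"
| "rank (\<^bold>\<sim> \<Phi>) = Suc (rank \<Phi>)"
| "rank (\<^bold>\<box> \<Phi>) = Suc (rank \<Phi>)"
| "rank (\<^bold>\<diamond> \<Phi>) = Suc (rank \<Phi>)"
| "rank (Forall x \<Phi>) = Suc (rank \<Phi>)"
| "rank (Exists x \<Phi>) = Suc (rank \<Phi>)"

lemma rank_subst [simp]: "rank (subst s \<Phi>) = rank \<Phi>"
  by (induction \<Phi> arbitrary: s) auto

lemma rank_inst [simp]: "rank (inst \<Phi> x t) = rank \<Phi>"
  by (simp add: inst_def)

function verifies :: "('w, 'p, 'c, 'a) model \<Rightarrow> 'w \<Rightarrow> ('p, 'c + 'a) fm \<Rightarrow> bool"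
  and falsifies :: "('w, 'p, 'c, 'a) model \<Rightarrow> 'w \<Rightarrow> ('p, 'c + 'a) fm \<Rightarrow> bool" where
  "verifies M w (Atom p ts) \<longleftrightarrow> atom_true (pos M w) p ts"
| "verifies M w \<^bold>\<bottom> \<longleftrightarrow> False"
| "verifies M w (\<Phi> \<^bold>\<rightarrow> \<Psi>) \<longleftrightarrow> \<not> verifies M w \<Phi> \<or> verifies M w \<Psi>"
| "verifies M w (\<Phi> \<^bold>\<and> \<Psi>) \<longleftrightarrow> verifies M w \<Phi> \<and> verifies M w \<Psi>"
| "verifies M w (\<Phi> \<^bold>\<or> \<Psi>) \<longleftrightarrow> verifies M w \<Phi> \<or> verifies M w \<Psi>"
| "verifies M w (\<^bold>\<sim> \<Phi>) \<longleftrightarrow> falsifies M w \<Phi>"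
| "verifies M w (\<^bold>\<box> \<Phi>) \<longleftrightarrow> (\<forall>v. (w, v) \<in> acc M \<longrightarrow> verifies M v \<Phi>)"
| "verifies M w (\<^bold>\<diamond> \<Phi>) \<longleftrightarrow> (\<exists>v. (w, v) \<in> acc M \<and> verifies M v \<Phi>)"
| "verifies M w (Forall x \<Phi>) \<longleftrightarrow> (\<forall>a\<in>univ (pos M w). verifies M w (inst \<Phi> x (Const (Inr a))))"
| "verifies M w (Exists x \<Phi>) \<longleftrightarrow> (\<exists>a\<in>univ (pos M w). verifies M w (inst \<Phi> x (Const (Inr a))))"
| "falsifies M w (Atom p ts) \<longleftrightarrow> atom_true (neg M w) p ts"
| "falsifies M w \<^bold>\<bottom> \<longleftrightarrow> True"
| "falsifies M w (\<Phi> \<^bold>\<rightarrow> \<Psi>) \<longleftrightarrow> verifies M w \<Phi> \<and> falsifies M w \<Psi>"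
| "falsifies M w (\<Phi> \<^bold>\<and> \<Psi>) \<longleftrightarrow> falsifies M w \<Phi> \<or> falsifies M w \<Psi>"
| "falsifies M w (\<Phi> \<^bold>\<or> \<Psi>) \<longleftrightarrow> falsifies M w \<Phi> \<and> falsifies M w \<Psi>"
| "falsifies M w (\<^bold>\<sim> \<Phi>) \<longleftrightarrow> verifies M w \<Phi>"
| "falsifies M w (\<^bold>\<box> \<Phi>) \<longleftrightarrow> (\<exists>v. (w, v) \<in> acc M \<and> falsifies M v \<Phi>)"
| "falsifies M w (\<^bold>\<diamond> \<Phi>) \<longleftrightarrow> (\<forall>v. (w, v) \<in> acc M \<longrightarrow> falsifies M v \<Phi>)"
| "falsifies M w (Forall x \<Phi>) \<longleftrightarrow> (\<exists>a\<in>univ (pos M w). falsifies M w (inst \<Phi> x (Const (Inr a))))"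
| "falsifies M w (Exists x \<Phi>) \<longleftrightarrow> (\<forall>a\<in>univ (pos M w). falsifies M w (inst \<Phi> x (Const (Inr a))))"
  by pat_completeness auto
termination
  by (relation "measure (case_sum (\<lambda>(M, w, \<Phi>). rank \<Phi>) (\<lambda>(M, w, \<Phi>). rank \<Phi>))") auto

definition ground_subst :: "'a set \<Rightarrow> (nat \<Rightarrow> ('c + 'a) trm) \<Rightarrow> bool" where
  "ground_subst A \<theta> \<longleftrightarrow> (\<forall>x. \<exists>a\<in>A. \<theta> x = Const (Inr a))"

text \<open>Consequence over the models whose worlds and individuals are taken from the types \<open>'w\<close> and
  \<open>'a\<close>. HOL cannot quantify over types inside a definition, hence the two type arguments.\<close>

definition QBKo_entails ::
  "'w itself \<Rightarrow> 'a itself \<Rightarrow> ('p, 'c) signature \<Rightarrow> ('p, 'c) fm set \<Rightarrow> ('p, 'c) fm set \<Rightarrow> bool" where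
  "QBKo_entails TYPE('w) TYPE('a) \<sigma> \<Gamma> \<Delta> \<longleftrightarrow>
     (\<forall>M :: ('w, 'p, 'c, 'a) model. \<forall>w \<theta>.
        QBKo_model \<sigma> M \<longrightarrow> w \<in> worlds M \<longrightarrow> ground_subst (univ (pos M w)) \<theta> \<longrightarrow>
        (\<forall>\<Phi>\<in>\<Gamma>. verifies M w (embed \<Phi>)) \<longrightarrow>
        (\<exists>\<Psi>\<in>\<Delta>. verifies M w (subst \<theta> (embed \<Psi>))))"

end

theory Submission
  imports Defs
begin

text \<open>Soundness is a direct induction. For completeness, suppose that no disjunction of elements of
  \<open>\<Delta>\<close> is derivable from \<open>\<Gamma>\<close>. Replace the free variables of \<open>\<Delta>\<close> by fresh constants and build a canonical
  model whose worlds are pairs \<open>(n, T)\<close>, where \<open>T\<close> is a maximal consistent set of sentences over the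
  constants of level at most \<open>n\<close> that contains a Henkin axiom for every existential sentence of its
  language. A world of level \<open>n\<close> only sees worlds of level \<open>n + 1\<close>, so each step has a reserve of unused
  witnesses at its disposal and the domains increase; no Barcan formula is needed. The witness for
  \<open>\<exists>x \<Phi>\<close> is named by the formula \<open>\<Phi>\<close> itself, hence of finitely many Henkin axioms the one with the
  largest witness can always be removed first. Falsification of \<open>\<Phi>\<close> at \<open>T\<close> is membership of
  \<open>\<sim>\<Phi>\<close> in \<open>T\<close>; the axiom \<open>\<Phi> \<or> \<sim>\<Phi>\<close> makes every atom verified or falsified.\<close>

section \<open>Syntax\<close>

text \<open>Three obstacles shape the proof. Substitution never renames bound variables, so
  \<open>subst_subst\<close> is confined to substitutions that are ground wherever they are not the
  identity, and a constant may become a variable only if that variable is new to the whole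
  derivation. The Bernays rules, applied below hypotheses, would burden the deduction theorem with
  side conditions. Completeness therefore works with \<open>mpc\<close>, where hypotheses meet modus
  ponens alone; since \<open>mpc\<close> lies inside \<open>QBKo_closure\<close>, underivability
  carries over to it. Finally, HOL fixes the types of worlds and individuals in advance. The
  canonical model is copied into them along injections, so its Henkin constants have to be counted
  against the formulas of \<sigma>, and its worlds against the sets of such formulas. Names that are
  data of a recursive type make this count possible: they are finite trees over the symbols. Both
  directions replace the official clauses, which substitute names, by the relation
  \<open>sat\<close> with environments, so that structural induction reaches the body of a
  quantifier directly.\<close>

lemma subst_cong: "\<forall>x\<in>fv \<Phi>. s x = s' x \<Longrightarrow> subst s \<Phi> = subst s' \<Phi>"
proof (induction \<Phi> arbitrary: s s')
  case (Atom p ts)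
  have "tsubst s t = tsubst s' t" if "t \<in> set ts" for t
    using Atom that by (cases t) force+
  then show ?case by simp
next
  case (Forall x \<Phi>)
  show ?case by simp (rule Forall.IH, use Forall.prems in simp)
next
  case (Exists x \<Phi>)
  show ?case by simp (rule Exists.IH, use Exists.prems in simp)
qed (simp_all add: ball_Un)

lemma subst_Var [simp]: "subst Var \<Phi> = \<Phi>"
proof (induction \<Phi>)
  case (Atom p ts)
  have "tsubst Var t = t" for t :: "'b trm" by (cases t) auto
  then show ?case by (simp add: map_idI)
qed auto

lemma subst_sentence: "fv \<Phi> = {} \<Longrightarrow> subst s \<Phi> = \<Phi>"
  using subst_cong[of \<Phi> s Var] by simp

lemma fv_subst: "fv (subst s \<Phi>) \<subseteq> (\<Union>x\<in>fv \<Phi>. tvars (s x))"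
proof (induction \<Phi> arbitrary: s)
  case (Atom p ts)
  have "tvars (tsubst s t) \<subseteq> (\<Union>x\<in>tvars t. tvars (s x))" for t by (cases t) auto
  then show ?case by fastforce
next
  case (Forall x \<Phi>)
  have "fv (subst s (Forall x \<Phi>)) \<subseteq> (\<Union>z\<in>fv \<Phi>. tvars ((s(x := Var x)) z)) - {x}"
    using Forall.IH[of "s(x := Var x)"] by (simp del: fun_upd_apply) blast
  also have "\<dots> \<subseteq> (\<Union>z\<in>fv (Forall x \<Phi>). tvars (s z))" by (auto split: if_splits)
  finally show ?case .
next
  case (Exists x \<Phi>)
  have "fv (subst s (Exists x \<Phi>)) \<subseteq> (\<Union>z\<in>fv \<Phi>. tvars ((s(x := Var x)) z)) - {x}"
    using Exists.IH[of "s(x := Var x)"] by (simp del: fun_upd_apply) blast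
  also have "\<dots> \<subseteq> (\<Union>z\<in>fv (Exists x \<Phi>). tvars (s z))" by (auto split: if_splits)
  finally show ?case .
qed (simp_all; blast)+

lemma tsubst_ground: "tvars t = {} \<Longrightarrow> tsubst s t = t"
  by (cases t) auto

text \<open>Without renaming, composition can fail when \<open>s'\<close> brings a variable under a
  quantifier that binds it. A value that is ground, or the variable itself, is immune to
  this.\<close>

lemma subst_subst:
  assumes "\<And>x. s' x = Var x \<or> tvars (s' x) = {}"
  shows "subst s (subst s' \<Phi>) = subst (tsubst s \<circ> s') \<Phi>"
  using assms
proof (induction \<Phi> arbitrary: s s')
  case (Atom p ts)
  have "tsubst s (tsubst s' t) = tsubst (tsubst s \<circ> s') t" for t by (cases t) auto
  then show ?case by (simp del: comp_apply) (simp add: comp_def[of "tsubst s" "tsubst s'"])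
next
  case (Forall x \<Phi>)
  have "tsubst (s(x := Var x)) \<circ> s'(x := Var x) = (tsubst s \<circ> s')(x := Var x)"
  proof
    fix z
    show "(tsubst (s(x := Var x)) \<circ> s'(x := Var x)) z = ((tsubst s \<circ> s')(x := Var x)) z"
      using Forall.prems[of z] by (auto simp: tsubst_ground)
  qed
  moreover have "\<And>z. (s'(x := Var x)) z = Var z \<or> tvars ((s'(x := Var x)) z) = {}"
    using Forall.prems by simp
  ultimately show ?case using Forall.IH[of "s'(x := Var x)" "s(x := Var x)"] by (simp only: subst.simps)
next
  case (Exists x \<Phi>)
  have "tsubst (s(x := Var x)) \<circ> s'(x := Var x) = (tsubst s \<circ> s')(x := Var x)"
  proof
    fix z
    show "(tsubst (s(x := Var x)) \<circ> s'(x := Var x)) z = ((tsubst s \<circ> s')(x := Var x)) z"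
      using Exists.prems[of z] by (auto simp: tsubst_ground)
  qed
  moreover have "\<And>z. (s'(x := Var x)) z = Var z \<or> tvars ((s'(x := Var x)) z) = {}"
    using Exists.prems by simp
  ultimately show ?case using Exists.IH[of "s'(x := Var x)" "s(x := Var x)"] by (simp only: subst.simps)
qed simp_all

text \<open>Substitution below the quantifier skips \<open>x\<close> and \<open>inst\<close> fills
  the gap, which amounts to one ground substitution with an updated environment. The comparison of
  the two semantics and the truth lemma both treat quantifiers through this identity.\<close>

lemma inst_subst_ground:
  "inst (subst ((Const \<circ> e)(x := Var x)) \<Phi>) x (Const c) = subst (Const \<circ> e(x := c)) \<Phi>"
proof -
  have "tsubst (Var(x := Const c)) \<circ> (Const \<circ> e)(x := Var x) = Const \<circ> e(x := c)"
    by (auto simp: fun_eq_iff)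
  then show ?thesis by (simp add: inst_def subst_subst)
qed

lemma wf_fm_subst: "wf_fm \<sigma> \<Phi> \<Longrightarrow> (\<And>x. wf_trm \<sigma> (s x)) \<Longrightarrow> wf_fm \<sigma> (subst s \<Phi>)"
proof (induction \<Phi> arbitrary: s)
  case (Atom p ts)
  have "wf_trm \<sigma> t \<Longrightarrow> wf_trm \<sigma> (tsubst s t)" for t using Atom.prems by (cases t) auto
  then show ?case using Atom by auto
qed simp_all

text \<open>Separates the shape of a formula from its choice of constants; the second half bounds
  the constants that a formula of \<sigma> can contain.\<close>

lemma wf_fm_iff:
  "wf_fm \<sigma> \<Phi> \<longleftrightarrow> wf_fm (\<sigma>\<lparr>csyms := UNIV\<rparr>) \<Phi> \<and> set2_fm \<Phi> \<subseteq> csyms \<sigma>"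
proof (induction \<Phi>)
  case (Atom p ts)
  have t1: "wf_trm \<sigma> t \<longleftrightarrow> set_trm t \<subseteq> csyms \<sigma>" for t by (cases t) auto
  have t2: "wf_trm (\<sigma>\<lparr>csyms := UNIV\<rparr>) t" for t by (cases t) auto
  show ?case by (auto simp: t1 t2)
qed auto

lemma set1_fm_wf: "wf_fm \<sigma> \<Phi> \<Longrightarrow> set1_fm \<Phi> \<subseteq> psyms \<sigma>"
  by (induction \<Phi>) auto

lemma set2_fm_subst: "set2_fm (subst s \<Phi>) \<subseteq> set2_fm \<Phi> \<union> (\<Union>x\<in>fv \<Phi>. set_trm (s x))"
proof (induction \<Phi> arbitrary: s)
  case (Atom p ts)
  have "set_trm (tsubst s t) \<subseteq> set_trm t \<union> (\<Union>x\<in>tvars t. set_trm (s x))" for t by (cases t) auto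
  then show ?case by fastforce
next
  case (Forall x \<Phi>)
  have "set2_fm (subst s (Forall x \<Phi>)) \<subseteq> set2_fm \<Phi> \<union> (\<Union>z\<in>fv \<Phi>. set_trm ((s(x := Var x)) z))"
    using Forall.IH[of "s(x := Var x)"] by (simp del: fun_upd_apply)
  also have "\<dots> \<subseteq> set2_fm \<Phi> \<union> (\<Union>z\<in>fv (Forall x \<Phi>). set_trm (s z))" by (auto split: if_splits)
  finally show ?case by simp
next
  case (Exists x \<Phi>)
  have "set2_fm (subst s (Exists x \<Phi>)) \<subseteq> set2_fm \<Phi> \<union> (\<Union>z\<in>fv \<Phi>. set_trm ((s(x := Var x)) z))"
    using Exists.IH[of "s(x := Var x)"] by (simp del: fun_upd_apply)
  also have "\<dots> \<subseteq> set2_fm \<Phi> \<union> (\<Union>z\<in>fv (Exists x \<Phi>). set_trm (s z))" by (auto split: if_splits)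
  finally show ?case by simp
qed (simp_all; blast)+

lemma free_for_Const [simp]: "free_for (Const c) x \<Phi>"
  by (induction \<Phi>) auto

lemma free_for_Var_self [simp]: "free_for (Var x) x \<Phi>"
  by (induction \<Phi>) auto

lemma inst_Var_self [simp]: "inst \<Phi> x (Var x) = \<Phi>"
  by (simp add: inst_def)

lemma Form_simps [simp]:
  "\<^bold>\<bottom> \<in> Form \<sigma>"
  "(\<Phi> \<^bold>\<rightarrow> \<Psi>) \<in> Form \<sigma> \<longleftrightarrow> \<Phi> \<in> Form \<sigma> \<and> \<Psi> \<in> Form \<sigma>"
  "(\<Phi> \<^bold>\<and> \<Psi>) \<in> Form \<sigma> \<longleftrightarrow> \<Phi> \<in> Form \<sigma> \<and> \<Psi> \<in> Form \<sigma>"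
  "(\<Phi> \<^bold>\<or> \<Psi>) \<in> Form \<sigma> \<longleftrightarrow> \<Phi> \<in> Form \<sigma> \<and> \<Psi> \<in> Form \<sigma>"
  "\<^bold>\<sim> \<Phi> \<in> Form \<sigma> \<longleftrightarrow> \<Phi> \<in> Form \<sigma>"
  "\<^bold>\<box> \<Phi> \<in> Form \<sigma> \<longleftrightarrow> \<Phi> \<in> Form \<sigma>"
  "\<^bold>\<diamond> \<Phi> \<in> Form \<sigma> \<longleftrightarrow> \<Phi> \<in> Form \<sigma>"
  "Forall x \<Phi> \<in> Form \<sigma> \<longleftrightarrow> \<Phi> \<in> Form \<sigma>"
  "Exists x \<Phi> \<in> Form \<sigma> \<longleftrightarrow> \<Phi> \<in> Form \<sigma>"
  by (auto simp: Form_def)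

lemma inst_Form: "\<Phi> \<in> Form \<sigma> \<Longrightarrow> wf_trm \<sigma> t \<Longrightarrow> inst \<Phi> x t \<in> Form \<sigma>"
  by (simp add: Form_def inst_def wf_fm_subst)

lemma QBKo_axioms_Form: "\<Phi> \<in> QBKo_axioms \<sigma> \<Longrightarrow> \<Phi> \<in> Form \<sigma>"
  by (induction rule: QBKo_axioms.induct) (auto simp: inst_Form)

lemma QBKo_Form: "\<Phi> \<in> QBKo \<sigma> \<Longrightarrow> \<Phi> \<in> Form \<sigma>"
  by (induction rule: QBKo.induct) (auto simp: QBKo_axioms_Form)

section \<open>Semantics with environments, and soundness\<close>

text \<open>The values \<open>k\<close> of the constants do not depend on the world, which the
  rigidity of constants along \<open>acc\<close> permits, and the type of the constants is free. One
  relation \<open>sat\<close> can thereby serve formulas over \<sigma> as well as formulas over the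
  Henkin constants.\<close>

primrec teval :: "('d \<Rightarrow> 'a) \<Rightarrow> (nat \<Rightarrow> 'a) \<Rightarrow> 'd trm \<Rightarrow> 'a" where
  "teval k e (Var x) = e x"
| "teval k e (Const d) = k d"

text \<open>The Boolean argument selects verification (\<open>True\<close>) or falsification (\<open>False\<close>).\<close>

primrec sat :: "('w, 'p, 'c, 'a) model \<Rightarrow> ('d \<Rightarrow> 'a) \<Rightarrow> ('p, 'd) fm \<Rightarrow> bool \<Rightarrow> 'w \<Rightarrow> (nat \<Rightarrow> 'a) \<Rightarrow> bool" where
  "sat M k (Atom p ts) b w e \<longleftrightarrow> map (teval k e) ts \<in> pint (if b then pos M w else neg M w) p"
| "sat M k \<^bold>\<bottom> b w e \<longleftrightarrow> \<not> b"
| "sat M k (\<Phi> \<^bold>\<rightarrow> \<Psi>) b w e \<longleftrightarrow>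
    (if b then sat M k \<Phi> True w e \<longrightarrow> sat M k \<Psi> True w e
     else sat M k \<Phi> True w e \<and> sat M k \<Psi> False w e)"
| "sat M k (\<Phi> \<^bold>\<and> \<Psi>) b w e \<longleftrightarrow>
    (if b then sat M k \<Phi> b w e \<and> sat M k \<Psi> b w e else sat M k \<Phi> b w e \<or> sat M k \<Psi> b w e)"
| "sat M k (\<Phi> \<^bold>\<or> \<Psi>) b w e \<longleftrightarrow>
    (if b then sat M k \<Phi> b w e \<or> sat M k \<Psi> b w e else sat M k \<Phi> b w e \<and> sat M k \<Psi> b w e)"
| "sat M k (\<^bold>\<sim> \<Phi>) b w e \<longleftrightarrow> sat M k \<Phi> (\<not> b) w e"
| "sat M k (\<^bold>\<box> \<Phi>) b w e \<longleftrightarrow>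
    (if b then \<forall>v. (w, v) \<in> acc M \<longrightarrow> sat M k \<Phi> b v e else \<exists>v. (w, v) \<in> acc M \<and> sat M k \<Phi> b v e)"
| "sat M k (\<^bold>\<diamond> \<Phi>) b w e \<longleftrightarrow>
    (if b then \<exists>v. (w, v) \<in> acc M \<and> sat M k \<Phi> b v e else \<forall>v. (w, v) \<in> acc M \<longrightarrow> sat M k \<Phi> b v e)"
| "sat M k (Forall x \<Phi>) b w e \<longleftrightarrow>
    (if b then \<forall>a\<in>univ (pos M w). sat M k \<Phi> b w (e(x := a))
     else \<exists>a\<in>univ (pos M w). sat M k \<Phi> b w (e(x := a)))"
| "sat M k (Exists x \<Phi>) b w e \<longleftrightarrow>
    (if b then \<exists>a\<in>univ (pos M w). sat M k \<Phi> b w (e(x := a))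
     else \<forall>a\<in>univ (pos M w). sat M k \<Phi> b w (e(x := a)))"

lemma teval_cong:
  "(\<And>c. c \<in> set_trm t \<Longrightarrow> k c = k' c) \<Longrightarrow> (\<And>x. x \<in> tvars t \<Longrightarrow> e x = e' x) \<Longrightarrow>
    teval k e t = teval k' e' t"
  by (cases t) auto

lemma sat_cong:
  "(\<And>c. c \<in> set2_fm \<Phi> \<Longrightarrow> k c = k' c) \<Longrightarrow> (\<And>x. x \<in> fv \<Phi> \<Longrightarrow> e x = e' x) \<Longrightarrow>
    sat M k \<Phi> b w e = sat M k' \<Phi> b w e'"
proof (induction \<Phi> arbitrary: b w e e')
  case (Atom p ts)
  have "teval k e t = teval k' e' t" if "t \<in> set ts" for t
    by (rule teval_cong) (use Atom that in force)+
  then have "map (teval k e) ts = map (teval k' e') ts" by simp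
  then show ?case unfolding sat.simps by presburger
next
  case (Forall x \<Phi>)
  have "sat M k \<Phi> b w (e(x := a)) = sat M k' \<Phi> b w (e'(x := a))" for a b
    by (rule Forall.IH) (use Forall.prems in auto)
  then show ?case by (simp del: fun_upd_apply)
next
  case (Exists x \<Phi>)
  have "sat M k \<Phi> b w (e(x := a)) = sat M k' \<Phi> b w (e'(x := a))" for a b
    by (rule Exists.IH) (use Exists.prems in auto)
  then show ?case by (simp del: fun_upd_apply)
next
  case (Imp \<Phi> \<Psi>)
  have "sat M k \<Phi> b w e = sat M k' \<Phi> b w e'" "sat M k \<Psi> b w e = sat M k' \<Psi> b w e'" for b
    by (rule Imp.IH; use Imp.prems in auto)+
  then show ?case by simp
next
  case (Con \<Phi> \<Psi>)
  have "sat M k \<Phi> b w e = sat M k' \<Phi> b w e'" "sat M k \<Psi> b w e = sat M k' \<Psi> b w e'" for b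
    by (rule Con.IH; use Con.prems in auto)+
  then show ?case by simp
next
  case (Dis \<Phi> \<Psi>)
  have "sat M k \<Phi> b w e = sat M k' \<Phi> b w e'" "sat M k \<Psi> b w e = sat M k' \<Psi> b w e'" for b
    by (rule Dis.IH; use Dis.prems in auto)+
  then show ?case by simp
next
  case (SNeg \<Phi>)
  have "sat M k \<Phi> b w e = sat M k' \<Phi> b w e'" for b
    by (rule SNeg.IH) (use SNeg.prems in auto)
  then show ?case by simp
next
  case (Box \<Phi>)
  have "sat M k \<Phi> b w e = sat M k' \<Phi> b w e'" for b w
    by (rule Box.IH) (use Box.prems in auto)
  then show ?case by simp
next
  case (Dia \<Phi>)
  have "sat M k \<Phi> b w e = sat M k' \<Phi> b w e'" for b w
    by (rule Dia.IH) (use Dia.prems in auto)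
  then show ?case by simp
qed simp

lemma sat_fun_upd_fresh: "x \<notin> fv \<Phi> \<Longrightarrow> sat M k \<Phi> b w (e(x := a)) = sat M k \<Phi> b w e"
  by (rule sat_cong) auto

lemma sat_map_fm: "sat M k (map_fm id f \<Phi>) b w e = sat M (k \<circ> f) \<Phi> b w e"
proof (induction \<Phi> arbitrary: b w e)
  case (Atom p ts)
  have "teval k e (map_trm f t) = teval (k \<circ> f) e t" for t by (cases t) auto
  then show ?case by (simp add: comp_def)
qed simp_all

text \<open>Once the quantified variable \<open>z\<close> is known not to occur in \<open>t\<close>,
  updating the environment at \<open>z\<close> leaves the value of \<open>t\<close> alone, and the
  updates at \<open>x\<close> and \<open>z\<close> commute.\<close>

lemma sat_inst:
  "free_for t x \<Phi> \<Longrightarrow> sat M k (inst \<Phi> x t) b w e = sat M k \<Phi> b w (e(x := teval k e t))"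
proof (induction \<Phi> arbitrary: b w e)
  case (Atom p ts)
  have "teval k e (tsubst (Var(x := t)) t') = teval k (e(x := teval k e t)) t'" for t' by (cases t') auto
  then have "map (teval k e \<circ> tsubst (Var(x := t))) ts = map (teval k (e(x := teval k e t))) ts" by simp
  then show ?case by (simp only: inst_def subst.simps sat.simps map_map)
next
  case (Forall z \<Phi>)
  show ?case
  proof (cases "x \<in> fv (Forall z \<Phi>)")
    \<comment> \<open>This covers \<open>z = x\<close> as well: nothing is replaced, and the value
      of \<open>x\<close> has no influence.\<close>
    case False
    then have "inst (Forall z \<Phi>) x t = subst Var (Forall z \<Phi>)"
      unfolding inst_def by (intro subst_cong) auto
    then show ?thesis using False sat_fun_upd_fresh by (metis subst_Var)
  next
    case True
    then have z: "z \<noteq> x" "z \<notin> tvars t" "free_for t x \<Phi>" using Forall.prems by auto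
    have "inst (Forall z \<Phi>) x t = Forall z (inst \<Phi> x t)" using z by (simp add: inst_def fun_upd_twist fun_upd_idem)
    moreover have "teval k (e(z := a)) t = teval k e t" for a
      by (rule teval_cong) (use z in auto)
    ultimately show ?thesis using z Forall.IH by (simp add: fun_upd_twist del: fun_upd_apply)
  qed
next
  case (Exists z \<Phi>)
  show ?case
  proof (cases "x \<in> fv (Exists z \<Phi>)")
    case False
    then have "inst (Exists z \<Phi>) x t = subst Var (Exists z \<Phi>)"
      unfolding inst_def by (intro subst_cong) auto
    then show ?thesis using False sat_fun_upd_fresh by (metis subst_Var)
  next
    case True
    then have z: "z \<noteq> x" "z \<notin> tvars t" "free_for t x \<Phi>" using Exists.prems by auto
    have "inst (Exists z \<Phi>) x t = Exists z (inst \<Phi> x t)" using z by (simp add: inst_def fun_upd_twist fun_upd_idem)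
    moreover have "teval k (e(z := a)) t = teval k e t" for a
      by (rule teval_cong) (use z in auto)
    ultimately show ?thesis using z Exists.IH by (simp add: fun_upd_twist del: fun_upd_apply)
  qed
qed (simp_all add: inst_def)

text \<open>The official clauses instantiate with names of individuals; here the names of the values
  of \<open>e\<close> are traded for \<open>e\<close> itself. Both claims go through one induction
  because strong negation and falsified implications mix them. In the modal cases \<open>k\<close>
  remains correct at the successor since constants are rigid.\<close>

lemma verifies_falsifies_sat:
  assumes "QBK_model \<sigma> M"
  shows "\<Phi> \<in> Form \<sigma> \<Longrightarrow> w \<in> worlds M \<Longrightarrow> \<forall>c\<in>csyms \<sigma>. k c = cint (pos M w) c \<Longrightarrow>
    (verifies M w (subst (Const \<circ> (Inr \<circ> e)) (embed \<Phi>)) \<longleftrightarrow> sat M k \<Phi> True w e) \<and>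
    (falsifies M w (subst (Const \<circ> (Inr \<circ> e)) (embed \<Phi>)) \<longleftrightarrow> sat M k \<Phi> False w e)"
proof (induction \<Phi> arbitrary: w e)
  case (Atom p ts)
  have ts: "\<forall>t\<in>set ts. wf_trm \<sigma> t" using Atom by (simp add: Form_def)
  have neg: "\<forall>c\<in>csyms \<sigma>. cint (pos M w) c = cint (neg M w) c"
    using assms Atom.prems(2) by (simp add: QBK_model_def)
  let ?s = "tsubst (Const \<circ> (Inr \<circ> e)) \<circ> map_trm Inl"
  have "tval (pos M w) (?s t) = teval k e t" if "t \<in> set ts" for t
    using ts Atom.prems that by (cases t) force+
  moreover have "tval (neg M w) (?s t) = teval k e t" if "t \<in> set ts" for t
    using ts Atom.prems that neg by (cases t) force+
  ultimately have "map (tval (pos M w)) (map ?s ts) = map (teval k e) ts"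
    "map (tval (neg M w)) (map ?s ts) = map (teval k e) ts" by (simp_all del: comp_apply) (simp_all add: comp_def)
  then show ?case 
    by (simp only: atom_true_def fm.map subst.simps sat.simps verifies.simps falsifies.simps list.map_comp id_apply if_True if_False simp_thms)
next
  case (Box \<Phi>)
  have "(verifies M v (subst (Const \<circ> (Inr \<circ> e)) (embed \<Phi>)) \<longleftrightarrow> sat M k \<Phi> True v e) \<and>
    (falsifies M v (subst (Const \<circ> (Inr \<circ> e)) (embed \<Phi>)) \<longleftrightarrow> sat M k \<Phi> False v e)"
    if "(w, v) \<in> acc M" for v
    by (rule Box.IH) (use Box.prems assms that in \<open>auto simp: QBK_model_def\<close>)
  then show ?case by (auto simp del: comp_apply id_apply)
next
  case (Dia \<Phi>)
  have "(verifies M v (subst (Const \<circ> (Inr \<circ> e)) (embed \<Phi>)) \<longleftrightarrow> sat M k \<Phi> True v e) \<and>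
    (falsifies M v (subst (Const \<circ> (Inr \<circ> e)) (embed \<Phi>)) \<longleftrightarrow> sat M k \<Phi> False v e)"
    if "(w, v) \<in> acc M" for v
    by (rule Dia.IH) (use Dia.prems assms that in \<open>auto simp: QBK_model_def\<close>)
  then show ?case by (auto simp del: comp_apply id_apply)
next
  case (Forall x \<Phi>)
  have [simp]: "Inr \<circ> e(x := a) = (Inr \<circ> e)(x := Inr a)" for a by auto
  have "(verifies M w (subst (Const \<circ> (Inr \<circ> e(x := a))) (embed \<Phi>)) \<longleftrightarrow> sat M k \<Phi> True w (e(x := a))) \<and>
    (falsifies M w (subst (Const \<circ> (Inr \<circ> e(x := a))) (embed \<Phi>)) \<longleftrightarrow> sat M k \<Phi> False w (e(x := a)))" for a
    by (rule Forall.IH) (use Forall.prems in auto)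
  then show ?case by (simp add: inst_subst_ground del: comp_apply id_apply)
next
  case (Exists x \<Phi>)
  have [simp]: "Inr \<circ> e(x := a) = (Inr \<circ> e)(x := Inr a)" for a by auto
  have "(verifies M w (subst (Const \<circ> (Inr \<circ> e(x := a))) (embed \<Phi>)) \<longleftrightarrow> sat M k \<Phi> True w (e(x := a))) \<and>
    (falsifies M w (subst (Const \<circ> (Inr \<circ> e(x := a))) (embed \<Phi>)) \<longleftrightarrow> sat M k \<Phi> False w (e(x := a)))" for a
    by (rule Exists.IH) (use Exists.prems in auto)
  then show ?case by (simp add: inst_subst_ground del: comp_apply id_apply)
qed auto

section \<open>Soundness of the axioms and rules\<close>

lemma teval_univ:
  "wf_trm \<sigma> t \<Longrightarrow> \<forall>c\<in>csyms \<sigma>. k c \<in> A \<Longrightarrow> \<forall>x. e x \<in> A \<Longrightarrow> teval k e t \<in> A"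
  by (cases t) auto

lemma QBKo_model_acc:
  assumes "QBKo_model \<sigma> M" "(w, v) \<in> acc M"
  shows "v \<in> worlds M" "univ (pos M w) \<subseteq> univ (pos M v)"
  using assms unfolding QBKo_model_def QBK_model_def by blast+

text \<open>The model condition covers atoms only, and the property climbs through all connectives:
  an implication that is not verified has a verified antecedent and, by induction, a falsified
  consequent. Values must lie in the domain of \<open>w\<close>, where the atomic condition speaks,
  and they stay in the domains of successors because domains grow.\<close>

lemma sat_True_or_False:
  assumes M: "QBKo_model \<sigma> M"
  shows "\<Phi> \<in> Form \<sigma> \<Longrightarrow> w \<in> worlds M \<Longrightarrow> \<forall>c\<in>csyms \<sigma>. k c \<in> univ (pos M w) \<Longrightarrow>
    \<forall>x. e x \<in> univ (pos M w) \<Longrightarrow> sat M k \<Phi> True w e \<or> sat M k \<Phi> False w e"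
proof (induction \<Phi> arbitrary: w e)
  case (Atom p ts)
  \<comment> \<open>The model condition concerns closed atoms of the expanded language, so each term
    is replaced by the name of its value.\<close>
  let ?ts = "map (\<lambda>t. Const (Inr (teval k e t))) ts"
  have "Atom p ?ts \<in> Sent (expand_sig \<sigma> (univ (pos M w)))"
    using Atom.prems teval_univ[of \<sigma> _ k "univ (pos M w)" e]
    by (auto simp: Sent_def Form_def expand_sig_def)
  then have "atom_true (pos M w) p ?ts \<or> atom_true (neg M w) p ?ts"
    using M Atom.prems(2) unfolding QBKo_model_def by blast
  then show ?case by (simp add: atom_true_def comp_def)
next
  case (Box \<Phi>)
  have "sat M k \<Phi> True v e \<or> sat M k \<Phi> False v e" if "(w, v) \<in> acc M" for v
    by (rule Box.IH) (use Box.prems QBKo_model_acc[OF M that] in auto)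
  then show ?case by auto
next
  case (Dia \<Phi>)
  have "sat M k \<Phi> True v e \<or> sat M k \<Phi> False v e" if "(w, v) \<in> acc M" for v
    by (rule Dia.IH) (use Dia.prems QBKo_model_acc[OF M that] in auto)
  then show ?case by auto
next
  case (Forall x \<Phi>)
  have "sat M k \<Phi> True w (e(x := a)) \<or> sat M k \<Phi> False w (e(x := a))" if "a \<in> univ (pos M w)" for a
    by (rule Forall.IH) (use Forall.prems that in auto)
  then show ?case by auto
next
  case (Exists x \<Phi>)
  have "sat M k \<Phi> True w (e(x := a)) \<or> sat M k \<Phi> False w (e(x := a))" if "a \<in> univ (pos M w)" for a
    by (rule Exists.IH) (use Exists.prems that in auto)
  then show ?case by auto
next
  case (Imp \<Phi> \<Psi>)
  then show ?case by (auto simp del: split_paired_All)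
qed auto

lemma QBKo_axioms_sound:
  assumes M: "QBKo_model \<sigma> M" and w: "w \<in> worlds M"
    and k: "\<forall>c\<in>csyms \<sigma>. k c \<in> univ (pos M w)" and e: "\<forall>x. e x \<in> univ (pos M w)"
  shows "\<Phi> \<in> QBKo_axioms \<sigma> \<Longrightarrow> sat M k \<Phi> True w e"
proof (induction rule: QBKo_axioms.induct)
  case (AllE \<Phi> t x)
  then show ?case using teval_univ[OF _ k e] by (auto simp: sat_inst)
next
  case (ExI \<Phi> t x)
  then show ?case using teval_univ[OF _ k e] by (auto simp: sat_inst)
next
  case (SEM \<Phi>)
  then show ?case using sat_True_or_False[OF M _ w k e] by auto
qed auto

text \<open>World and environment are generalized: \<open>MB\<close> and \<open>MD\<close> use the
  premise at successors, the Bernays rules use it under updated environments.\<close>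

lemma QBKo_sound:
  assumes M: "QBKo_model \<sigma> M"
  shows "\<Phi> \<in> QBKo \<sigma> \<Longrightarrow> w \<in> worlds M \<Longrightarrow> \<forall>c\<in>csyms \<sigma>. k c \<in> univ (pos M w) \<Longrightarrow>
    \<forall>x. e x \<in> univ (pos M w) \<Longrightarrow> sat M k \<Phi> True w e"
proof (induction arbitrary: w e rule: QBKo.induct)
  case (Ax \<Phi>)
  then show ?case using QBKo_axioms_sound[OF M] by blast
next
  case (MP \<Phi> \<Psi>)
  then show ?case by fastforce
next
  case (MB \<Phi> \<Psi>)
  have "sat M k (\<Phi> \<^bold>\<rightarrow> \<Psi>) True v e" if "(w, v) \<in> acc M" for v
    by (rule MB.IH) (use MB.prems QBKo_model_acc[OF M that] in auto)
  then show ?case by auto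
next
  case (MD \<Phi> \<Psi>)
  have "sat M k (\<Phi> \<^bold>\<rightarrow> \<Psi>) True v e" if "(w, v) \<in> acc M" for v
    by (rule MD.IH) (use MD.prems QBKo_model_acc[OF M that] in auto)
  then show ?case by auto
next
  case (BR1 \<Phi> \<Psi> x)
  have "sat M k (\<Phi> \<^bold>\<rightarrow> \<Psi>) True w (e(x := a))" if "a \<in> univ (pos M w)" for a
    by (rule BR1.IH) (use BR1.prems that in auto)
  then show ?case using BR1.hyps by (auto simp: sat_fun_upd_fresh)
next
  case (BR2 \<Phi> \<Psi> x)
  have "sat M k (\<Phi> \<^bold>\<rightarrow> \<Psi>) True w (e(x := a))" if "a \<in> univ (pos M w)" for a
    by (rule BR2.IH) (use BR2.prems that in auto)
  then show ?case using BR2.hyps by (auto simp: sat_fun_upd_fresh)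
qed

text \<open>No modal rule applies to hypotheses, so the world stays fixed. The Bernays rules do
  change the environment, hence the hypotheses are assumed under every environment, as is justified
  for sentences.\<close>

lemma QBKo_closure_sound:
  assumes M: "QBKo_model \<sigma> M" and w: "w \<in> worlds M"
    and k: "\<forall>c\<in>csyms \<sigma>. k c \<in> univ (pos M w)"
    and \<Gamma>: "\<And>\<Phi> e. \<Phi> \<in> \<Gamma> \<Longrightarrow> sat M k \<Phi> True w e"
  shows "\<Phi> \<in> QBKo_closure \<sigma> \<Gamma> \<Longrightarrow> \<forall>x. e x \<in> univ (pos M w) \<Longrightarrow> sat M k \<Phi> True w e"
proof (induction arbitrary: e rule: QBKo_closure.induct)
  case (Hyp \<Phi>)
  then show ?case using \<Gamma> QBKo_sound[OF M _ w k] by blast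
next
  case (MP \<Phi> \<Psi>)
  then show ?case by fastforce
next
  case (BR1 \<Phi> \<Psi> x)
  have "sat M k (\<Phi> \<^bold>\<rightarrow> \<Psi>) True w (e(x := a))" if "a \<in> univ (pos M w)" for a
    by (rule BR1.IH) (use BR1.prems that in auto)
  then show ?case using BR1.hyps by (auto simp: sat_fun_upd_fresh)
next
  case (BR2 \<Phi> \<Psi> x)
  have "sat M k (\<Phi> \<^bold>\<rightarrow> \<Psi>) True w (e(x := a))" if "a \<in> univ (pos M w)" for a
    by (rule BR2.IH) (use BR2.prems that in auto)
  then show ?case using BR2.hyps by (auto simp: sat_fun_upd_fresh)
qed

lemma sat_disj: "sat M k (disj \<Phi>s) True w e \<longleftrightarrow> (\<exists>\<Phi>\<in>set \<Phi>s. sat M k \<Phi> True w e)"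
  by (induction \<Phi>s rule: disj.induct) auto

lemma fv_map_fm [simp]: "fv (map_fm f g \<Phi>) = fv \<Phi>"
proof (induction \<Phi>)
  case (Atom p ts)
  have "tvars (map_trm g t) = tvars t" for t by (cases t) auto
  then show ?case by simp
qed auto

lemma verifies_sat:
  assumes "QBK_model \<sigma> M" "\<Phi> \<in> Form \<sigma>" "w \<in> worlds M"
  shows "verifies M w (subst (Const \<circ> (Inr \<circ> e)) (embed \<Phi>)) \<longleftrightarrow> sat M (cint (pos M w)) \<Phi> True w e"
  using verifies_falsifies_sat[OF assms(1), of \<Phi> w "cint (pos M w)" e] assms by simp

lemma verifies_sat_sentence:
  assumes "QBK_model \<sigma> M" "\<Phi> \<in> Sent \<sigma>" "w \<in> worlds M"
  shows "verifies M w (embed \<Phi>) \<longleftrightarrow> sat M (cint (pos M w)) \<Phi> True w e"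
  using verifies_sat[of \<sigma> M \<Phi> w e] assms by (simp add: Sent_def subst_sentence del: comp_apply)

theorem soundness:
  fixes \<sigma> :: "('p, 'c) signature"
  assumes \<Gamma>: "\<Gamma> \<subseteq> Sent \<sigma>" and \<Delta>: "\<Delta> \<subseteq> Form \<sigma>" and "QBKo_derives \<sigma> \<Gamma> \<Delta>"
  shows "QBKo_entails TYPE('w) TYPE('a) \<sigma> \<Gamma> \<Delta>"
  unfolding QBKo_entails_def
proof (intro allI impI)
  fix M :: "('w, 'p, 'c, 'a) model" and w and \<theta> :: "nat \<Rightarrow> ('c + 'a) trm"
  assume M: "QBKo_model \<sigma> M" and w: "w \<in> worlds M" and \<theta>: "ground_subst (univ (pos M w)) \<theta>"
    and ver: "\<forall>\<Phi>\<in>\<Gamma>. verifies M w (embed \<Phi>)"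
  obtain \<Psi>s where \<Psi>s: "set \<Psi>s \<subseteq> \<Delta>" "disj \<Psi>s \<in> QBKo_closure \<sigma> \<Gamma>"
    using assms(3) unfolding QBKo_derives_def Disj_def by blast
  have M': "QBK_model \<sigma> M" using M by (simp add: QBKo_model_def)
  obtain e where e: "\<forall>x. e x \<in> univ (pos M w) \<and> \<theta> x = Const (Inr (e x))"
    using \<theta> unfolding ground_subst_def by metis
  then have \<theta>_eq: "\<theta> = Const \<circ> (Inr \<circ> e)" by auto
  have k: "\<forall>c\<in>csyms \<sigma>. cint (pos M w) c \<in> univ (pos M w)"
    using M' w by (simp add: QBK_model_def is_struc_def)
  have "sat M (cint (pos M w)) (disj \<Psi>s) True w e"
    by (rule QBKo_closure_sound[OF M w k _ \<Psi>s(2)])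
      (use verifies_sat_sentence[OF M' _ w] ver \<Gamma> e in blast)+
  then show "\<exists>\<Psi>\<in>\<Delta>. verifies M w (subst \<theta> (embed \<Psi>))"
    using \<Psi>s(1) \<Delta> verifies_sat[OF M' _ w] unfolding \<theta>_eq sat_disj by blast
qed

section \<open>Derivability by modus ponens alone\<close>

text \<open>Theorems arrive closed under all rules, and hypotheses are combined by modus ponens
  only. The deduction theorem then holds for open formulas without any condition on their
  variables.\<close>

inductive_set mpc :: "('p, 'c) signature \<Rightarrow> ('p, 'c) fm set \<Rightarrow> ('p, 'c) fm set"
  for \<sigma> :: "('p, 'c) signature" and \<Gamma> :: "('p, 'c) fm set" where
  Hyp: "\<Phi> \<in> \<Gamma> \<Longrightarrow> \<Phi> \<in> mpc \<sigma> \<Gamma>"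
| Thm: "\<Phi> \<in> QBKo \<sigma> \<Longrightarrow> \<Phi> \<in> mpc \<sigma> \<Gamma>"
| MP: "\<lbrakk>\<Phi> \<in> mpc \<sigma> \<Gamma>; \<Phi> \<^bold>\<rightarrow> \<Psi> \<in> mpc \<sigma> \<Gamma>\<rbrakk> \<Longrightarrow> \<Psi> \<in> mpc \<sigma> \<Gamma>"

lemma mpc_Ax: "\<Phi> \<in> QBKo_axioms \<sigma> \<Longrightarrow> \<Phi> \<in> mpc \<sigma> \<Gamma>"
  by (intro mpc.Thm QBKo.Ax)

lemma mpc_mono: "\<Phi> \<in> mpc \<sigma> \<Gamma> \<Longrightarrow> \<Gamma> \<subseteq> \<Gamma>' \<Longrightarrow> \<Phi> \<in> mpc \<sigma> \<Gamma>'"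
  by (induction rule: mpc.induct) (auto intro: mpc.intros)

lemma mpc_empty: "\<Phi> \<in> mpc \<sigma> {} \<Longrightarrow> \<Phi> \<in> QBKo \<sigma>"
  by (induction rule: mpc.induct) (auto intro: QBKo.MP)

lemma mpc_Form: "\<Phi> \<in> mpc \<sigma> \<Gamma> \<Longrightarrow> \<Gamma> \<subseteq> Form \<sigma> \<Longrightarrow> \<Phi> \<in> Form \<sigma>"
  by (induction rule: mpc.induct) (auto simp: QBKo_Form)

lemma mpc_subset_closure: "mpc \<sigma> \<Gamma> \<subseteq> QBKo_closure \<sigma> \<Gamma>"
proof
  fix \<Phi> assume "\<Phi> \<in> mpc \<sigma> \<Gamma>"
  then show "\<Phi> \<in> QBKo_closure \<sigma> \<Gamma>"
    by (induction rule: mpc.induct) (auto intro: QBKo_closure.intros)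
qed

lemma mpc_compact: "\<Phi> \<in> mpc \<sigma> \<Gamma> \<Longrightarrow> \<exists>\<Gamma>0. finite \<Gamma>0 \<and> \<Gamma>0 \<subseteq> \<Gamma> \<and> \<Phi> \<in> mpc \<sigma> \<Gamma>0"
proof (induction rule: mpc.induct)
  case (Hyp \<Phi>)
  then show ?case by (intro exI[of _ "{\<Phi>}"]) (auto intro: mpc.Hyp)
next
  case (Thm \<Phi>)
  then show ?case by (intro exI[of _ "{}"]) (auto intro: mpc.Thm)
next
  case (MP \<Phi> \<Psi>)
  then obtain \<Gamma>1 \<Gamma>2 where "finite \<Gamma>1" "\<Gamma>1 \<subseteq> \<Gamma>" "\<Phi> \<in> mpc \<sigma> \<Gamma>1"
    "finite \<Gamma>2" "\<Gamma>2 \<subseteq> \<Gamma>" "(\<Phi> \<^bold>\<rightarrow> \<Psi>) \<in> mpc \<sigma> \<Gamma>2" by blast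
  then show ?case
    by (intro exI[of _ "\<Gamma>1 \<union> \<Gamma>2"]) (auto intro: mpc.MP[of \<Phi>] mpc_mono)
qed

lemma mpc_K: "\<Psi> \<in> mpc \<sigma> \<Gamma> \<Longrightarrow> \<Phi> \<in> Form \<sigma> \<Longrightarrow> \<Psi> \<in> Form \<sigma> \<Longrightarrow> \<Phi> \<^bold>\<rightarrow> \<Psi> \<in> mpc \<sigma> \<Gamma>"
  by (meson mpc.MP mpc_Ax ImpK)

lemma mpc_refl: assumes "\<Phi> \<in> Form \<sigma>" shows "\<Phi> \<^bold>\<rightarrow> \<Phi> \<in> mpc \<sigma> \<Gamma>"
proof -
  have "(\<Phi> \<^bold>\<rightarrow> ((\<Phi> \<^bold>\<rightarrow> \<Phi>) \<^bold>\<rightarrow> \<Phi>)) \<^bold>\<rightarrow> ((\<Phi> \<^bold>\<rightarrow> (\<Phi> \<^bold>\<rightarrow> \<Phi>)) \<^bold>\<rightarrow> (\<Phi> \<^bold>\<rightarrow> \<Phi>)) \<in> mpc \<sigma> \<Gamma>"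
    using assms by (intro mpc_Ax ImpS) auto
  moreover have "\<Phi> \<^bold>\<rightarrow> ((\<Phi> \<^bold>\<rightarrow> \<Phi>) \<^bold>\<rightarrow> \<Phi>) \<in> mpc \<sigma> \<Gamma>" using assms by (intro mpc_Ax ImpK) auto
  moreover have "\<Phi> \<^bold>\<rightarrow> (\<Phi> \<^bold>\<rightarrow> \<Phi>) \<in> mpc \<sigma> \<Gamma>" using assms by (intro mpc_Ax ImpK) auto
  ultimately show ?thesis by (meson mpc.MP)
qed

lemma mpc_deduction:
  assumes "\<Gamma> \<subseteq> Form \<sigma>" "\<Phi> \<in> Form \<sigma>"
  shows "\<Psi> \<in> mpc \<sigma> (insert \<Phi> \<Gamma>) \<Longrightarrow> \<Phi> \<^bold>\<rightarrow> \<Psi> \<in> mpc \<sigma> \<Gamma>"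
proof (induction rule: mpc.induct)
  case (Hyp \<Psi>)
  then show ?case using assms by (auto intro: mpc_refl mpc_K mpc.Hyp)
next
  case (Thm \<Psi>)
  then show ?case using assms by (auto intro: mpc_K mpc.Thm QBKo_Form)
next
  case (MP \<Psi> \<Theta>)
  have "\<Psi> \<^bold>\<rightarrow> \<Theta> \<in> Form \<sigma>" using MP.hyps assms by (meson mpc_Form insert_subset)
  then have "(\<Phi> \<^bold>\<rightarrow> (\<Psi> \<^bold>\<rightarrow> \<Theta>)) \<^bold>\<rightarrow> ((\<Phi> \<^bold>\<rightarrow> \<Psi>) \<^bold>\<rightarrow> (\<Phi> \<^bold>\<rightarrow> \<Theta>)) \<in> mpc \<sigma> \<Gamma>"
    using assms by (intro mpc_Ax ImpS) auto
  then show ?case using MP.IH by (meson mpc.MP)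
qed

lemma mpc_trans: "\<Phi> \<in> mpc \<sigma> \<Gamma>' \<Longrightarrow> \<Gamma>' \<subseteq> mpc \<sigma> \<Gamma> \<Longrightarrow> \<Phi> \<in> mpc \<sigma> \<Gamma>"
  by (induction rule: mpc.induct) (auto intro: mpc.Thm mpc.MP)

lemma mpc_cut: "\<Phi> \<in> mpc \<sigma> \<Gamma> \<Longrightarrow> \<Psi> \<in> mpc \<sigma> (insert \<Phi> \<Gamma>) \<Longrightarrow> \<Psi> \<in> mpc \<sigma> \<Gamma>"
  by (erule mpc_trans) (auto intro: mpc.Hyp)

lemma mpc_ConI: "\<Phi> \<in> mpc \<sigma> \<Gamma> \<Longrightarrow> \<Psi> \<in> mpc \<sigma> \<Gamma> \<Longrightarrow> \<Gamma> \<subseteq> Form \<sigma> \<Longrightarrow> \<Phi> \<^bold>\<and> \<Psi> \<in> mpc \<sigma> \<Gamma>"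
  by (meson mpc.MP mpc_Ax ConI mpc_Form)

lemma mpc_ConE:
  assumes "\<Phi> \<^bold>\<and> \<Psi> \<in> mpc \<sigma> \<Gamma>" "\<Gamma> \<subseteq> Form \<sigma>"
  shows "\<Phi> \<in> mpc \<sigma> \<Gamma>" "\<Psi> \<in> mpc \<sigma> \<Gamma>"
proof -
  have "\<Phi> \<in> Form \<sigma>" "\<Psi> \<in> Form \<sigma>" using mpc_Form[OF assms] by auto
  then show "\<Phi> \<in> mpc \<sigma> \<Gamma>" "\<Psi> \<in> mpc \<sigma> \<Gamma>"
    using assms(1) by (meson mpc.MP mpc_Ax ConE1 ConE2)+
qed

lemma mpc_BotE: "\<^bold>\<bottom> \<in> mpc \<sigma> \<Gamma> \<Longrightarrow> \<Phi> \<in> Form \<sigma> \<Longrightarrow> \<Phi> \<in> mpc \<sigma> \<Gamma>"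
  by (meson mpc.MP mpc_Ax BotE)

lemma mpc_DisI:
  assumes "\<Phi> \<in> Form \<sigma>" "\<Psi> \<in> Form \<sigma>" "\<Phi> \<in> mpc \<sigma> \<Gamma> \<or> \<Psi> \<in> mpc \<sigma> \<Gamma>"
  shows "\<Phi> \<^bold>\<or> \<Psi> \<in> mpc \<sigma> \<Gamma>"
  using assms by (meson mpc.MP mpc_Ax DisI1 DisI2)

lemma mpc_DisE:
  assumes "\<Phi> \<^bold>\<or> \<Psi> \<in> mpc \<sigma> \<Gamma>" "\<Theta> \<in> mpc \<sigma> (insert \<Phi> \<Gamma>)" "\<Theta> \<in> mpc \<sigma> (insert \<Psi> \<Gamma>)" "\<Gamma> \<subseteq> Form \<sigma>"
  shows "\<Theta> \<in> mpc \<sigma> \<Gamma>"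
proof -
  have F: "\<Phi> \<in> Form \<sigma>" "\<Psi> \<in> Form \<sigma>" using mpc_Form[OF assms(1,4)] by auto
  then have "\<Theta> \<in> Form \<sigma>" using assms(2,4) mpc_Form by (metis insert_subset)
  then have "(\<Phi> \<^bold>\<rightarrow> \<Theta>) \<^bold>\<rightarrow> ((\<Psi> \<^bold>\<rightarrow> \<Theta>) \<^bold>\<rightarrow> ((\<Phi> \<^bold>\<or> \<Psi>) \<^bold>\<rightarrow> \<Theta>)) \<in> mpc \<sigma> \<Gamma>"
    using F by (intro mpc_Ax DisE)
  moreover have "\<Phi> \<^bold>\<rightarrow> \<Theta> \<in> mpc \<sigma> \<Gamma>" "\<Psi> \<^bold>\<rightarrow> \<Theta> \<in> mpc \<sigma> \<Gamma>" using assms F mpc_deduction by blast+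
  ultimately show ?thesis using assms(1) by (meson mpc.MP)
qed

lemma mpc_ccontr:
  assumes "\<^bold>\<bottom> \<in> mpc \<sigma> (insert (\<^bold>\<not> \<Phi>) \<Gamma>)" "\<Phi> \<in> Form \<sigma>" "\<Gamma> \<subseteq> Form \<sigma>"
  shows "\<Phi> \<in> mpc \<sigma> \<Gamma>"
proof (rule mpc_DisE)
  show "\<Phi> \<^bold>\<or> \<^bold>\<not> \<Phi> \<in> mpc \<sigma> \<Gamma>" using assms by (intro mpc_Ax EM)
qed (use assms in \<open>auto intro: mpc.Hyp mpc_BotE\<close>)

text \<open>The conjunction of the hypotheses used is a single sentence: this makes the Bernays rules
  admissible over sets of sentences.\<close>

lemma mpc_single_hypothesis:
  assumes "\<Gamma> \<subseteq> Sent \<sigma>"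
  shows "\<Phi> \<in> mpc \<sigma> \<Gamma> \<Longrightarrow> \<exists>G \<in> mpc \<sigma> \<Gamma>. G \<in> Sent \<sigma> \<and> G \<^bold>\<rightarrow> \<Phi> \<in> QBKo \<sigma>"
proof (induction rule: mpc.induct)
  case (Hyp \<Phi>)
  then have "\<Phi> \<in> Sent \<sigma>" using assms by blast
  moreover have "\<Phi> \<^bold>\<rightarrow> \<Phi> \<in> QBKo \<sigma>"
    using calculation by (intro mpc_empty mpc_refl) (simp add: Sent_def)
  ultimately show ?case using Hyp mpc.Hyp by blast
next
  case (Thm \<Phi>)
  have "(\<^bold>\<not> \<^bold>\<bottom>) \<^bold>\<rightarrow> \<Phi> \<in> QBKo \<sigma>"
    using Thm by (intro mpc_empty mpc_K) (auto intro: mpc.Thm simp: QBKo_Form)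
  moreover have "\<^bold>\<not> \<^bold>\<bottom> \<in> mpc \<sigma> \<Gamma>" by (intro mpc_refl) simp
  ultimately show ?case by (intro bexI[of _ "\<^bold>\<not> \<^bold>\<bottom>"]) (auto simp: Sent_def)
next
  case (MP \<Phi> \<Psi>)
  then obtain G H where G: "G \<in> mpc \<sigma> \<Gamma>" "G \<in> Sent \<sigma>" "G \<^bold>\<rightarrow> \<Phi> \<in> QBKo \<sigma>"
    and H: "H \<in> mpc \<sigma> \<Gamma>" "H \<in> Sent \<sigma>" "H \<^bold>\<rightarrow> (\<Phi> \<^bold>\<rightarrow> \<Psi>) \<in> QBKo \<sigma>" by blast
  have GH: "G \<^bold>\<and> H \<in> Form \<sigma>" using G H by (simp add: Sent_def)
  have "G \<in> mpc \<sigma> {G \<^bold>\<and> H}" "H \<in> mpc \<sigma> {G \<^bold>\<and> H}"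
    using mpc_ConE[of G H \<sigma> "{G \<^bold>\<and> H}"] GH by (auto intro: mpc.Hyp)
  then have "\<Psi> \<in> mpc \<sigma> {G \<^bold>\<and> H}" using G(3) H(3) by (meson mpc.MP mpc.Thm)
  then have "(G \<^bold>\<and> H) \<^bold>\<rightarrow> \<Psi> \<in> QBKo \<sigma>" using GH by (intro mpc_empty mpc_deduction) auto
  moreover have "G \<^bold>\<and> H \<in> mpc \<sigma> \<Gamma>" using G H assms by (intro mpc_ConI) (auto simp: Sent_def)
  ultimately show ?case using G H by (intro bexI[of _ "G \<^bold>\<and> H"]) (auto simp: Sent_def)
qed

text \<open>\<open>mpc_single_hypothesis\<close> condenses the hypotheses into one sentence
  \<open>G\<close>. Joined to the antecedent, \<open>G\<close> respects the side condition because
  it is closed, so the rule can be applied among the theorems.\<close>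

lemma mpc_BR1:
  assumes "\<Phi> \<^bold>\<rightarrow> \<Psi> \<in> mpc \<sigma> \<Gamma>" "x \<notin> fv \<Phi>" "\<Gamma> \<subseteq> Sent \<sigma>"
  shows "\<Phi> \<^bold>\<rightarrow> Forall x \<Psi> \<in> mpc \<sigma> \<Gamma>"
proof -
  have \<Gamma>: "\<Gamma> \<subseteq> Form \<sigma>" using assms(3) by (auto simp: Sent_def)
  then have F: "\<Phi> \<in> Form \<sigma>" "\<Psi> \<in> Form \<sigma>" using mpc_Form[OF assms(1)] by auto
  obtain G where G: "G \<in> mpc \<sigma> \<Gamma>" "G \<in> Sent \<sigma>" "G \<^bold>\<rightarrow> (\<Phi> \<^bold>\<rightarrow> \<Psi>) \<in> QBKo \<sigma>"
    using mpc_single_hypothesis[OF assms(3,1)] by blast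
  have GF: "G \<^bold>\<and> \<Phi> \<in> Form \<sigma>" using G F by (simp add: Sent_def)
  have "G \<in> mpc \<sigma> {G \<^bold>\<and> \<Phi>}" "\<Phi> \<in> mpc \<sigma> {G \<^bold>\<and> \<Phi>}"
    using mpc_ConE[of G \<Phi> \<sigma> "{G \<^bold>\<and> \<Phi>}"] GF by (auto intro: mpc.Hyp)
  then have "\<Psi> \<in> mpc \<sigma> {G \<^bold>\<and> \<Phi>}" using G(3) by (meson mpc.MP mpc.Thm)
  then have "(G \<^bold>\<and> \<Phi>) \<^bold>\<rightarrow> \<Psi> \<in> QBKo \<sigma>" using GF by (intro mpc_empty mpc_deduction) auto
  then have "(G \<^bold>\<and> \<Phi>) \<^bold>\<rightarrow> Forall x \<Psi> \<in> QBKo \<sigma>"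
    using G assms(2) by (intro QBKo.BR1) (auto simp: Sent_def)
  moreover have "G \<^bold>\<and> \<Phi> \<in> mpc \<sigma> (insert \<Phi> \<Gamma>)"
    using G F \<Gamma> by (intro mpc_ConI) (auto intro: mpc.Hyp mpc_mono)
  ultimately have "Forall x \<Psi> \<in> mpc \<sigma> (insert \<Phi> \<Gamma>)" by (meson mpc.MP mpc.Thm)
  then show ?thesis using \<Gamma> F mpc_deduction by blast
qed

lemma mpc_Forall:
  assumes "\<Phi> \<in> mpc \<sigma> \<Gamma>" "\<Gamma> \<subseteq> Sent \<sigma>"
  shows "Forall x \<Phi> \<in> mpc \<sigma> \<Gamma>"
proof -
  have "\<Phi> \<in> Form \<sigma>" using mpc_Form[OF assms(1)] assms(2) by (auto simp: Sent_def)
  then have "(\<^bold>\<not> \<^bold>\<bottom>) \<^bold>\<rightarrow> \<Phi> \<in> mpc \<sigma> \<Gamma>" using assms(1) by (intro mpc_K) auto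
  then have "(\<^bold>\<not> \<^bold>\<bottom>) \<^bold>\<rightarrow> Forall x \<Phi> \<in> mpc \<sigma> \<Gamma>" using assms(2) by (intro mpc_BR1) auto
  moreover have "\<^bold>\<not> \<^bold>\<bottom> \<in> mpc \<sigma> \<Gamma>" by (intro mpc_refl) simp
  ultimately show ?thesis by (meson mpc.MP)
qed

text \<open>Here \<open>G\<close> moves into the consequent, since that is where the side condition
  of this rule lies.\<close>

lemma mpc_BR2:
  assumes "\<Phi> \<^bold>\<rightarrow> \<Psi> \<in> mpc \<sigma> \<Gamma>" "x \<notin> fv \<Psi>" "\<Gamma> \<subseteq> Sent \<sigma>"
  shows "Exists x \<Phi> \<^bold>\<rightarrow> \<Psi> \<in> mpc \<sigma> \<Gamma>"
proof -
  have \<Gamma>: "\<Gamma> \<subseteq> Form \<sigma>" using assms(3) by (auto simp: Sent_def)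
  then have F: "\<Phi> \<in> Form \<sigma>" "\<Psi> \<in> Form \<sigma>" using mpc_Form[OF assms(1)] by auto
  obtain G where G: "G \<in> mpc \<sigma> \<Gamma>" "G \<in> Sent \<sigma>" "G \<^bold>\<rightarrow> (\<Phi> \<^bold>\<rightarrow> \<Psi>) \<in> QBKo \<sigma>"
    using mpc_single_hypothesis[OF assms(3,1)] by blast
  have GF: "G \<in> Form \<sigma>" using G by (simp add: Sent_def)
  have "\<Psi> \<in> mpc \<sigma> {G, \<Phi>}" using G(3) by (meson mpc.MP mpc.Thm mpc.Hyp insertI1 insertI2)
  then have "\<Phi> \<^bold>\<rightarrow> (G \<^bold>\<rightarrow> \<Psi>) \<in> QBKo \<sigma>" using GF F by (intro mpc_empty mpc_deduction) auto
  then have "Exists x \<Phi> \<^bold>\<rightarrow> (G \<^bold>\<rightarrow> \<Psi>) \<in> QBKo \<sigma>"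
    using G assms(2) by (intro QBKo.BR2) (auto simp: Sent_def)
  then have "\<Psi> \<in> mpc \<sigma> (insert (Exists x \<Phi>) \<Gamma>)"
    using mpc_mono[OF G(1)] by (meson mpc.MP mpc.Thm mpc.Hyp insertI1 subset_insertI)
  then show ?thesis using \<Gamma> F by (intro mpc_deduction) auto
qed

section \<open>Replacing constants by terms\<close>

text \<open>Bound variables count too, so that a variable outside this set can replace a constant
  without being captured.\<close>

primrec vars :: "('p, 'c) fm \<Rightarrow> nat set" where
  "vars (Atom p ts) = (\<Union>t\<in>set ts. tvars t)"
| "vars \<^bold>\<bottom> = {}"
| "vars (\<Phi> \<^bold>\<rightarrow> \<Psi>) = vars \<Phi> \<union> vars \<Psi>"
| "vars (\<Phi> \<^bold>\<and> \<Psi>) = vars \<Phi> \<union> vars \<Psi>"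
| "vars (\<Phi> \<^bold>\<or> \<Psi>) = vars \<Phi> \<union> vars \<Psi>"
| "vars (\<^bold>\<sim> \<Phi>) = vars \<Phi>"
| "vars (\<^bold>\<box> \<Phi>) = vars \<Phi>"
| "vars (\<^bold>\<diamond> \<Phi>) = vars \<Phi>"
| "vars (Forall x \<Phi>) = insert x (vars \<Phi>)"
| "vars (Exists x \<Phi>) = insert x (vars \<Phi>)"

primrec tcsub :: "('c \<Rightarrow> 'd trm) \<Rightarrow> 'c trm \<Rightarrow> 'd trm" where
  "tcsub g (Var x) = Var x"
| "tcsub g (Const c) = g c"

text \<open>Serves three purposes: turning a fresh constant into a variable, carrying formulas of
  \<sigma> into the Henkin language, and translating derivations back from there.\<close>

primrec csub :: "('c \<Rightarrow> 'd trm) \<Rightarrow> ('p, 'c) fm \<Rightarrow> ('p, 'd) fm" where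
  "csub g (Atom p ts) = Atom p (map (tcsub g) ts)"
| "csub g \<^bold>\<bottom> = \<^bold>\<bottom>"
| "csub g (\<Phi> \<^bold>\<rightarrow> \<Psi>) = csub g \<Phi> \<^bold>\<rightarrow> csub g \<Psi>"
| "csub g (\<Phi> \<^bold>\<and> \<Psi>) = csub g \<Phi> \<^bold>\<and> csub g \<Psi>"
| "csub g (\<Phi> \<^bold>\<or> \<Psi>) = csub g \<Phi> \<^bold>\<or> csub g \<Psi>"
| "csub g (\<^bold>\<sim> \<Phi>) = \<^bold>\<sim> (csub g \<Phi>)"
| "csub g (\<^bold>\<box> \<Phi>) = \<^bold>\<box> (csub g \<Phi>)"
| "csub g (\<^bold>\<diamond> \<Phi>) = \<^bold>\<diamond> (csub g \<Phi>)"
| "csub g (Forall x \<Phi>) = Forall x (csub g \<Phi>)"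
| "csub g (Exists x \<Phi>) = Exists x (csub g \<Phi>)"

lemma finite_tvars [simp]: "finite (tvars t)"
  by (cases t) auto

lemma finite_vars [simp]: "finite (vars \<Phi>)"
  by (induction \<Phi>) auto

lemma fv_subset_vars: "fv \<Phi> \<subseteq> vars \<Phi>"
  by (induction \<Phi>) auto

text \<open>Freshness is expressed as "for all large \<open>y\<close>": such statements combine
  under the filter \<open>sequentially\<close>, which saves collecting the variables of a
  derivation.\<close>

lemma eventually_not_in_vars: "\<forall>\<^sub>F y in sequentially. y \<notin> vars \<Phi>"
proof -
  obtain n where "\<forall>x\<in>vars \<Phi>. x < n" using finite_nat_set_iff_bounded finite_vars by blast
  then show ?thesis unfolding eventually_sequentially by (meson leD)
qed

lemma csub_id: "\<forall>c\<in>set2_fm \<Phi>. g c = Const c \<Longrightarrow> csub g \<Phi> = \<Phi>"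
proof (induction \<Phi>)
  case (Atom p ts)
  have "tcsub g t = t" if "t \<in> set ts" for t
    using Atom that by (cases t) force+
  then show ?case by (simp add: map_idI)
qed (simp_all add: ball_Un)

lemma csub_map_fm: "csub g (map_fm id f \<Phi>) = csub (g \<circ> f) \<Phi>"
proof (induction \<Phi>)
  case (Atom p ts)
  have "(tcsub g \<circ> map_trm f) t = tcsub (g \<circ> f) t" for t by (cases t) auto
  then show ?case by (simp del: comp_apply)
qed simp_all

lemma wf_fm_csub:
  "wf_fm \<sigma> \<Phi> \<Longrightarrow> psyms \<tau> = psyms \<sigma> \<Longrightarrow> arity \<tau> = arity \<sigma> \<Longrightarrow>
    \<forall>c\<in>csyms \<sigma>. wf_trm \<tau> (g c) \<Longrightarrow> wf_fm \<tau> (csub g \<Phi>)"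
proof (induction \<Phi>)
  case (Atom p ts)
  have "wf_trm \<sigma> t \<Longrightarrow> wf_trm \<tau> (tcsub g t)" for t using Atom.prems(4) by (cases t) auto
  then show ?case using Atom by auto
qed simp_all

lemma fv_csub: "\<forall>c. tvars (g c) \<subseteq> {y} \<Longrightarrow> fv (csub g \<Phi>) \<subseteq> insert y (fv \<Phi>)"
proof (induction \<Phi>)
  case (Atom p ts)
  have "tvars (tcsub g t) \<subseteq> insert y (tvars t)" for t using Atom by (cases t) auto
  then show ?case by fastforce
qed auto

text \<open>The terms inserted by \<open>g\<close> contain no variable but \<open>y\<close>, and
  \<open>s\<close> leaves \<open>y\<close> alone, so the later substitution does not act on
  them.\<close>

lemma csub_subst:
  "\<forall>c. tvars (g c) \<subseteq> {y} \<Longrightarrow> s y = Var y \<Longrightarrow> csub g (subst s \<Phi>) = subst (tcsub g \<circ> s) (csub g \<Phi>)"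
proof (induction \<Phi> arbitrary: s)
  case (Atom p ts)
  have "tcsub g (tsubst s t) = tsubst (tcsub g \<circ> s) (tcsub g t)" for t
  proof (cases t)
    case (Const c)
    show ?thesis
      by (cases "g c") (use Const Atom.prems(1)[rule_format, of c] Atom.prems(2) in auto)
  qed simp
  then show ?case by (simp del: comp_apply) (simp add: comp_def)
next
  case (Forall x \<Phi>)
  have "(tcsub g \<circ> s)(x := Var x) = tcsub g \<circ> s(x := Var x)" by auto
  moreover have "csub g (subst (s(x := Var x)) \<Phi>) = subst (tcsub g \<circ> s(x := Var x)) (csub g \<Phi>)"
    by (rule Forall.IH) (use Forall.prems in auto)
  ultimately show ?case by (simp only: subst.simps csub.simps)
next
  case (Exists x \<Phi>)
  have "(tcsub g \<circ> s)(x := Var x) = tcsub g \<circ> s(x := Var x)" by auto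
  moreover have "csub g (subst (s(x := Var x)) \<Phi>) = subst (tcsub g \<circ> s(x := Var x)) (csub g \<Phi>)"
    by (rule Exists.IH) (use Exists.prems in auto)
  ultimately show ?case by (simp only: subst.simps csub.simps)
qed simp_all

lemma csub_inst:
  assumes "\<forall>c. tvars (g c) \<subseteq> {y}" "x \<noteq> y"
  shows "csub g (inst \<Phi> x t) = inst (csub g \<Phi>) x (tcsub g t)"
proof -
  have "tcsub g \<circ> Var(x := t) = Var(x := tcsub g t)" by auto
  then show ?thesis unfolding inst_def using csub_subst[of g y "Var(x := t)" \<Phi>] assms by simp
qed

lemma free_for_csub:
  assumes "\<forall>c. tvars (g c) \<subseteq> {y}" "x \<noteq> y"
  shows "y \<notin> vars \<Phi> \<Longrightarrow> free_for t x \<Phi> \<Longrightarrow> free_for (tcsub g t) x (csub g \<Phi>)"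
proof (induction \<Phi>)
  case (Forall z \<Phi>)
  have "tvars (tcsub g t) \<subseteq> insert y (tvars t)" using assms by (cases t) auto
  then show ?case using Forall fv_csub[OF assms(1), of \<Phi>] assms(2) by auto
next
  case (Exists z \<Phi>)
  have "tvars (tcsub g t) \<subseteq> insert y (tvars t)" using assms by (cases t) auto
  then show ?case using Exists fv_csub[OF assms(1), of \<Phi>] assms(2) by auto
qed auto

lemma csub_QBKo_axioms:
  assumes \<tau>: "psyms \<tau> = psyms \<sigma>" "arity \<tau> = arity \<sigma>" "\<forall>c\<in>csyms \<sigma>. wf_trm \<tau> (g c)"
    and g: "\<forall>c. tvars (g c) \<subseteq> {y}"
  shows "\<Phi> \<in> QBKo_axioms \<sigma> \<Longrightarrow> y \<notin> vars \<Phi> \<Longrightarrow> csub g \<Phi> \<in> QBKo_axioms \<tau>"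
proof (induction rule: QBKo_axioms.induct)
  case (AllE \<Phi> t x)
  have "wf_trm \<tau> (tcsub g t)" using AllE \<tau> by (cases t) auto
  then show ?case
    using AllE free_for_csub[OF g, of x \<Phi> t] csub_inst[OF g, of x \<Phi> t] wf_fm_csub[OF _ \<tau>]
    by (auto intro!: QBKo_axioms.intros simp: Form_def)
next
  case (ExI \<Phi> t x)
  have "wf_trm \<tau> (tcsub g t)" using ExI \<tau> by (cases t) auto
  then show ?case
    using ExI free_for_csub[OF g, of x \<Phi> t] csub_inst[OF g, of x \<Phi> t] wf_fm_csub[OF _ \<tau>]
    by (auto intro!: QBKo_axioms.intros simp: Form_def)
qed (use wf_fm_csub[OF _ \<tau>] in \<open>auto intro!: QBKo_axioms.intros simp: Form_def\<close>)

text \<open>Intermediate formulas of a derivation may contain variables that the conclusion lacks,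
  so freshness for \<Phi> alone would not survive the induction over modus ponens. A claim about all
  large \<open>y\<close> does.\<close>

lemma csub_QBKo:
  assumes \<tau>: "psyms \<tau> = psyms \<sigma>" "arity \<tau> = arity \<sigma>" "\<And>y. \<forall>c\<in>csyms \<sigma>. wf_trm \<tau> (g y c)"
    and g: "\<And>y. \<forall>c. tvars (g y c) \<subseteq> {y}"
  shows "\<Phi> \<in> QBKo \<sigma> \<Longrightarrow> \<forall>\<^sub>F y in sequentially. csub (g y) \<Phi> \<in> QBKo \<tau>"
proof (induction rule: QBKo.induct)
  case (Ax \<Phi>)
  from eventually_not_in_vars[of \<Phi>] show ?case
    by eventually_elim (use Ax csub_QBKo_axioms[OF \<tau> g] in \<open>blast intro: QBKo.Ax\<close>)
next
  case (MP \<Phi> \<Psi>)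
  from MP.IH show ?case by eventually_elim (auto intro: QBKo.MP)
next
  case (MB \<Phi> \<Psi>)
  from MB.IH show ?case by eventually_elim (auto intro: QBKo.MB)
next
  case (MD \<Phi> \<Psi>)
  from MD.IH show ?case by eventually_elim (auto intro: QBKo.MD)
next
  case (BR1 \<Phi> \<Psi> x)
  \<comment> \<open>Besides being fresh, \<open>y\<close> must differ from the generalized variable
    \<open>x\<close>, or the side condition of the rule could be lost when \<open>y\<close> enters
    the antecedent.\<close>
  from BR1.IH eventually_gt_at_top[of x] show ?case
    by eventually_elim (use BR1.hyps(2) fv_csub[OF g, of _ \<Phi>] in \<open>auto intro!: QBKo.BR1\<close>)
next
  case (BR2 \<Phi> \<Psi> x)
  from BR2.IH eventually_gt_at_top[of x] show ?case
    by eventually_elim (use BR2.hyps(2) fv_csub[OF g, of _ \<Psi>] in \<open>auto intro!: QBKo.BR2\<close>)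
qed

lemma csub_mpc:
  assumes \<tau>: "psyms \<tau> = psyms \<sigma>" "arity \<tau> = arity \<sigma>" "\<And>y. \<forall>c\<in>csyms \<sigma>. wf_trm \<tau> (g y c)"
    and g: "\<And>y. \<forall>c. tvars (g y c) \<subseteq> {y}"
  shows "\<Phi> \<in> mpc \<sigma> \<Gamma> \<Longrightarrow> \<forall>\<^sub>F y in sequentially. csub (g y) \<Phi> \<in> mpc \<tau> (csub (g y) ` \<Gamma>)"
proof (induction rule: mpc.induct)
  case (Hyp \<Phi>)
  then show ?case by (intro always_eventually allI mpc.Hyp imageI)
next
  case (Thm \<Phi>)
  from csub_QBKo[OF \<tau> g this] show ?case by eventually_elim (rule mpc.Thm)
next
  case (MP \<Phi> \<Psi>)
  from MP.IH show ?case by eventually_elim (auto intro: mpc.MP)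
qed

section \<open>Renaming to a fresh variable and generalization on a constant\<close>

lemma inst_quantifier:
  "inst (Forall z \<Phi>) x t = (if z = x then Forall z \<Phi> else Forall z (inst \<Phi> x t))"
  "inst (Exists z \<Phi>) x t = (if z = x then Exists z \<Phi> else Exists z (inst \<Phi> x t))"
  by (simp_all add: inst_def fun_upd_twist fun_upd_idem)

lemma inst_not_free: "x \<notin> fv \<Phi> \<Longrightarrow> inst \<Phi> x t = \<Phi>"
  using subst_cong[of \<Phi> "Var(x := t)" Var] by (auto simp: inst_def)

text \<open>Each free occurrence of \<open>y\<close> replaces a free occurrence of \<open>x\<close>,
  which lies under no quantifier over \<open>x\<close>.\<close>

lemma free_for_inst_fresh: "y \<notin> vars \<Phi> \<Longrightarrow> free_for (Var x) y (inst \<Phi> x (Var y))"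
proof (induction \<Phi>)
  case (Forall z \<Phi>)
  then show ?case using fv_subset_vars[of \<Phi>] by (auto simp: inst_quantifier)
next
  case (Exists z \<Phi>)
  then show ?case using fv_subset_vars[of \<Phi>] by (auto simp: inst_quantifier)
qed (auto simp: inst_def)

text \<open>A fresh \<open>y\<close> marks exactly the places where \<open>x\<close> was free, so
  the renaming can be undone.\<close>

lemma inst_inst_fresh: "y \<notin> vars \<Phi> \<Longrightarrow> inst (inst \<Phi> x (Var y)) y (Var x) = \<Phi>"
proof (induction \<Phi>)
  case (Atom p ts)
  have "tsubst (Var(y := Var x)) (tsubst (Var(x := Var y)) t) = t" if "t \<in> set ts" for t
    using Atom that by (cases t) auto
  then show ?case by (simp add: inst_def map_idI del: fun_upd_apply)
next
  case (Forall z \<Phi>)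
  then have "y \<notin> fv \<Phi>" using fv_subset_vars[of \<Phi>] by auto
  with Forall show ?case by (auto simp: inst_quantifier inst_not_free)
next
  case (Exists z \<Phi>)
  then have "y \<notin> fv \<Phi>" using fv_subset_vars[of \<Phi>] by auto
  with Exists show ?case by (auto simp: inst_quantifier inst_not_free)
qed (auto simp: inst_def)

text \<open>In the derivation the constant \<open>c\<close> becomes a fresh variable
  \<open>y\<close>, which leaves \<Gamma> and \<Phi> untouched. As \<Gamma> is closed,
  \<open>y\<close> can be generalized and then instantiated by \<open>x\<close>.\<close>

lemma mpc_generalize_constant:
  assumes d: "inst \<Phi> x (Const c) \<in> mpc \<sigma> \<Gamma>" and \<Gamma>: "\<Gamma> \<subseteq> Sent \<sigma>" and \<Phi>: "\<Phi> \<in> Form \<sigma>"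
    and c: "c \<notin> set2_fm \<Phi>" "\<And>\<Psi>. \<Psi> \<in> \<Gamma> \<Longrightarrow> c \<notin> set2_fm \<Psi>"
  shows "\<Phi> \<in> mpc \<sigma> \<Gamma>"
proof -
  define g where "g y d = (if d = c then Var y else Const d)" for y d
  have g: "\<forall>c. tvars (g y c) \<subseteq> {y}" "\<forall>c\<in>csyms \<sigma>. wf_trm \<sigma> (g y c)" for y by (auto simp: g_def)
  have "\<forall>\<^sub>F y in sequentially. csub (g y) (inst \<Phi> x (Const c)) \<in> mpc \<sigma> (csub (g y) ` \<Gamma>)"
    by (rule csub_mpc[OF _ _ g(2) g(1) d]) auto
  then have "\<forall>\<^sub>F y in sequentially. csub (g y) (inst \<Phi> x (Const c)) \<in> mpc \<sigma> (csub (g y) ` \<Gamma>)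
      \<and> y \<notin> vars \<Phi> \<and> x < y"
    using eventually_not_in_vars[of \<Phi>] eventually_gt_at_top[of x] by eventually_elim auto
  then obtain y where y: "csub (g y) (inst \<Phi> x (Const c)) \<in> mpc \<sigma> (csub (g y) ` \<Gamma>)"
      "y \<notin> vars \<Phi>" "x < y" by (auto dest: eventually_happens)
  have "csub (g y) \<Psi> = \<Psi>" if "\<Psi> \<in> \<Gamma> \<or> \<Psi> = \<Phi>" for \<Psi>
    by (rule csub_id) (use that c in \<open>auto simp: g_def\<close>)
  moreover have "csub (g y) (inst \<Phi> x (Const c)) = inst (csub (g y) \<Phi>) x (Var y)"
    using csub_inst[OF g(1), of x y \<Phi> "Const c"] y(3) by (simp, simp add: g_def[of y c])
  ultimately have "inst \<Phi> x (Var y) \<in> mpc \<sigma> \<Gamma>" using y(1) by simp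
  then have "Forall y (inst \<Phi> x (Var y)) \<in> mpc \<sigma> \<Gamma>" using \<Gamma> by (rule mpc_Forall)
  moreover have "Forall y (inst \<Phi> x (Var y)) \<^bold>\<rightarrow> inst (inst \<Phi> x (Var y)) y (Var x) \<in> mpc \<sigma> \<Gamma>"
    using \<Phi> y(2) by (intro mpc_Ax AllE) (auto simp: inst_Form free_for_inst_fresh)
  ultimately show ?thesis using inst_inst_fresh[OF y(2), of x] by (metis mpc.MP)
qed

section \<open>Modal and quantifier principles\<close>

text \<open>The source of boxed theorems is the axiom \<box>(\<Phi> \<rightarrow> \<Phi>): a theorem
  \<Phi> is implied by \<Phi> \<rightarrow> \<Phi>, and \<open>MB\<close> boxes this
  implication.\<close>

lemma QBKo_necessitation:
  assumes "\<Phi> \<in> QBKo \<sigma>" shows "\<^bold>\<box> \<Phi> \<in> QBKo \<sigma>"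
proof -
  have F: "\<Phi> \<in> Form \<sigma>" using assms by (rule QBKo_Form)
  then have "(\<Phi> \<^bold>\<rightarrow> \<Phi>) \<^bold>\<rightarrow> \<Phi> \<in> QBKo \<sigma>"
    using assms by (intro mpc_empty mpc_K) (auto intro: mpc.Thm)
  then have "\<^bold>\<box> (\<Phi> \<^bold>\<rightarrow> \<Phi>) \<^bold>\<rightarrow> \<^bold>\<box> \<Phi> \<in> QBKo \<sigma>" by (rule QBKo.MB)
  then show ?thesis using F by (meson QBKo.MP QBKo.Ax BoxId)
qed

text \<open>The scheme K is obtained by applying \<open>MB\<close> to (\<Phi> \<and> (\<Phi>
  \<rightarrow> \<Psi>)) \<rightarrow> \<Psi> and splitting the boxed conjunction with
  \<open>BoxCon\<close>.\<close>

lemma mpc_Box_MP: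
  assumes "\<^bold>\<box> \<Phi> \<in> mpc \<sigma> \<Gamma>" "\<^bold>\<box> (\<Phi> \<^bold>\<rightarrow> \<Psi>) \<in> mpc \<sigma> \<Gamma>" "\<Gamma> \<subseteq> Form \<sigma>"
  shows "\<^bold>\<box> \<Psi> \<in> mpc \<sigma> \<Gamma>"
proof -
  have F: "\<Phi> \<in> Form \<sigma>" "\<Psi> \<in> Form \<sigma>" using mpc_Form[OF assms(2,3)] by auto
  let ?C = "\<Phi> \<^bold>\<and> (\<Phi> \<^bold>\<rightarrow> \<Psi>)"
  have "\<Psi> \<in> mpc \<sigma> {?C}" using mpc_ConE[of \<Phi> "\<Phi> \<^bold>\<rightarrow> \<Psi>" \<sigma> "{?C}"] F
    by (auto intro: mpc.Hyp mpc.MP)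
  then have "?C \<^bold>\<rightarrow> \<Psi> \<in> QBKo \<sigma>" using F by (intro mpc_empty mpc_deduction) auto
  then have "\<^bold>\<box> ?C \<^bold>\<rightarrow> \<^bold>\<box> \<Psi> \<in> mpc \<sigma> \<Gamma>" by (intro mpc.Thm QBKo.MB)
  moreover have "\<^bold>\<box> \<Phi> \<^bold>\<and> \<^bold>\<box> (\<Phi> \<^bold>\<rightarrow> \<Psi>) \<in> mpc \<sigma> \<Gamma>" using assms by (intro mpc_ConI)
  moreover have "(\<^bold>\<box> \<Phi> \<^bold>\<and> \<^bold>\<box> (\<Phi> \<^bold>\<rightarrow> \<Psi>)) \<^bold>\<rightarrow> \<^bold>\<box> ?C \<in> mpc \<sigma> \<Gamma>" using F by (intro mpc_Ax BoxCon) auto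
  ultimately show ?thesis by (meson mpc.MP)
qed

lemma mpc_Box:
  assumes "\<Gamma> \<subseteq> Form \<sigma>"
  shows "\<Phi> \<in> mpc \<sigma> {\<Psi>. \<^bold>\<box> \<Psi> \<in> \<Gamma>} \<Longrightarrow> \<^bold>\<box> \<Phi> \<in> mpc \<sigma> \<Gamma>"
proof (induction rule: mpc.induct)
  case (MP \<Phi> \<Psi>)
  then show ?case using assms by (blast intro: mpc_Box_MP)
qed (auto intro: mpc.Hyp mpc.Thm QBKo_necessitation)

text \<open>With this classical duality, Henkin axioms for existential sentences alone also take
  care of the universal ones.\<close>

lemma QBKo_not_Exists_not:
  assumes "\<Phi> \<in> Form \<sigma>"
  shows "\<^bold>\<not> Exists x (\<^bold>\<not> \<Phi>) \<^bold>\<rightarrow> Forall x \<Phi> \<in> QBKo \<sigma>"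
proof (rule QBKo.BR1)
  let ?E = "Exists x (\<^bold>\<not> \<Phi>)"
  have "inst (\<^bold>\<not> \<Phi>) x (Var x) \<^bold>\<rightarrow> ?E \<in> mpc \<sigma> {\<^bold>\<not> \<Phi>, \<^bold>\<not> ?E}"
    using assms by (intro mpc_Ax ExI) auto
  then have "?E \<in> mpc \<sigma> {\<^bold>\<not> \<Phi>, \<^bold>\<not> ?E}"
    by (rule mpc.MP[rotated]) (simp add: mpc.Hyp)
  then have "\<^bold>\<bottom> \<in> mpc \<sigma> {\<^bold>\<not> \<Phi>, \<^bold>\<not> ?E}"
    by (rule mpc.MP) (simp add: mpc.Hyp)
  then have "\<Phi> \<in> mpc \<sigma> {\<^bold>\<not> ?E}" by (rule mpc_ccontr) (use assms in auto)
  then show "\<^bold>\<not> ?E \<^bold>\<rightarrow> \<Phi> \<in> QBKo \<sigma>" using assms by (intro mpc_empty mpc_deduction) auto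
qed simp

section \<open>Maximal consistent sets\<close>

definition consistent :: "('p, 'c) signature \<Rightarrow> ('p, 'c) fm set \<Rightarrow> bool" where
  "consistent \<sigma> \<Gamma> \<longleftrightarrow> \<^bold>\<bottom> \<notin> mpc \<sigma> \<Gamma>"

text \<open>Maximality is relative to a set \<open>F\<close> of formulas because each level has its
  own language.\<close>

definition mcs :: "('p, 'c) signature \<Rightarrow> ('p, 'c) fm set \<Rightarrow> ('p, 'c) fm set \<Rightarrow> bool" where
  "mcs \<sigma> F T \<longleftrightarrow> T \<subseteq> F \<and> consistent \<sigma> T \<and> (\<forall>\<Phi>\<in>F. consistent \<sigma> (insert \<Phi> T) \<longrightarrow> \<Phi> \<in> T)"

text \<open>Zorn's lemma replaces an enumeration, as the language may be uncountable; compactness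
  makes the union of a chain consistent.\<close>

lemma lindenbaum:
  assumes "\<Gamma> \<subseteq> F" "consistent \<sigma> \<Gamma>"
  shows "\<exists>T. \<Gamma> \<subseteq> T \<and> mcs \<sigma> F T"
proof -
  define A where "A = {T. \<Gamma> \<subseteq> T \<and> T \<subseteq> F \<and> consistent \<sigma> T}"
  have "\<exists>T\<in>A. \<forall>X\<in>A. T \<subseteq> X \<longrightarrow> X = T"
  proof (rule subset_Zorn_nonempty)
    have "\<Gamma> \<in> A" using assms by (simp add: A_def)
    then show "A \<noteq> {}" by auto
  next
    fix \<C> assume \<C>: "\<C> \<noteq> {}" "subset.chain A \<C>"
    then have \<C>A: "\<C> \<subseteq> A" by (simp add: subset.chain_def)
    have "\<^bold>\<bottom> \<notin> mpc \<sigma> (\<Union>\<C>)"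
    proof
      assume "\<^bold>\<bottom> \<in> mpc \<sigma> (\<Union>\<C>)"
      from mpc_compact[OF this] obtain \<Gamma>0
        where \<Gamma>0: "finite \<Gamma>0" "\<Gamma>0 \<subseteq> \<Union>\<C>" "\<^bold>\<bottom> \<in> mpc \<sigma> \<Gamma>0" by auto
      from finite_subset_Union_chain[OF \<Gamma>0(1,2) \<C>] obtain T where T: "T \<in> \<C>" "\<Gamma>0 \<subseteq> T" .
      then have "consistent \<sigma> T" using \<C>A by (auto simp: A_def)
      then show False using mpc_mono[OF \<Gamma>0(3) T(2)] by (simp add: consistent_def)
    qed
    moreover have "\<Gamma> \<subseteq> \<Union>\<C>" using \<C>(1) \<C>A by (force simp: A_def)
    moreover have "\<Union>\<C> \<subseteq> F" using \<C>A by (auto simp: A_def)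
    ultimately show "\<Union>\<C> \<in> A" by (simp add: A_def consistent_def)
  qed
  then obtain T where T: "T \<in> A" "\<And>X. X \<in> A \<Longrightarrow> T \<subseteq> X \<Longrightarrow> X = T" by auto
  have "\<Phi> \<in> T" if "\<Phi> \<in> F" "consistent \<sigma> (insert \<Phi> T)" for \<Phi>
  proof -
    have "insert \<Phi> T \<in> A" using that T(1) by (auto simp: A_def)
    then have "insert \<Phi> T = T" by (rule T(2)) auto
    then show ?thesis by auto
  qed
  then show ?thesis using T(1) by (intro exI[of _ T]) (simp add: mcs_def A_def)
qed

context
  fixes \<sigma> :: "('p, 'c) signature" and F T
  assumes mcs: "mcs \<sigma> F T" and F: "F \<subseteq> Form \<sigma>"
begin

lemma mcs_Form: "T \<subseteq> Form \<sigma>"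
  using mcs F by (auto simp: mcs_def)

lemma mcs_mpc: "\<Phi> \<in> F \<Longrightarrow> \<Phi> \<in> T \<longleftrightarrow> \<Phi> \<in> mpc \<sigma> T"
proof
  assume "\<Phi> \<in> F" "\<Phi> \<in> mpc \<sigma> T"
  then have "consistent \<sigma> (insert \<Phi> T)"
    using mcs mpc_cut[of \<Phi> \<sigma> T "\<^bold>\<bottom>"] by (auto simp: mcs_def consistent_def)
  then show "\<Phi> \<in> T" using mcs \<open>\<Phi> \<in> F\<close> by (simp add: mcs_def)
qed (rule mpc.Hyp)

lemma mcs_Bot: "\<^bold>\<bottom> \<notin> T"
  using mcs mpc.Hyp[of "\<^bold>\<bottom>" T \<sigma>] by (auto simp: mcs_def consistent_def)

lemma mcs_not_in: "\<Phi> \<in> F \<Longrightarrow> \<Phi> \<notin> T \<Longrightarrow> \<^bold>\<not> \<Phi> \<in> mpc \<sigma> T"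
  using mcs F mpc_deduction[OF mcs_Form, of \<Phi> "\<^bold>\<bottom>"] by (auto simp: mcs_def consistent_def)

lemma mcs_Imp:
  assumes "\<Phi> \<in> F" "\<Psi> \<in> F" "\<Phi> \<^bold>\<rightarrow> \<Psi> \<in> F"
  shows "\<Phi> \<^bold>\<rightarrow> \<Psi> \<in> T \<longleftrightarrow> (\<Phi> \<in> T \<longrightarrow> \<Psi> \<in> T)"
proof
  assume "\<Phi> \<^bold>\<rightarrow> \<Psi> \<in> T"
  then show "\<Phi> \<in> T \<longrightarrow> \<Psi> \<in> T" using mcs_mpc assms(2) mpc.MP[OF mpc.Hyp mpc.Hyp] by blast
next
  assume imp: "\<Phi> \<in> T \<longrightarrow> \<Psi> \<in> T"
  have "\<Psi> \<in> mpc \<sigma> (insert \<Phi> T)"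
  proof (cases "\<Phi> \<in> T")
    case True
    then show ?thesis using imp by (simp add: mpc.Hyp)
  next
    case False
    then have "\<^bold>\<not> \<Phi> \<in> mpc \<sigma> (insert \<Phi> T)"
      using mcs_not_in assms(1) mpc_mono by (metis subset_insertI)
    then have "\<^bold>\<bottom> \<in> mpc \<sigma> (insert \<Phi> T)" by (rule mpc.MP[rotated]) (simp add: mpc.Hyp)
    then show ?thesis using assms(2) F by (auto intro: mpc_BotE)
  qed
  then have "\<Phi> \<^bold>\<rightarrow> \<Psi> \<in> mpc \<sigma> T" using assms(1) F mcs_Form by (intro mpc_deduction) auto
  then show "\<Phi> \<^bold>\<rightarrow> \<Psi> \<in> T" using mcs_mpc assms(3) by simp
qed

lemma mcs_Neg: "\<Phi> \<in> F \<Longrightarrow> \<^bold>\<bottom> \<in> F \<Longrightarrow> \<^bold>\<not> \<Phi> \<in> F \<Longrightarrow> \<^bold>\<not> \<Phi> \<in> T \<longleftrightarrow> \<Phi> \<notin> T"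
  by (simp add: mcs_Imp mcs_Bot)

lemma mcs_Con:
  assumes "\<Phi> \<in> F" "\<Psi> \<in> F" "\<Phi> \<^bold>\<and> \<Psi> \<in> F"
  shows "\<Phi> \<^bold>\<and> \<Psi> \<in> T \<longleftrightarrow> \<Phi> \<in> T \<and> \<Psi> \<in> T"
  using assms mpc_ConI[of \<Phi> \<sigma> T \<Psi>] mpc_ConE[of \<Phi> \<Psi> \<sigma> T] mcs_Form by (auto simp: mcs_mpc)

lemma mcs_Dis:
  assumes "\<Phi> \<in> F" "\<Psi> \<in> F" "\<Phi> \<^bold>\<or> \<Psi> \<in> F"
  shows "\<Phi> \<^bold>\<or> \<Psi> \<in> T \<longleftrightarrow> \<Phi> \<in> T \<or> \<Psi> \<in> T"
proof
  assume dis: "\<Phi> \<^bold>\<or> \<Psi> \<in> T"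
  show "\<Phi> \<in> T \<or> \<Psi> \<in> T"
  proof (rule ccontr)
    assume "\<not> (\<Phi> \<in> T \<or> \<Psi> \<in> T)"
    then have "\<^bold>\<bottom> \<in> mpc \<sigma> (insert \<Phi> T)" "\<^bold>\<bottom> \<in> mpc \<sigma> (insert \<Psi> T)"
      using mcs assms(1,2) by (auto simp: mcs_def consistent_def)
    then have "\<^bold>\<bottom> \<in> mpc \<sigma> T" using mpc_DisE[OF mpc.Hyp[OF dis]] mcs_Form by blast
    then show False using mcs by (simp add: mcs_def consistent_def)
  qed
next
  assume "\<Phi> \<in> T \<or> \<Psi> \<in> T"
  then show "\<Phi> \<^bold>\<or> \<Psi> \<in> T" 
    using assms F mpc_DisI[of \<Phi> \<sigma> \<Psi> T] by (auto simp: mcs_mpc)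
qed

lemma mcs_theorem_Imp: "\<Phi> \<^bold>\<rightarrow> \<Psi> \<in> QBKo \<sigma> \<Longrightarrow> \<Psi> \<in> F \<Longrightarrow> \<Phi> \<in> T \<Longrightarrow> \<Psi> \<in> T"
  using mpc.MP[OF mpc.Hyp mpc.Thm, of \<Phi> T \<Psi> \<sigma>] by (simp add: mcs_mpc)

lemma mcs_theorem_Iff:
  assumes "(\<Phi> \<^bold>\<leftrightarrow> \<Psi>) \<in> QBKo \<sigma>" "\<Phi> \<in> F" "\<Psi> \<in> F"
  shows "\<Phi> \<in> T \<longleftrightarrow> \<Psi> \<in> T"
proof -
  have "(\<Phi> \<^bold>\<leftrightarrow> \<Psi>) \<in> mpc \<sigma> {}" using assms(1) by (rule mpc.Thm)
  then have "\<Phi> \<^bold>\<rightarrow> \<Psi> \<in> QBKo \<sigma>" "\<Psi> \<^bold>\<rightarrow> \<Phi> \<in> QBKo \<sigma>" using mpc_ConE mpc_empty by blast+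
  then show ?thesis using assms mcs_theorem_Imp by blast
qed

end

section \<open>Henkin constants\<close>

text \<open>\<open>Wit n x \<Phi>\<close> is the witness for \<open>\<exists>x \<Phi>\<close> at the worlds of level \<open>n\<close>; the constants \<open>Fv x\<close> stand for the
  free variables of the conclusions. Constants of \<open>\<sigma>\<close> that occur in no formula are left out:
  there may be more of them than there are formulas.\<close>

datatype ('p, 'c) hc = Orig 'c | Fv nat | Wit nat nat "('p, ('p, 'c) hc) fm"

definition used_csyms :: "('p, 'c) signature \<Rightarrow> 'c set" where
  "used_csyms \<sigma> = csyms \<sigma> \<inter> (\<Union>\<Phi>\<in>Form \<sigma>. set2_fm \<Phi>)"

text \<open>The bound \<open>m \<le> n\<close> keeps the witnesses of later levels in reserve. The
  other conditions admit into names only predicate symbols of \<sigma> and constants already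
  generated, which bounds the number of names.\<close>

inductive_set hcs :: "('p, 'c) signature \<Rightarrow> nat \<Rightarrow> ('p, 'c) hc set"
  for \<sigma> :: "('p, 'c) signature" and n :: nat where
  Orig: "c \<in> used_csyms \<sigma> \<Longrightarrow> Orig c \<in> hcs \<sigma> n"
| Fv: "Fv x \<in> hcs \<sigma> n"
| Wit: "m \<le> n \<Longrightarrow> set1_fm \<Phi> \<subseteq> psyms \<sigma> \<Longrightarrow> (\<And>c. c \<in> set2_fm \<Phi> \<Longrightarrow> c \<in> hcs \<sigma> n) \<Longrightarrow> Wit m x \<Phi> \<in> hcs \<sigma> n"

text \<open>All Henkin constants belong to one signature, and the levels are cut out by
  \<open>lang\<close>. Consistency thus has the same meaning at every level and is kept when a set
  is regarded at the next one.\<close>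

definition hsig :: "('p, 'c) signature \<Rightarrow> ('p, ('p, 'c) hc) signature" where
  "hsig \<sigma> = \<lparr>psyms = psyms \<sigma>, arity = arity \<sigma>, csyms = UNIV\<rparr>"

definition lang :: "('p, 'c) signature \<Rightarrow> nat \<Rightarrow> ('p, ('p, 'c) hc) fm set" where
  "lang \<sigma> n = {\<Phi> \<in> Sent (hsig \<sigma>). set2_fm \<Phi> \<subseteq> hcs \<sigma> n}"

definition hax :: "nat \<Rightarrow> nat \<Rightarrow> ('p, ('p, 'c) hc) fm \<Rightarrow> ('p, ('p, 'c) hc) fm" where
  "hax n x \<Phi> = Exists x \<Phi> \<^bold>\<rightarrow> inst \<Phi> x (Const (Wit n x \<Phi>))"

text \<open>Only witnesses of level \<open>n\<close> are required, and sentences inherited from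
  earlier languages receive new ones. The earlier Henkin axioms need not be boxed at a predecessor,
  so they cannot be relied upon at its successors.\<close>

definition cworlds :: "('p, 'c) signature \<Rightarrow> (nat \<times> ('p, ('p, 'c) hc) fm set) set" where
  "cworlds \<sigma> = {(n, T). mcs (hsig \<sigma>) (lang \<sigma> n) T \<and> (\<forall>x \<Phi>. Exists x \<Phi> \<in> lang \<sigma> n \<longrightarrow> hax n x \<Phi> \<in> T)}"

lemma wf_trm_hsig [simp]: "wf_trm (hsig \<sigma>) t"
  by (cases t) (auto simp: hsig_def)

lemma psyms_hsig [simp]: "psyms (hsig \<sigma>) = psyms \<sigma>" and arity_hsig [simp]: "arity (hsig \<sigma>) = arity \<sigma>"
  and csyms_hsig [simp]: "csyms (hsig \<sigma>) = UNIV"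
  by (simp_all add: hsig_def)

lemma hcs_mono: "c \<in> hcs \<sigma> n \<Longrightarrow> n \<le> m \<Longrightarrow> c \<in> hcs \<sigma> m"
  by (induction rule: hcs.induct) (auto intro: hcs.intros)

lemma Wit_in_hcs_level: "Wit m x \<Phi> \<in> hcs \<sigma> n \<Longrightarrow> m \<le> n"
  by (auto elim: hcs.cases)

lemma size_fm_set2: "c \<in> set2_fm \<Phi> \<Longrightarrow> f c \<le> size_fm g f \<Phi>"
proof (induction \<Phi>)
  case (Atom p ts)
  then obtain t where t: "t \<in> set ts" "c \<in> set_trm t" by auto
  have "f c \<le> size_trm f t" using t(2) by (cases t) auto
  also have "\<dots> \<le> size_list (size_trm f) ts" using t(1) by (rule size_list_estimation') simp
  finally show ?case by simp
qed auto

text \<open>A constant occurring in \<Phi> is a proper part of the name built from \<Phi>. Hence a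
  witness is fresh for its own formula, and no circle of mutually dependent witnesses can
  arise.\<close>

lemma size_Wit: "c \<in> set2_fm \<Phi> \<Longrightarrow> size c < size (Wit n x \<Phi>)"
  using size_fm_set2[of c \<Phi> size "\<lambda>_. 0"] by simp

lemma lang_simps [simp]:
  "\<^bold>\<bottom> \<in> lang \<sigma> n"
  "(\<Phi> \<^bold>\<rightarrow> \<Psi>) \<in> lang \<sigma> n \<longleftrightarrow> \<Phi> \<in> lang \<sigma> n \<and> \<Psi> \<in> lang \<sigma> n"
  "(\<Phi> \<^bold>\<and> \<Psi>) \<in> lang \<sigma> n \<longleftrightarrow> \<Phi> \<in> lang \<sigma> n \<and> \<Psi> \<in> lang \<sigma> n"
  "(\<Phi> \<^bold>\<or> \<Psi>) \<in> lang \<sigma> n \<longleftrightarrow> \<Phi> \<in> lang \<sigma> n \<and> \<Psi> \<in> lang \<sigma> n"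
  "\<^bold>\<sim> \<Phi> \<in> lang \<sigma> n \<longleftrightarrow> \<Phi> \<in> lang \<sigma> n"
  "\<^bold>\<box> \<Phi> \<in> lang \<sigma> n \<longleftrightarrow> \<Phi> \<in> lang \<sigma> n"
  "\<^bold>\<diamond> \<Phi> \<in> lang \<sigma> n \<longleftrightarrow> \<Phi> \<in> lang \<sigma> n"
  by (auto simp: lang_def Sent_def)

lemma lang_quantifier:
  "Forall x \<Phi> \<in> lang \<sigma> n \<longleftrightarrow> \<Phi> \<in> Form (hsig \<sigma>) \<and> fv \<Phi> \<subseteq> {x} \<and> set2_fm \<Phi> \<subseteq> hcs \<sigma> n"
  "Exists x \<Phi> \<in> lang \<sigma> n \<longleftrightarrow> \<Phi> \<in> Form (hsig \<sigma>) \<and> fv \<Phi> \<subseteq> {x} \<and> set2_fm \<Phi> \<subseteq> hcs \<sigma> n"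
  by (auto simp: lang_def Sent_def)

lemma lang_Sent: "lang \<sigma> n \<subseteq> Sent (hsig \<sigma>)"
  by (auto simp: lang_def)

lemma lang_Form: "lang \<sigma> n \<subseteq> Form (hsig \<sigma>)"
  by (auto simp: lang_def Sent_def)

lemma lang_mono: "n \<le> m \<Longrightarrow> lang \<sigma> n \<subseteq> lang \<sigma> m"
  by (auto simp: lang_def intro: hcs_mono)

section \<open>Instances and Henkin axioms in the language of a level\<close>

lemma fv_inst_Const: "fv (inst \<Phi> x (Const c)) \<subseteq> fv \<Phi> - {x}"
  using fv_subst[of "Var(x := Const c)" \<Phi>] by (auto simp: inst_def split: if_splits)

lemma set2_fm_inst_Const: "set2_fm (inst \<Phi> x (Const c)) \<subseteq> insert c (set2_fm \<Phi>)"
  using set2_fm_subst[of "Var(x := Const c)" \<Phi>] by (auto simp: inst_def split: if_splits)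

lemma inst_lang:
  assumes "Exists x \<Phi> \<in> lang \<sigma> n" "c \<in> hcs \<sigma> n"
  shows "inst \<Phi> x (Const c) \<in> lang \<sigma> n"
  using assms fv_inst_Const[of \<Phi> x c] set2_fm_inst_Const[of \<Phi> x c]
  by (auto simp: lang_quantifier) (auto simp: lang_def Sent_def inst_Form)

lemma Wit_hcs: "Exists x \<Phi> \<in> lang \<sigma> n \<Longrightarrow> Wit n x \<Phi> \<in> hcs \<sigma> n"
  using set1_fm_wf[of "hsig \<sigma>" \<Phi>] by (intro hcs.Wit) (auto simp: lang_quantifier Form_def)

lemma hax_lang: "Exists x \<Phi> \<in> lang \<sigma> n \<Longrightarrow> hax n x \<Phi> \<in> lang \<sigma> n"
  by (simp add: hax_def inst_lang Wit_hcs)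

text \<open>If the axiom were refutable, \<Gamma> would derive the existential sentence and refute
  its instance at \<open>c\<close>. As \<open>c\<close> is fresh, the refutation generalizes to
  \<not>\<Phi>, and the rule for \<exists> then refutes the existential sentence itself.\<close>

lemma henkin_axiom_conservative:
  assumes \<Gamma>: "\<Gamma> \<subseteq> Sent \<sigma>" and E: "Exists x \<Phi> \<in> Sent \<sigma>" and c: "c \<in> csyms \<sigma>"
    and fresh: "c \<notin> set2_fm \<Phi>" "\<And>\<Psi>. \<Psi> \<in> \<Gamma> \<Longrightarrow> c \<notin> set2_fm \<Psi>"
    and cons: "consistent \<sigma> \<Gamma>"
  shows "consistent \<sigma> (insert (Exists x \<Phi> \<^bold>\<rightarrow> inst \<Phi> x (Const c)) \<Gamma>)"
proof (rule ccontr)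
  let ?A = "Exists x \<Phi>" and ?B = "inst \<Phi> x (Const c)"
  assume "\<not> ?thesis"
  then have bot: "\<^bold>\<bottom> \<in> mpc \<sigma> (insert (?A \<^bold>\<rightarrow> ?B) \<Gamma>)" by (simp add: consistent_def)
  have F: "\<Phi> \<in> Form \<sigma>" "?A \<in> Form \<sigma>" "?B \<in> Form \<sigma>" "\<Gamma> \<subseteq> Form \<sigma>"
    using E \<Gamma> c by (auto simp: Sent_def inst_Form)
  have neg: "\<^bold>\<not> (?A \<^bold>\<rightarrow> ?B) \<in> mpc \<sigma> \<Gamma>" using F by (intro mpc_deduction bot) auto
  have A: "?A \<in> mpc \<sigma> \<Gamma>"
  proof (rule mpc_ccontr)
    have "\<^bold>\<bottom> \<in> mpc \<sigma> (insert ?A (insert (\<^bold>\<not> ?A) \<Gamma>))"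
      by (rule mpc.MP[of ?A]) (simp_all add: mpc.Hyp)
    then have "?B \<in> mpc \<sigma> (insert ?A (insert (\<^bold>\<not> ?A) \<Gamma>))" by (rule mpc_BotE) (use F in auto)
    then have "?A \<^bold>\<rightarrow> ?B \<in> mpc \<sigma> (insert (\<^bold>\<not> ?A) \<Gamma>)" using F by (intro mpc_deduction) auto
    then show "\<^bold>\<bottom> \<in> mpc \<sigma> (insert (\<^bold>\<not> ?A) \<Gamma>)"
      by (rule mpc.MP) (rule mpc_mono[OF neg], auto)
  qed (use F in auto)
  have "?B \<in> mpc \<sigma> (insert ?B \<Gamma>)" by (simp add: mpc.Hyp)
  then have "?A \<^bold>\<rightarrow> ?B \<in> mpc \<sigma> (insert ?B \<Gamma>)" using F by (intro mpc_K)
  then have "\<^bold>\<bottom> \<in> mpc \<sigma> (insert ?B \<Gamma>)" by (rule mpc.MP) (rule mpc_mono[OF neg], auto)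
  then have "\<^bold>\<not> ?B \<in> mpc \<sigma> \<Gamma>" using F by (intro mpc_deduction)
  then have "inst (\<^bold>\<not> \<Phi>) x (Const c) \<in> mpc \<sigma> \<Gamma>" by (simp add: inst_def)
  then have "\<^bold>\<not> \<Phi> \<in> mpc \<sigma> \<Gamma>"
    by (rule mpc_generalize_constant) (use \<Gamma> F fresh in auto)
  then have "\<^bold>\<not> ?A \<in> mpc \<sigma> \<Gamma>" using \<Gamma> by (intro mpc_BR2) auto
  then show False using mpc.MP[OF A] cons by (simp add: consistent_def)
qed

lemma henkin_axioms_conservative:
  assumes T0: "T0 \<subseteq> Sent (hsig \<sigma>)" "consistent (hsig \<sigma>) T0"
    and fresh: "\<And>\<Psi> x \<Phi>. \<Psi> \<in> T0 \<Longrightarrow> Wit n x \<Phi> \<notin> set2_fm \<Psi>"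
    and P: "finite P"
  shows "(\<forall>(x, \<Phi>)\<in>P. Exists x \<Phi> \<in> lang \<sigma> n) \<Longrightarrow>
    consistent (hsig \<sigma>) (T0 \<union> (\<lambda>(x, \<Phi>). hax n x \<Phi>) ` P)"
  using P
proof (induction P rule: finite_ranking_induct[where f = "\<lambda>(x, \<Phi>). size (Wit n x \<Phi>)"])
  case empty
  then show ?case using T0 by simp
next
  case (insert y S)
  show ?case
  proof (cases "y \<in> S")
    case True
    then show ?thesis using insert by (simp add: insert_absorb)
  next
    case False
    obtain x \<Phi> where y: "y = (x, \<Phi>)" by (cases y)
    let ?\<Gamma> = "T0 \<union> (\<lambda>(x, \<Phi>). hax n x \<Phi>) ` S"
    have \<Gamma>: "?\<Gamma> \<subseteq> Sent (hsig \<sigma>)" using T0 insert.prems hax_lang lang_Sent by fastforce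
    have E: "Exists x \<Phi> \<in> Sent (hsig \<sigma>)" using insert.prems y lang_Sent by auto
    \<comment> \<open>The new witness could occur in another axiom as that axiom's own witness, but
      the pairs are distinct, or inside \<Psi>, but then it would be strictly smaller than
      \<open>Wit n z \<Psi>\<close>, against the ranking.\<close>
    have "Wit n x \<Phi> \<notin> set2_fm (hax n z \<Psi>)" if "(z, \<Psi>) \<in> S" for z \<Psi>
    proof
      assume "Wit n x \<Phi> \<in> set2_fm (hax n z \<Psi>)"
      then have "Wit n x \<Phi> = Wit n z \<Psi> \<or> Wit n x \<Phi> \<in> set2_fm \<Psi>"
        using set2_fm_inst_Const[of \<Psi> z "Wit n z \<Psi>"] by (auto simp: hax_def)
      then show False
        using False that y insert.hyps(2)[OF that] size_Wit[of "Wit n x \<Phi>" \<Psi> n z] by auto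
    qed
    then have "\<And>\<Psi>. \<Psi> \<in> ?\<Gamma> \<Longrightarrow> Wit n x \<Phi> \<notin> set2_fm \<Psi>" using fresh by auto
    moreover have "Wit n x \<Phi> \<notin> set2_fm \<Phi>" using size_Wit[of "Wit n x \<Phi>" \<Phi> n x] by auto
    moreover have "consistent (hsig \<sigma>) ?\<Gamma>" using insert by simp
    ultimately have "consistent (hsig \<sigma>) (insert (hax n x \<Phi>) ?\<Gamma>)"
      unfolding hax_def[of n x \<Phi>] using \<Gamma> E by (intro henkin_axiom_conservative) (auto simp: hsig_def)
    then show ?thesis using y by simp
  qed
qed

text \<open>Since every witness is named in advance, all Henkin axioms of the level are added at
  once and maximization comes last. Compactness reduces their joint consistency to finitely many
  axioms.\<close>

lemma henkin_extension:
  assumes T0: "T0 \<subseteq> lang \<sigma> n" "consistent (hsig \<sigma>) T0"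
    and fresh: "\<And>\<Psi> x \<Phi>. \<Psi> \<in> T0 \<Longrightarrow> Wit n x \<Phi> \<notin> set2_fm \<Psi>"
  shows "\<exists>T. T0 \<subseteq> T \<and> (n, T) \<in> cworlds \<sigma>"
proof -
  define P where "P = {(x, \<Phi>). Exists x \<Phi> \<in> lang \<sigma> n}"
  let ?h = "\<lambda>(x, \<Phi>). hax n x \<Phi>"
  have "consistent (hsig \<sigma>) (T0 \<union> ?h ` P)"
    unfolding consistent_def
  proof
    assume "\<^bold>\<bottom> \<in> mpc (hsig \<sigma>) (T0 \<union> ?h ` P)"
    from mpc_compact[OF this] obtain \<Gamma>0
      where \<Gamma>0: "finite \<Gamma>0" "\<Gamma>0 \<subseteq> T0 \<union> ?h ` P" "\<^bold>\<bottom> \<in> mpc (hsig \<sigma>) \<Gamma>0" by auto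
    have "finite (\<Gamma>0 - T0)" "\<Gamma>0 - T0 \<subseteq> ?h ` P" using \<Gamma>0 by auto
    from finite_subset_image[OF this] obtain P0 where P0: "P0 \<subseteq> P" "finite P0" "\<Gamma>0 - T0 = ?h ` P0" by auto
    have "consistent (hsig \<sigma>) (T0 \<union> ?h ` P0)"
      by (rule henkin_axioms_conservative[OF _ T0(2) fresh P0(2)])
        (use T0(1) lang_Sent P0(1) in \<open>auto simp: P_def\<close>)
    moreover have "\<^bold>\<bottom> \<in> mpc (hsig \<sigma>) (T0 \<union> ?h ` P0)" by (rule mpc_mono[OF \<Gamma>0(3)]) (use P0(3) in auto)
    ultimately show False by (simp add: consistent_def)
  qed
  moreover have "T0 \<union> ?h ` P \<subseteq> lang \<sigma> n" using T0(1) hax_lang by (auto simp: P_def)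
  ultimately obtain T where T: "T0 \<union> ?h ` P \<subseteq> T" "mcs (hsig \<sigma>) (lang \<sigma> n) T"
    using lindenbaum[of "T0 \<union> ?h ` P" "lang \<sigma> n" "hsig \<sigma>"] by auto
  then have "(n, T) \<in> cworlds \<sigma>" by (force simp: cworlds_def P_def)
  then show ?thesis using T(1) by auto
qed

section \<open>Membership in the worlds of the canonical model\<close>

context
  fixes \<sigma> :: "('p, 'c) signature" and n T
  assumes world: "(n, T) \<in> cworlds \<sigma>"
begin

lemma cworld_mcs: "mcs (hsig \<sigma>) (lang \<sigma> n) T"
  using world by (simp add: cworlds_def)

lemmas cworld_Bot = mcs_Bot[OF cworld_mcs lang_Form]
  and cworld_Imp = mcs_Imp[OF cworld_mcs lang_Form]
  and cworld_Neg = mcs_Neg[OF cworld_mcs lang_Form]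
  and cworld_Con = mcs_Con[OF cworld_mcs lang_Form]
  and cworld_Dis = mcs_Dis[OF cworld_mcs lang_Form]
  and cworld_theorem_Imp = mcs_theorem_Imp[OF cworld_mcs lang_Form]
  and cworld_theorem_Iff = mcs_theorem_Iff[OF cworld_mcs lang_Form]

lemma cworld_theorem: "\<Phi> \<in> QBKo (hsig \<sigma>) \<Longrightarrow> \<Phi> \<in> lang \<sigma> n \<Longrightarrow> \<Phi> \<in> T"
  using mcs_mpc[OF cworld_mcs lang_Form, of \<Phi>] by (simp add: mpc.Thm)

lemma cworld_lang: "T \<subseteq> lang \<sigma> n"
  using cworld_mcs by (simp add: mcs_def)

lemma lang_FormD: "\<Phi> \<in> lang \<sigma> n \<Longrightarrow> \<Phi> \<in> Form (hsig \<sigma>)"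
  using lang_Form by blast

text \<open>If \<box>\<Phi> is missing, the unboxed sentences of \<open>T\<close> together with
  \<not>\<Phi> are consistent by \<open>mpc_Box\<close>. They stay in the language of level
  \<open>n\<close>, so the witnesses of level \<open>n + 1\<close> are fresh for them and a
  successor refuting \<Phi> exists.\<close>

lemma cworld_Box:
  assumes "\<Phi> \<in> lang \<sigma> n"
  shows "\<^bold>\<box> \<Phi> \<in> T \<longleftrightarrow> (\<forall>T'. (Suc n, T') \<in> cworlds \<sigma> \<longrightarrow> {\<Psi>. \<^bold>\<box> \<Psi> \<in> T} \<subseteq> T' \<longrightarrow> \<Phi> \<in> T')"
proof
  assume R: "\<forall>T'. (Suc n, T') \<in> cworlds \<sigma> \<longrightarrow> {\<Psi>. \<^bold>\<box> \<Psi> \<in> T} \<subseteq> T' \<longrightarrow> \<Phi> \<in> T'"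
  show "\<^bold>\<box> \<Phi> \<in> T"
  proof (rule ccontr)
    assume notin: "\<^bold>\<box> \<Phi> \<notin> T"
    let ?B = "{\<Psi>. \<^bold>\<box> \<Psi> \<in> T}"
    have B: "?B \<subseteq> lang \<sigma> n" using cworld_lang by auto
    have "consistent (hsig \<sigma>) (insert (\<^bold>\<not> \<Phi>) ?B)"
      unfolding consistent_def
    proof
      assume "\<^bold>\<bottom> \<in> mpc (hsig \<sigma>) (insert (\<^bold>\<not> \<Phi>) ?B)"
      then have "\<Phi> \<in> mpc (hsig \<sigma>) ?B"
        by (rule mpc_ccontr) (use lang_FormD assms B in auto)
      then have "\<^bold>\<box> \<Phi> \<in> mpc (hsig \<sigma>) T"
        by (intro mpc_Box) (use lang_FormD cworld_lang in auto)
      then show False using notin assms mcs_mpc[OF cworld_mcs lang_Form, of "\<^bold>\<box> \<Phi>"] by simp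
    qed
    moreover have sub: "insert (\<^bold>\<not> \<Phi>) ?B \<subseteq> lang \<sigma> n" using B assms by auto
    moreover have "lang \<sigma> n \<subseteq> lang \<sigma> (Suc n)" by (intro lang_mono) simp
    moreover have "Wit (Suc n) x \<Theta> \<notin> set2_fm \<Psi>" if "\<Psi> \<in> insert (\<^bold>\<not> \<Phi>) ?B" for x \<Theta> \<Psi>
    proof
      assume "Wit (Suc n) x \<Theta> \<in> set2_fm \<Psi>"
      moreover have "\<Psi> \<in> lang \<sigma> n" using sub that by (rule subsetD)
      ultimately have "Wit (Suc n) x \<Theta> \<in> hcs \<sigma> n" by (auto simp: lang_def)
      then show False using Wit_in_hcs_level by fastforce
    qed
    ultimately obtain T' where T': "insert (\<^bold>\<not> \<Phi>) ?B \<subseteq> T'" "(Suc n, T') \<in> cworlds \<sigma>"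
      using henkin_extension[of "insert (\<^bold>\<not> \<Phi>) ?B" \<sigma> "Suc n"] by (metis (no_types, lifting) subset_trans)
    then have "\<Phi> \<in> T'" using R by simp
    moreover have "\<Phi> \<in> lang \<sigma> (Suc n)" using assms lang_mono[of n "Suc n"] by auto
    ultimately show False
      using T'(1) mcs_Neg[of "hsig \<sigma>" "lang \<sigma> (Suc n)" T' \<Phi>] T'(2) lang_Form
      by (auto simp: cworlds_def)
  qed
qed auto

text \<open>Reduction to \<open>cworld_Box\<close> through \<not>\<diamond>\<Phi> \<leftrightarrow>
  \<box>\<not>\<Phi>: classical negation is non-membership both in \<open>T\<close> and in its
  successors.\<close>

lemma cworld_Dia:
  assumes "\<Phi> \<in> lang \<sigma> n"
  shows "\<^bold>\<diamond> \<Phi> \<in> T \<longleftrightarrow> (\<exists>T'. (Suc n, T') \<in> cworlds \<sigma> \<and> {\<Psi>. \<^bold>\<box> \<Psi> \<in> T} \<subseteq> T' \<and> \<Phi> \<in> T')"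
proof -
  have "\<^bold>\<diamond> \<Phi> \<notin> T \<longleftrightarrow> \<^bold>\<not> \<^bold>\<diamond> \<Phi> \<in> T" using assms by (simp add: cworld_Neg)
  also have "\<dots> \<longleftrightarrow> \<^bold>\<box> \<^bold>\<not> \<Phi> \<in> T"
    by (rule cworld_theorem_Iff) (use assms lang_FormD in \<open>auto intro: QBKo.Ax NegDia\<close>)
  also have "\<dots> \<longleftrightarrow> (\<forall>T'. (Suc n, T') \<in> cworlds \<sigma> \<longrightarrow> {\<Psi>. \<^bold>\<box> \<Psi> \<in> T} \<subseteq> T' \<longrightarrow> \<^bold>\<not> \<Phi> \<in> T')"
    using assms by (intro cworld_Box) simp
  also have "\<dots> \<longleftrightarrow> (\<forall>T'. (Suc n, T') \<in> cworlds \<sigma> \<longrightarrow> {\<Psi>. \<^bold>\<box> \<Psi> \<in> T} \<subseteq> T' \<longrightarrow> \<Phi> \<notin> T')"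
  proof -
    have "\<^bold>\<not> \<Phi> \<in> T' \<longleftrightarrow> \<Phi> \<notin> T'" if "(Suc n, T') \<in> cworlds \<sigma>" for T'
      using that assms lang_mono[of n "Suc n" \<sigma>]
      by (intro mcs_Neg[of "hsig \<sigma>" "lang \<sigma> (Suc n)", OF _ lang_Form]) (auto simp: cworlds_def)
    then show ?thesis by auto
  qed
  finally show ?thesis by blast
qed

lemma cworld_Exists:
  assumes "Exists x \<Phi> \<in> lang \<sigma> n"
  shows "Exists x \<Phi> \<in> T \<longleftrightarrow> (\<exists>c\<in>hcs \<sigma> n. inst \<Phi> x (Const c) \<in> T)"
proof
  assume "Exists x \<Phi> \<in> T"
  moreover have "hax n x \<Phi> \<in> T" using assms world by (auto simp: cworlds_def)
  ultimately have "inst \<Phi> x (Const (Wit n x \<Phi>)) \<in> T"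
    using assms by (simp add: hax_def cworld_Imp inst_lang Wit_hcs)
  then show "\<exists>c\<in>hcs \<sigma> n. inst \<Phi> x (Const c) \<in> T" using Wit_hcs[OF assms] by blast
next
  assume "\<exists>c\<in>hcs \<sigma> n. inst \<Phi> x (Const c) \<in> T"
  then obtain c where "inst \<Phi> x (Const c) \<in> T" by blast
  moreover have "inst \<Phi> x (Const c) \<^bold>\<rightarrow> Exists x \<Phi> \<in> QBKo (hsig \<sigma>)"
    using assms by (intro QBKo.Ax ExI) (auto simp: lang_quantifier)
  ultimately show "Exists x \<Phi> \<in> T" using assms cworld_theorem_Imp by blast
qed

text \<open>If all instances belong to \<open>T\<close>, no constant can witness \<exists>x
  \<not>\<Phi>; so this sentence is absent by \<open>cworld_Exists\<close>, and duality gives the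
  universal one.\<close>

lemma cworld_Forall:
  assumes "Forall x \<Phi> \<in> lang \<sigma> n"
  shows "Forall x \<Phi> \<in> T \<longleftrightarrow> (\<forall>c\<in>hcs \<sigma> n. inst \<Phi> x (Const c) \<in> T)"
proof
  assume A: "Forall x \<Phi> \<in> T"
  show "\<forall>c\<in>hcs \<sigma> n. inst \<Phi> x (Const c) \<in> T"
  proof
    fix c assume "c \<in> hcs \<sigma> n"
    then have "inst \<Phi> x (Const c) \<in> lang \<sigma> n" using assms by (intro inst_lang) (simp_all add: lang_quantifier)
    moreover have "Forall x \<Phi> \<^bold>\<rightarrow> inst \<Phi> x (Const c) \<in> QBKo (hsig \<sigma>)"
      using assms by (intro QBKo.Ax AllE) (auto simp: lang_quantifier)
    ultimately show "inst \<Phi> x (Const c) \<in> T" using A cworld_theorem_Imp by blast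
  qed
next
  assume all: "\<forall>c\<in>hcs \<sigma> n. inst \<Phi> x (Const c) \<in> T"
  have E: "Exists x (\<^bold>\<not> \<Phi>) \<in> lang \<sigma> n" using assms by (simp add: lang_quantifier)
  have "Exists x (\<^bold>\<not> \<Phi>) \<notin> T"
  proof
    assume "Exists x (\<^bold>\<not> \<Phi>) \<in> T"
    then obtain c where c: "c \<in> hcs \<sigma> n" "inst (\<^bold>\<not> \<Phi>) x (Const c) \<in> T" using cworld_Exists[OF E] by blast
    have "inst \<Phi> x (Const c) \<in> lang \<sigma> n" using assms c(1) by (intro inst_lang) (simp_all add: lang_quantifier)
    then show False using c all by (simp add: inst_def cworld_Neg)
  qed
  then have "\<^bold>\<not> Exists x (\<^bold>\<not> \<Phi>) \<in> T" using E by (simp add: cworld_Neg)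
  moreover have "\<^bold>\<not> Exists x (\<^bold>\<not> \<Phi>) \<^bold>\<rightarrow> Forall x \<Phi> \<in> QBKo (hsig \<sigma>)"
    using assms by (intro QBKo_not_Exists_not) (simp add: lang_quantifier)
  ultimately show "Forall x \<Phi> \<in> T" using assms cworld_theorem_Imp by blast
qed

section \<open>Strong negation in a world\<close>

lemma cworld_SNeg:
  "\<^bold>\<sim> \<^bold>\<bottom> \<in> T"
  "\<Phi> \<in> lang \<sigma> n \<Longrightarrow> \<^bold>\<sim> \<^bold>\<sim> \<Phi> \<in> T \<longleftrightarrow> \<Phi> \<in> T"
  "\<Phi> \<in> lang \<sigma> n \<Longrightarrow> \<Psi> \<in> lang \<sigma> n \<Longrightarrow> \<^bold>\<sim> (\<Phi> \<^bold>\<rightarrow> \<Psi>) \<in> T \<longleftrightarrow> \<Phi> \<in> T \<and> \<^bold>\<sim> \<Psi> \<in> T"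
  "\<Phi> \<in> lang \<sigma> n \<Longrightarrow> \<Psi> \<in> lang \<sigma> n \<Longrightarrow> \<^bold>\<sim> (\<Phi> \<^bold>\<and> \<Psi>) \<in> T \<longleftrightarrow> \<^bold>\<sim> \<Phi> \<in> T \<or> \<^bold>\<sim> \<Psi> \<in> T"
  "\<Phi> \<in> lang \<sigma> n \<Longrightarrow> \<Psi> \<in> lang \<sigma> n \<Longrightarrow> \<^bold>\<sim> (\<Phi> \<^bold>\<or> \<Psi>) \<in> T \<longleftrightarrow> \<^bold>\<sim> \<Phi> \<in> T \<and> \<^bold>\<sim> \<Psi> \<in> T"
  "Forall x \<Phi> \<in> lang \<sigma> n \<Longrightarrow> \<^bold>\<sim> (Forall x \<Phi>) \<in> T \<longleftrightarrow> Exists x (\<^bold>\<sim> \<Phi>) \<in> T"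
  "Exists x \<Phi> \<in> lang \<sigma> n \<Longrightarrow> \<^bold>\<sim> (Exists x \<Phi>) \<in> T \<longleftrightarrow> Forall x (\<^bold>\<sim> \<Phi>) \<in> T"
proof -
  note ax = QBKo.Ax[OF SNegSNeg] QBKo.Ax[OF SNegImp] QBKo.Ax[OF SNegCon] QBKo.Ax[OF SNegDis]
    QBKo.Ax[OF SNegAll] QBKo.Ax[OF SNegEx]
  show "\<^bold>\<sim> \<^bold>\<bottom> \<in> T" by (intro cworld_theorem QBKo.Ax SNegBot) simp
  show "\<^bold>\<sim> \<^bold>\<sim> \<Phi> \<in> T \<longleftrightarrow> \<Phi> \<in> T" if "\<Phi> \<in> lang \<sigma> n"
    using that by (intro cworld_theorem_Iff ax lang_FormD) auto
  show "\<^bold>\<sim> (\<Phi> \<^bold>\<rightarrow> \<Psi>) \<in> T \<longleftrightarrow> \<Phi> \<in> T \<and> \<^bold>\<sim> \<Psi> \<in> T" if "\<Phi> \<in> lang \<sigma> n" "\<Psi> \<in> lang \<sigma> n"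
    using that cworld_theorem_Iff[OF ax(2), of \<Phi> \<Psi>] by (simp add: lang_FormD cworld_Con)
  show "\<^bold>\<sim> (\<Phi> \<^bold>\<and> \<Psi>) \<in> T \<longleftrightarrow> \<^bold>\<sim> \<Phi> \<in> T \<or> \<^bold>\<sim> \<Psi> \<in> T" if "\<Phi> \<in> lang \<sigma> n" "\<Psi> \<in> lang \<sigma> n"
    using that cworld_theorem_Iff[OF ax(3), of \<Phi> \<Psi>] by (simp add: lang_FormD cworld_Dis)
  show "\<^bold>\<sim> (\<Phi> \<^bold>\<or> \<Psi>) \<in> T \<longleftrightarrow> \<^bold>\<sim> \<Phi> \<in> T \<and> \<^bold>\<sim> \<Psi> \<in> T" if "\<Phi> \<in> lang \<sigma> n" "\<Psi> \<in> lang \<sigma> n"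
    using that cworld_theorem_Iff[OF ax(4), of \<Phi> \<Psi>] by (simp add: lang_FormD cworld_Con)
  show "\<^bold>\<sim> (Forall x \<Phi>) \<in> T \<longleftrightarrow> Exists x (\<^bold>\<sim> \<Phi>) \<in> T" if "Forall x \<Phi> \<in> lang \<sigma> n"
    using that by (intro cworld_theorem_Iff ax) (auto simp: lang_quantifier)
  show "\<^bold>\<sim> (Exists x \<Phi>) \<in> T \<longleftrightarrow> Forall x (\<^bold>\<sim> \<Phi>) \<in> T" if "Exists x \<Phi> \<in> lang \<sigma> n"
    using that by (intro cworld_theorem_Iff ax) (auto simp: lang_quantifier)
qed

text \<open>These equivalences come from the strongly negated half of the axioms with
  \<Leftrightarrow>, followed by cancellation of a double strong negation.\<close>

lemma cworld_SNeg_Box: "\<Phi> \<in> lang \<sigma> n \<Longrightarrow> \<^bold>\<sim> \<^bold>\<box> \<Phi> \<in> T \<longleftrightarrow> \<^bold>\<diamond> \<^bold>\<sim> \<Phi> \<in> T"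
  and cworld_SNeg_Dia: "\<Phi> \<in> lang \<sigma> n \<Longrightarrow> \<^bold>\<sim> \<^bold>\<diamond> \<Phi> \<in> T \<longleftrightarrow> \<^bold>\<box> \<^bold>\<sim> \<Phi> \<in> T"
proof -
  have SIff: "\<^bold>\<sim> \<Phi> \<in> T \<longleftrightarrow> \<^bold>\<sim> \<Psi> \<in> T"
    if "(\<Phi> \<^bold>\<Leftrightarrow> \<Psi>) \<in> QBKo (hsig \<sigma>)" "\<Phi> \<in> lang \<sigma> n" "\<Psi> \<in> lang \<sigma> n" for \<Phi> \<Psi>
  proof (rule cworld_theorem_Iff)
    show "(\<^bold>\<sim> \<Phi> \<^bold>\<leftrightarrow> \<^bold>\<sim> \<Psi>) \<in> QBKo (hsig \<sigma>)"
      using mpc_ConE(2)[OF mpc.Thm[OF that(1)], of "{}"] mpc_empty by blast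
  qed (use that in auto)
  show "\<^bold>\<sim> \<^bold>\<box> \<Phi> \<in> T \<longleftrightarrow> \<^bold>\<diamond> \<^bold>\<sim> \<Phi> \<in> T" if "\<Phi> \<in> lang \<sigma> n"
    using that SIff[OF QBKo.Ax[OF BoxDia], of \<Phi>] by (simp add: lang_FormD cworld_SNeg)
  show "\<^bold>\<sim> \<^bold>\<diamond> \<Phi> \<in> T \<longleftrightarrow> \<^bold>\<box> \<^bold>\<sim> \<Phi> \<in> T" if "\<Phi> \<in> lang \<sigma> n"
    using that SIff[OF QBKo.Ax[OF DiaBox], of \<Phi>] by (simp add: lang_FormD cworld_SNeg)
qed

lemma cworld_SEM: "\<Phi> \<in> lang \<sigma> n \<Longrightarrow> \<Phi> \<in> T \<or> \<^bold>\<sim> \<Phi> \<in> T"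
  using cworld_theorem[OF QBKo.Ax[OF SEM], of \<Phi>] by (simp add: lang_FormD cworld_Dis)

end

section \<open>The canonical model\<close>

text \<open>Constants of \<sigma> outside \<open>used_csyms\<close> have no Henkin counterpart but
  need a value in every domain, equal at all worlds. \<open>Fv 0\<close> belongs to all levels and
  provides it.\<close>

fun cstruc :: "('p, 'c) signature \<Rightarrow> (('p, 'c) hc \<Rightarrow> 'a) \<Rightarrow> bool \<Rightarrow>
    nat \<times> ('p, ('p, 'c) hc) fm set \<Rightarrow> ('p, 'c, 'a) struc" where
  "cstruc \<sigma> i b (n, T) =
    \<lparr>univ = i ` hcs \<sigma> n,
     cint = (\<lambda>c. i (if c \<in> used_csyms \<sigma> then Orig c else Fv 0)),
     pint = (\<lambda>p. {map i cs | cs. set cs \<subseteq> hcs \<sigma> n \<and>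
       (if b then Atom p (map Const cs) else \<^bold>\<sim> (Atom p (map Const cs))) \<in> T})\<rparr>"

text \<open>The maps \<open>j\<close> and \<open>i\<close> copy the canonical worlds and constants
  into the prescribed types \<open>'w\<close> and \<open>'a\<close>; \<open>inv_into\<close>
  recovers the canonical world from its copy.\<close>

definition cmodel :: "('p, 'c) signature \<Rightarrow> (nat \<times> ('p, ('p, 'c) hc) fm set \<Rightarrow> 'w) \<Rightarrow>
    (('p, 'c) hc \<Rightarrow> 'a) \<Rightarrow> ('w, 'p, 'c, 'a) model" where
  "cmodel \<sigma> j i =
    \<lparr>worlds = j ` cworlds \<sigma>,
     acc = {(j (n, T), j (Suc n, T')) | n T T'.
       (n, T) \<in> cworlds \<sigma> \<and> (Suc n, T') \<in> cworlds \<sigma> \<and> {\<Psi>. \<^bold>\<box> \<Psi> \<in> T} \<subseteq> T'},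
     pos = (\<lambda>w. cstruc \<sigma> i True (inv_into (cworlds \<sigma>) j w)),
     neg = (\<lambda>w. cstruc \<sigma> i False (inv_into (cworlds \<sigma>) j w))\<rparr>"

lemma set2_fm_subst_Const:
  assumes "set2_fm \<Phi> \<subseteq> C" "\<forall>x. e x \<in> C"
  shows "set2_fm (subst (Const \<circ> e) \<Phi>) \<subseteq> C"
  using set2_fm_subst[of "Const \<circ> e" \<Phi>] assms by auto

lemma subst_lang:
  assumes "\<Phi> \<in> Form (hsig \<sigma>)" "set2_fm \<Phi> \<subseteq> hcs \<sigma> n" "\<forall>x. e x \<in> hcs \<sigma> n"
  shows "subst (Const \<circ> e) \<Phi> \<in> lang \<sigma> n"
proof -
  have "wf_fm (hsig \<sigma>) (subst (Const \<circ> e) \<Phi>)" using assms(1) by (intro wf_fm_subst) (auto simp: Form_def)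
  moreover have "fv (subst (Const \<circ> e) \<Phi>) = {}" using fv_subst[of "Const \<circ> e" \<Phi>] by auto
  ultimately show ?thesis using set2_fm_subst_Const[OF assms(2,3)] by (simp add: lang_def Sent_def Form_def)
qed

context
  fixes \<sigma> :: "('p, 'c) signature" and j :: "nat \<times> ('p, ('p, 'c) hc) fm set \<Rightarrow> 'w" and i :: "('p, 'c) hc \<Rightarrow> 'a"
  assumes j: "inj_on j (cworlds \<sigma>)" and i: "inj_on i (\<Union>n. hcs \<sigma> n)"
begin

lemma cmodel_struc [simp]:
  assumes "w \<in> cworlds \<sigma>"
  shows "pos (cmodel \<sigma> j i) (j w) = cstruc \<sigma> i True w" "neg (cmodel \<sigma> j i) (j w) = cstruc \<sigma> i False w"
  using assms by (simp_all add: cmodel_def inv_into_f_f[OF j])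

lemma cmodel_acc:
  assumes "(n, T) \<in> cworlds \<sigma>"
  shows "(j (n, T), v) \<in> acc (cmodel \<sigma> j i) \<longleftrightarrow>
    (\<exists>T'. v = j (Suc n, T') \<and> (Suc n, T') \<in> cworlds \<sigma> \<and> {\<Psi>. \<^bold>\<box> \<Psi> \<in> T} \<subseteq> T')"
proof
  assume "(j (n, T), v) \<in> acc (cmodel \<sigma> j i)"
  then obtain m S T' where *: "j (n, T) = j (m, S)" "v = j (Suc m, T')" "(m, S) \<in> cworlds \<sigma>"
      "(Suc m, T') \<in> cworlds \<sigma>" "{\<Psi>. \<^bold>\<box> \<Psi> \<in> S} \<subseteq> T'"
    by (auto simp: cmodel_def)
  then have "(n, T) = (m, S)" using inj_onD[OF j *(1) assms *(3)] by simp
  with * show "\<exists>T'. v = j (Suc n, T') \<and> (Suc n, T') \<in> cworlds \<sigma> \<and> {\<Psi>. \<^bold>\<box> \<Psi> \<in> T} \<subseteq> T'" by auto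
next
  assume "\<exists>T'. v = j (Suc n, T') \<and> (Suc n, T') \<in> cworlds \<sigma> \<and> {\<Psi>. \<^bold>\<box> \<Psi> \<in> T} \<subseteq> T'"
  then show "(j (n, T), v) \<in> acc (cmodel \<sigma> j i)" using assms by (auto simp: cmodel_def)
qed

lemma cstruc_pint:
  assumes "set cs \<subseteq> hcs \<sigma> n"
  shows "map i cs \<in> pint (cstruc \<sigma> i b (n, T)) p \<longleftrightarrow>
    (if b then Atom p (map Const cs) else \<^bold>\<sim> (Atom p (map Const cs))) \<in> T"
proof -
  have "map i cs = map i cs' \<longleftrightarrow> cs = cs'" if "set cs' \<subseteq> hcs \<sigma> n" for cs'
    by (rule inj_on_map_eq_map, rule inj_on_subset[OF i]) (use assms that in auto)
  then show ?thesis using assms by auto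
qed

text \<open>The claim concerns open formulas under an environment of Henkin constants, so the
  quantifier cases use the induction hypothesis for the body with an updated environment instead of
  an instance. World and level vary because of the modal cases.\<close>

lemma truth_lemma:
  "\<Phi> \<in> Form (hsig \<sigma>) \<Longrightarrow> (n, T) \<in> cworlds \<sigma> \<Longrightarrow> set2_fm \<Phi> \<subseteq> hcs \<sigma> n \<Longrightarrow> \<forall>x. e x \<in> hcs \<sigma> n \<Longrightarrow>
    (sat (cmodel \<sigma> j i) i \<Phi> True (j (n, T)) (i \<circ> e) \<longleftrightarrow> subst (Const \<circ> e) \<Phi> \<in> T) \<and>
    (sat (cmodel \<sigma> j i) i \<Phi> False (j (n, T)) (i \<circ> e) \<longleftrightarrow> \<^bold>\<sim> (subst (Const \<circ> e) \<Phi>) \<in> T)"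
proof (induction \<Phi> arbitrary: n T e)
  case (Atom p ts)
  let ?cs = "map (teval id e) ts"
  have "teval id e t \<in> hcs \<sigma> n" if "t \<in> set ts" for t
    using Atom.prems(3,4) that by (cases t) force+
  then have cs: "set ?cs \<subseteq> hcs \<sigma> n" by auto
  have "(teval i (i \<circ> e)) t = (i \<circ> teval id e) t" "tsubst (Const \<circ> e) t = (Const \<circ> teval id e) t" for t
    by (cases t; simp)+
  then have "map (teval i (i \<circ> e)) ts = map i ?cs" "map (tsubst (Const \<circ> e)) ts = map Const ?cs"
    by simp_all
  then show ?case using cstruc_pint[OF cs, of True T p] cstruc_pint[OF cs, of False T p] Atom.prems(2)
    by (simp only: sat.simps subst.simps cmodel_struc if_True if_False simp_thms)
next
  case Bot
  then show ?case by (simp add: cworld_Bot cworld_SNeg)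
next
  case (Imp \<Phi> \<Psi>)
  have "subst (Const \<circ> e) \<Phi> \<in> lang \<sigma> n" "subst (Const \<circ> e) \<Psi> \<in> lang \<sigma> n"
    by (rule subst_lang; use Imp.prems in simp)+
  then show ?case using Imp by (simp add: cworld_Imp cworld_SNeg del: comp_apply)
next
  case (Con \<Phi> \<Psi>)
  have "subst (Const \<circ> e) \<Phi> \<in> lang \<sigma> n" "subst (Const \<circ> e) \<Psi> \<in> lang \<sigma> n"
    by (rule subst_lang; use Con.prems in simp)+
  then show ?case using Con by (simp add: cworld_Con cworld_SNeg del: comp_apply)
next
  case (Dis \<Phi> \<Psi>)
  have "subst (Const \<circ> e) \<Phi> \<in> lang \<sigma> n" "subst (Const \<circ> e) \<Psi> \<in> lang \<sigma> n"
    by (rule subst_lang; use Dis.prems in simp)+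
  then show ?case using Dis by (simp add: cworld_Dis cworld_SNeg del: comp_apply)
next
  case (SNeg \<Phi>)
  have "subst (Const \<circ> e) \<Phi> \<in> lang \<sigma> n" by (rule subst_lang) (use SNeg.prems in simp_all)
  then show ?case using SNeg by (simp add: cworld_SNeg del: comp_apply)
next
  case (Box \<Phi>)
  have "subst (Const \<circ> e) \<Phi> \<in> lang \<sigma> n" by (rule subst_lang) (use Box.prems in simp_all)
  \<comment> \<open>The constants of level \<open>n\<close> remain available at level
    \<open>n + 1\<close>, so the same environment is admissible at the successors.\<close>
  moreover have "(sat (cmodel \<sigma> j i) i \<Phi> True (j (Suc n, T')) (i \<circ> e) \<longleftrightarrow> subst (Const \<circ> e) \<Phi> \<in> T') \<and>
    (sat (cmodel \<sigma> j i) i \<Phi> False (j (Suc n, T')) (i \<circ> e) \<longleftrightarrow> \<^bold>\<sim> (subst (Const \<circ> e) \<Phi>) \<in> T')"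
    if "(Suc n, T') \<in> cworlds \<sigma>" for T'
    by (rule Box.IH) (use Box.prems that hcs_mono[of _ \<sigma> n "Suc n"] in auto)
  ultimately show ?case using Box.prems(2)
    by (simp add: cmodel_acc cworld_Box cworld_SNeg_Box cworld_Dia del: comp_apply) blast
next
  case (Dia \<Phi>)
  have "subst (Const \<circ> e) \<Phi> \<in> lang \<sigma> n" by (rule subst_lang) (use Dia.prems in simp_all)
  moreover have "(sat (cmodel \<sigma> j i) i \<Phi> True (j (Suc n, T')) (i \<circ> e) \<longleftrightarrow> subst (Const \<circ> e) \<Phi> \<in> T') \<and>
    (sat (cmodel \<sigma> j i) i \<Phi> False (j (Suc n, T')) (i \<circ> e) \<longleftrightarrow> \<^bold>\<sim> (subst (Const \<circ> e) \<Phi>) \<in> T')"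
    if "(Suc n, T') \<in> cworlds \<sigma>" for T'
    by (rule Dia.IH) (use Dia.prems that hcs_mono[of _ \<sigma> n "Suc n"] in auto)
  ultimately show ?case using Dia.prems(2)
    by (simp add: cmodel_acc cworld_Box cworld_SNeg_Dia cworld_Dia del: comp_apply) blast
next
  case (Forall x \<Phi>)
  let ?M = "cmodel \<sigma> j i" and ?s = "subst ((Const \<circ> e)(x := Var x)) \<Phi>"
  have "subst (Const \<circ> e) (Forall x \<Phi>) \<in> lang \<sigma> n" by (rule subst_lang) (use Forall.prems in simp_all)
  then have A: "Forall x ?s \<in> lang \<sigma> n" by (simp only: subst.simps)
  then have E: "Exists x (\<^bold>\<sim> ?s) \<in> lang \<sigma> n" by (simp add: lang_quantifier del: comp_apply fun_upd_apply)
  have IH: "(sat ?M i \<Phi> True (j (n, T)) ((i \<circ> e)(x := i c)) \<longleftrightarrow> inst ?s x (Const c) \<in> T) \<and>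
    (sat ?M i \<Phi> False (j (n, T)) ((i \<circ> e)(x := i c)) \<longleftrightarrow> inst (\<^bold>\<sim> ?s) x (Const c) \<in> T)"
    if "c \<in> hcs \<sigma> n" for c
  proof -
    have "(sat ?M i \<Phi> True (j (n, T)) (i \<circ> e(x := c)) \<longleftrightarrow> subst (Const \<circ> e(x := c)) \<Phi> \<in> T) \<and>
      (sat ?M i \<Phi> False (j (n, T)) (i \<circ> e(x := c)) \<longleftrightarrow> \<^bold>\<sim> (subst (Const \<circ> e(x := c)) \<Phi>) \<in> T)"
      by (rule Forall.IH) (use Forall.prems that in auto)
    moreover have "i \<circ> e(x := c) = (i \<circ> e)(x := i c)" by auto
    moreover have "inst (\<^bold>\<sim> ?s) x (Const c) = \<^bold>\<sim> (inst ?s x (Const c))" by (simp add: inst_def)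
    ultimately show ?thesis by (simp only: inst_subst_ground)
  qed
  have "sat ?M i (Forall x \<Phi>) True (j (n, T)) (i \<circ> e) \<longleftrightarrow> (\<forall>c\<in>hcs \<sigma> n. inst ?s x (Const c) \<in> T)"
    using IH Forall.prems(2) by (simp del: comp_apply fun_upd_apply)
  moreover have "sat ?M i (Forall x \<Phi>) False (j (n, T)) (i \<circ> e) \<longleftrightarrow> (\<exists>c\<in>hcs \<sigma> n. inst (\<^bold>\<sim> ?s) x (Const c) \<in> T)"
    using IH Forall.prems(2) by (simp del: comp_apply fun_upd_apply)
  moreover have "Forall x ?s \<in> T \<longleftrightarrow> (\<forall>c\<in>hcs \<sigma> n. inst ?s x (Const c) \<in> T)"
    by (rule cworld_Forall[OF Forall.prems(2) A])
  moreover have "\<^bold>\<sim> (Forall x ?s) \<in> T \<longleftrightarrow> (\<exists>c\<in>hcs \<sigma> n. inst (\<^bold>\<sim> ?s) x (Const c) \<in> T)"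
    unfolding cworld_SNeg(6)[OF Forall.prems(2) A] by (rule cworld_Exists[OF Forall.prems(2) E])
  ultimately show ?case by (simp only: subst.simps)
next
  case (Exists x \<Phi>)
  let ?M = "cmodel \<sigma> j i" and ?s = "subst ((Const \<circ> e)(x := Var x)) \<Phi>"
  have "subst (Const \<circ> e) (Exists x \<Phi>) \<in> lang \<sigma> n" by (rule subst_lang) (use Exists.prems in simp_all)
  then have A: "Exists x ?s \<in> lang \<sigma> n" by (simp only: subst.simps)
  then have E: "Forall x (\<^bold>\<sim> ?s) \<in> lang \<sigma> n" by (simp add: lang_quantifier del: comp_apply fun_upd_apply)
  have IH: "(sat ?M i \<Phi> True (j (n, T)) ((i \<circ> e)(x := i c)) \<longleftrightarrow> inst ?s x (Const c) \<in> T) \<and>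
    (sat ?M i \<Phi> False (j (n, T)) ((i \<circ> e)(x := i c)) \<longleftrightarrow> inst (\<^bold>\<sim> ?s) x (Const c) \<in> T)"
    if "c \<in> hcs \<sigma> n" for c
  proof -
    have "(sat ?M i \<Phi> True (j (n, T)) (i \<circ> e(x := c)) \<longleftrightarrow> subst (Const \<circ> e(x := c)) \<Phi> \<in> T) \<and>
      (sat ?M i \<Phi> False (j (n, T)) (i \<circ> e(x := c)) \<longleftrightarrow> \<^bold>\<sim> (subst (Const \<circ> e(x := c)) \<Phi>) \<in> T)"
      by (rule Exists.IH) (use Exists.prems that in auto)
    moreover have "i \<circ> e(x := c) = (i \<circ> e)(x := i c)" by auto
    moreover have "inst (\<^bold>\<sim> ?s) x (Const c) = \<^bold>\<sim> (inst ?s x (Const c))" by (simp add: inst_def)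
    ultimately show ?thesis by (simp only: inst_subst_ground)
  qed
  have "sat ?M i (Exists x \<Phi>) True (j (n, T)) (i \<circ> e) \<longleftrightarrow> (\<exists>c\<in>hcs \<sigma> n. inst ?s x (Const c) \<in> T)"
    using IH Exists.prems(2) by (simp del: comp_apply fun_upd_apply)
  moreover have "sat ?M i (Exists x \<Phi>) False (j (n, T)) (i \<circ> e) \<longleftrightarrow> (\<forall>c\<in>hcs \<sigma> n. inst (\<^bold>\<sim> ?s) x (Const c) \<in> T)"
    using IH Exists.prems(2) by (simp del: comp_apply fun_upd_apply)
  moreover have "Exists x ?s \<in> T \<longleftrightarrow> (\<exists>c\<in>hcs \<sigma> n. inst ?s x (Const c) \<in> T)"
    by (rule cworld_Exists[OF Exists.prems(2) A])
  moreover have "\<^bold>\<sim> (Exists x ?s) \<in> T \<longleftrightarrow> (\<forall>c\<in>hcs \<sigma> n. inst (\<^bold>\<sim> ?s) x (Const c) \<in> T)"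
    unfolding cworld_SNeg(7)[OF Exists.prems(2) A] by (rule cworld_Forall[OF Exists.prems(2) E])
  ultimately show ?case by (simp only: subst.simps)
qed

lemma cstruc_is_struc:
  assumes "(n, T) \<in> cworlds \<sigma>"
  shows "is_struc \<sigma> (cstruc \<sigma> i b (n, T))"
proof -
  have "length cs = arity \<sigma> p"
    if "(if b then Atom p (map Const cs) else \<^bold>\<sim> (Atom p (map Const cs))) \<in> T" for p cs
  proof -
    have "Atom p (map Const cs) \<in> lang \<sigma> n" using that cworld_lang[OF assms] by (cases b) auto
    then show ?thesis by (simp add: lang_def Sent_def Form_def)
  qed
  moreover have "hcs \<sigma> n \<noteq> {}" using hcs.Fv by blast
  ultimately show ?thesis by (auto simp: is_struc_def intro: hcs.Orig hcs.Fv intro!: imageI)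
qed

lemma cmodel_QBKo_model:
  assumes ne: "cworlds \<sigma> \<noteq> {}"
  shows "QBKo_model \<sigma> (cmodel \<sigma> j i)"
proof -
  let ?M = "cmodel \<sigma> j i"
  have W: "worlds ?M = j ` cworlds \<sigma>" by (simp add: cmodel_def)
  have "QBK_model \<sigma> ?M"
    unfolding QBK_model_def
  proof (intro conjI)
    show "worlds ?M \<noteq> {}" using ne by (simp add: W)
    show "acc ?M \<subseteq> worlds ?M \<times> worlds ?M" by (auto simp: cmodel_def)
    show "\<forall>w\<in>worlds ?M. is_struc \<sigma> (pos ?M w) \<and> is_struc \<sigma> (neg ?M w) \<and>
        univ (pos ?M w) = univ (neg ?M w) \<and> (\<forall>c\<in>csyms \<sigma>. cint (pos ?M w) c = cint (neg ?M w) c)"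
    proof
      fix w assume "w \<in> worlds ?M"
      then obtain n T where w: "w = j (n, T)" "(n, T) \<in> cworlds \<sigma>" by (auto simp: W)
      show "is_struc \<sigma> (pos ?M w) \<and> is_struc \<sigma> (neg ?M w) \<and>
        univ (pos ?M w) = univ (neg ?M w) \<and> (\<forall>c\<in>csyms \<sigma>. cint (pos ?M w) c = cint (neg ?M w) c)"
        using cstruc_is_struc[OF w(2)] w by (simp del: cstruc.simps) simp
    qed
    show "\<forall>(u, v)\<in>acc ?M. univ (pos ?M u) \<subseteq> univ (pos ?M v) \<and>
        (\<forall>c\<in>csyms \<sigma>. cint (pos ?M u) c = cint (pos ?M v) c)"
    proof clarify
      fix u v assume "(u, v) \<in> acc ?M"
      then obtain n T T' where uv: "u = j (n, T)" "v = j (Suc n, T')" "(n, T) \<in> cworlds \<sigma>" "(Suc n, T') \<in> cworlds \<sigma>"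
        by (auto simp: cmodel_def)
      show "univ (pos ?M u) \<subseteq> univ (pos ?M v) \<and> (\<forall>c\<in>csyms \<sigma>. cint (pos ?M u) c = cint (pos ?M v) c)"
        using uv hcs_mono[of _ \<sigma> n "Suc n"] by auto
    qed
  qed
  moreover have "atom_true (pos ?M w) p ts \<or> atom_true (neg ?M w) p ts"
    if w: "w \<in> worlds ?M" and at: "Atom p ts \<in> Sent (expand_sig \<sigma> (univ (pos ?M w)))" for w p ts
  proof -
    obtain n T where w: "w = j (n, T)" "(n, T) \<in> cworlds \<sigma>" using w by (auto simp: W)
    have ts: "p \<in> psyms \<sigma>" "length ts = arity \<sigma> p" using at by (auto simp: Sent_def Form_def expand_sig_def)
    have "\<forall>t\<in>set ts. \<exists>c. c \<in> hcs \<sigma> n \<and> tval (cstruc \<sigma> i True (n, T)) t = i c \<and> tval (cstruc \<sigma> i False (n, T)) t = i c"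
    proof
      fix t assume "t \<in> set ts"
      then have t: "tvars t = {}" "wf_trm (expand_sig \<sigma> (univ (pos ?M w))) t"
        using at by (auto simp: Sent_def Form_def)
      then obtain d where d: "t = Const d" by (cases t) auto
      then have "d \<in> Inl ` csyms \<sigma> \<union> Inr ` i ` hcs \<sigma> n" using t(2) w by (simp add: expand_sig_def)
      with d show "\<exists>c. c \<in> hcs \<sigma> n \<and> tval (cstruc \<sigma> i True (n, T)) t = i c \<and> tval (cstruc \<sigma> i False (n, T)) t = i c"
        by auto (metis hcs.Orig, metis hcs.Fv)
    qed
    then obtain h where h: "\<forall>t\<in>set ts. h t \<in> hcs \<sigma> n \<and> tval (cstruc \<sigma> i True (n, T)) t = i (h t) \<and>
        tval (cstruc \<sigma> i False (n, T)) t = i (h t)" by metis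
    let ?cs = "map h ts"
    have cs: "set ?cs \<subseteq> hcs \<sigma> n" using h by auto
    have "map (tval (cstruc \<sigma> i True (n, T))) ts = map i ?cs" "map (tval (cstruc \<sigma> i False (n, T))) ts = map i ?cs"
      using h by (simp_all del: cstruc.simps)
    moreover have "Atom p (map Const ?cs) \<in> lang \<sigma> n"
      using ts(1,2) cs by (auto simp: lang_def Sent_def Form_def)
    then have "Atom p (map Const ?cs) \<in> T \<or> \<^bold>\<sim> (Atom p (map Const ?cs)) \<in> T" by (rule cworld_SEM[OF w(2)])
    ultimately show ?thesis
      using cstruc_pint[OF cs, of True T p] cstruc_pint[OF cs, of False T p] w
      unfolding atom_true_def by (simp only: cmodel_struc if_True if_False simp_thms)
  qed
  ultimately show ?thesis unfolding QBKo_model_def by blast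
qed

end

section \<open>Cardinalities\<close>

text \<open>Formulas over the Henkin constants are coded as binary trees over the symbols, and trees over an
  infinite set are collapsed into that set by a pairing function.\<close>

datatype 'f tree = Lf 'f | Nd "'f tree" "'f tree"

datatype ('p, 'c) tok = TN nat | TP 'p | TC 'c

primrec enc_trm :: "('p, 'c) tok tree trm \<Rightarrow> ('p, 'c) tok tree" where
  "enc_trm (Var x) = Nd (Lf (TN 0)) (Lf (TN x))"
| "enc_trm (Const t) = Nd (Lf (TN 1)) t"

primrec enc_list :: "('p, 'c) tok tree list \<Rightarrow> ('p, 'c) tok tree" where
  "enc_list [] = Lf (TN 0)"
| "enc_list (t # ts) = Nd t (enc_list ts)"

text \<open>The constants of the argument are already code trees, which lets \<open>enc_hc\<close>
  recurse through \<open>map_fm\<close> into the formula inside a witness.\<close>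

primrec enc_fm :: "('p, ('p, 'c) tok tree) fm \<Rightarrow> ('p, 'c) tok tree" where
  "enc_fm (Atom p ts) = Nd (Lf (TN 0)) (Nd (Lf (TP p)) (enc_list (map enc_trm ts)))"
| "enc_fm \<^bold>\<bottom> = Lf (TN 0)"
| "enc_fm (\<Phi> \<^bold>\<rightarrow> \<Psi>) = Nd (Lf (TN 1)) (Nd (enc_fm \<Phi>) (enc_fm \<Psi>))"
| "enc_fm (\<Phi> \<^bold>\<and> \<Psi>) = Nd (Lf (TN 2)) (Nd (enc_fm \<Phi>) (enc_fm \<Psi>))"
| "enc_fm (\<Phi> \<^bold>\<or> \<Psi>) = Nd (Lf (TN 3)) (Nd (enc_fm \<Phi>) (enc_fm \<Psi>))"
| "enc_fm (\<^bold>\<sim> \<Phi>) = Nd (Lf (TN 4)) (enc_fm \<Phi>)"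
| "enc_fm (\<^bold>\<box> \<Phi>) = Nd (Lf (TN 5)) (enc_fm \<Phi>)"
| "enc_fm (\<^bold>\<diamond> \<Phi>) = Nd (Lf (TN 6)) (enc_fm \<Phi>)"
| "enc_fm (Forall x \<Phi>) = Nd (Lf (TN 7)) (Nd (Lf (TN x)) (enc_fm \<Phi>))"
| "enc_fm (Exists x \<Phi>) = Nd (Lf (TN 8)) (Nd (Lf (TN x)) (enc_fm \<Phi>))"

primrec enc_hc :: "('p, 'c) hc \<Rightarrow> ('p, 'c) tok tree" where
  "enc_hc (Orig c) = Lf (TC c)"
| "enc_hc (Fv x) = Lf (TN x)"
| "enc_hc (Wit n x \<Phi>) = Nd (Lf (TN n)) (Nd (Lf (TN x)) (enc_fm (map_fm id enc_hc \<Phi>)))"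

lemma enc_trm_eq [simp]: "enc_trm t = enc_trm t' \<longleftrightarrow> t = t'"
  by (cases t; cases t') auto

lemma inj_enc_trm: "inj enc_trm"
  by (auto intro: injI)

lemma enc_list_eq [simp]: "enc_list ts = enc_list ts' \<longleftrightarrow> ts = ts'"
proof (induction ts arbitrary: ts')
  case Nil
  then show ?case by (cases ts') auto
next
  case (Cons t ts)
  then show ?case by (cases ts') auto
qed

lemma enc_fm_eq [simp]: "enc_fm \<Phi> = enc_fm \<Psi> \<longleftrightarrow> \<Phi> = \<Psi>"
proof (induction \<Phi> arbitrary: \<Psi>)
  case (Atom p ts)
  show ?case by (cases \<Psi>) (auto simp: inj_map_eq_map[OF inj_enc_trm])
qed (case_tac \<Psi>; simp)+

lemma inj_enc_hc: "inj enc_hc"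
proof (rule injI)
  fix h h' :: "('p, 'c) hc"
  show "enc_hc h = enc_hc h' \<Longrightarrow> h = h'"
  proof (induction h arbitrary: h')
    case (Orig c)
    then show ?case by (cases h') auto
  next
    case (Fv x)
    then show ?case by (cases h') auto
  next
    case (Wit n x \<Phi>)
    then obtain \<Psi> where h': "h' = Wit n x \<Psi>" "map_fm id enc_hc \<Phi> = map_fm id enc_hc \<Psi>"
      by (cases h') auto
    have "\<Phi> = \<Psi>" by (rule fm.inj_map_strong[OF _ _ h'(2)]) (use Wit.IH in auto)
    then show ?case using h' by simp
  qed
qed

definition toks :: "('p, 'c) signature \<Rightarrow> ('p, 'c) tok set" where
  "toks \<sigma> = range TN \<union> TP ` psyms \<sigma> \<union> TC ` used_csyms \<sigma>"

lemma set_tree_enc_fm: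
  "set1_fm \<Phi> \<subseteq> psyms \<sigma> \<Longrightarrow> (\<And>t. t \<in> set2_fm \<Phi> \<Longrightarrow> set_tree t \<subseteq> toks \<sigma>) \<Longrightarrow> set_tree (enc_fm \<Phi>) \<subseteq> toks \<sigma>"
proof (induction \<Phi>)
  case (Atom p ts)
  have "set_tree (enc_trm t) \<subseteq> toks \<sigma>" if "t \<in> set ts" for t
    using Atom.prems that by (cases t) (fastforce simp: toks_def)+
  moreover have "(\<And>t. t \<in> set us \<Longrightarrow> set_tree t \<subseteq> toks \<sigma>) \<Longrightarrow> set_tree (enc_list us) \<subseteq> toks \<sigma>" for us
    by (induction us) (auto simp: toks_def)
  from this[of "map enc_trm ts"] calculation have "set_tree (enc_list (map enc_trm ts)) \<subseteq> toks \<sigma>" by auto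
  then show ?case using Atom.prems by (auto simp: toks_def)
qed (auto simp: toks_def)

lemma set_tree_enc_hc: "h \<in> hcs \<sigma> n \<Longrightarrow> set_tree (enc_hc h) \<subseteq> toks \<sigma>"
proof (induction rule: hcs.induct)
  case (Wit m \<Phi> x)
  have "set_tree (enc_fm (map_fm id enc_hc \<Phi>)) \<subseteq> toks \<sigma>"
    by (rule set_tree_enc_fm) (use Wit in \<open>auto simp: fm.set_map\<close>)
  then show ?case by (auto simp: toks_def)
qed (auto simp: toks_def)

lemma infinite_Form: "infinite (Form \<sigma>)"
proof -
  \<comment> \<open>Iterated boxes over falsum exist in every signature, even without predicate
    symbols.\<close>
  define f :: "nat \<Rightarrow> ('a, 'b) fm" where "f n = (Box ^^ n) \<^bold>\<bottom>" for n
  have "rank (f n) = n" for n by (induction n) (auto simp: f_def)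
  then have "inj f" by (metis injI)
  moreover have "f n \<in> Form \<sigma>" for n by (induction n) (auto simp: f_def)
  ultimately show ?thesis using infinite_iff_countable_subset[of "Form \<sigma>"] by blast
qed

lemma lepollE:
  assumes "A \<lesssim> B"
  obtains f where "inj_on f A" "f ` A \<subseteq> B"
  using assms unfolding lepoll_def by blast

lemma lepollI: "inj_on f A \<Longrightarrow> f ` A \<subseteq> B \<Longrightarrow> A \<lesssim> B"
  unfolding lepoll_def by blast

lemma infinite_pairing:
  assumes "infinite B"
  obtains pr where "inj_on pr (B \<times> B)" "pr ` (B \<times> B) \<subseteq> B"
proof -
  have "B \<times> B \<lesssim> B"
    using card_of_Times_same_infinite[OF assms] eqpoll_iff_card_of_ordIso eqpoll_imp_lepoll by blast
  then show ?thesis using that by (rule lepollE)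
qed

lemma psyms_lepoll_Form: "psyms \<sigma> \<lesssim> Form \<sigma>"
proof -
  let ?f = "\<lambda>p. Atom p (replicate (arity \<sigma> p) (Var 0))"
  have "inj_on ?f (psyms \<sigma>)" "?f ` psyms \<sigma> \<subseteq> Form \<sigma>" by (auto simp: inj_on_def Form_def)
  then show ?thesis by (rule lepollI)
qed

lemma set2_fm_arity: "wf_fm \<sigma> \<Phi> \<Longrightarrow> c \<in> set2_fm \<Phi> \<Longrightarrow> \<exists>p\<in>psyms \<sigma>. 0 < arity \<sigma> p"
proof (induction \<Phi>)
  case (Atom p ts)
  then have "length ts = arity \<sigma> p" "ts \<noteq> []" "p \<in> psyms \<sigma>" by auto
  then show ?case by (metis length_greater_0_conv)
qed auto

text \<open>A constant that occurs in a formula presupposes a predicate symbol of positive arity,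
  and the atom of this symbol filled with the constant determines it. The bound can fail for
  constants that occur in no formula.\<close>

lemma used_csyms_lepoll_Form: "used_csyms \<sigma> \<lesssim> Form \<sigma>"
proof (cases "used_csyms \<sigma> = {}")
  case False
  then obtain p where p: "p \<in> psyms \<sigma>" "0 < arity \<sigma> p"
    using set2_fm_arity by (fastforce simp: used_csyms_def Form_def)
  let ?f = "\<lambda>c. Atom p (replicate (arity \<sigma> p) (Const c))"
  have "inj_on ?f (used_csyms \<sigma>)" "?f ` used_csyms \<sigma> \<subseteq> Form \<sigma>"
    using p by (auto simp: inj_on_def Form_def used_csyms_def)
  then show ?thesis by (rule lepollI)
qed simp

lemma toks_lepoll_Form:
  fixes \<sigma> :: "('p, 'c) signature"
  shows "toks \<sigma> \<lesssim> Form \<sigma>"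
proof -
  let ?B = "Form \<sigma>"
  obtain pr where pr: "inj_on pr (?B \<times> ?B)" "pr ` (?B \<times> ?B) \<subseteq> ?B"
    using infinite_pairing[OF infinite_Form] .
  have "(UNIV :: nat set) \<lesssim> ?B" using infinite_Form[of \<sigma>] by (simp add: infinite_le_lepoll)
  then obtain f :: "nat \<Rightarrow> _" where f: "inj f" "range f \<subseteq> ?B" by (rule lepollE)
  obtain g where g: "inj_on g (psyms \<sigma>)" "g ` psyms \<sigma> \<subseteq> ?B" 
    using psyms_lepoll_Form by (rule lepollE)
  obtain h where h: "inj_on h (used_csyms \<sigma>)" "h ` used_csyms \<sigma> \<subseteq> ?B"
    using used_csyms_lepoll_Form by (rule lepollE)
  \<comment> \<open>The distinct formulas \<open>f 0\<close>, \<open>f 1\<close> and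
    \<open>f 2\<close> act as tags for the three kinds of symbols.\<close>
  define k where "k t = (case t of TN n \<Rightarrow> (f 0, f n) | TP p \<Rightarrow> (f 1, g p) | TC c \<Rightarrow> (f 2, h c))" for t
  have k: "k (TN n) = (f 0, f n)" "k (TP p) = (f 1, g p)" "k (TC c) = (f 2, h c)" for n p c
    by (simp_all add: k_def)
  have f_eq: "f m = f n \<longleftrightarrow> m = n" for m n using f(1) by (rule inj_eq)
  have "inj_on k (toks \<sigma>)"
  proof (rule inj_onI)
    fix s t assume "s \<in> toks \<sigma>" "t \<in> toks \<sigma>" "k s = k t"
    then show "s = t"
      by (cases s; cases t) (auto simp: toks_def k f_eq inj_on_eq_iff[OF g(1)] inj_on_eq_iff[OF h(1)])
  qed
  moreover have "k ` toks \<sigma> \<subseteq> ?B \<times> ?B"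
  proof
    fix u assume "u \<in> k ` toks \<sigma>"
    then obtain t where t: "t \<in> toks \<sigma>" "u = k t" by auto
    have "f n \<in> ?B" for n using f(2) by auto
    with t g(2) h(2) show "u \<in> ?B \<times> ?B" by (cases t) (auto simp: toks_def k)
  qed
  ultimately have "toks \<sigma> \<lesssim> ?B \<times> ?B" by (rule lepollI)
  moreover have "?B \<times> ?B \<lesssim> ?B" using pr by (rule lepollI)
  ultimately show ?thesis by (rule lepoll_trans)
qed

lemma trees_lepoll:
  assumes "S \<lesssim> B" "infinite B"
  shows "{t. set_tree t \<subseteq> S} \<lesssim> B"
proof -
  obtain pr where pr: "inj_on pr (B \<times> B)" "pr ` (B \<times> B) \<subseteq> B" using infinite_pairing[OF assms(2)] .
  obtain f where f: "inj_on f S" "f ` S \<subseteq> B" using assms(1) by (rule lepollE)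
  \<comment> \<open>Two distinct elements of \<open>B\<close> serve as tags that separate leaves
    from inner nodes.\<close>
  obtain b0 where b0: "b0 \<in> B" using assms(2) by fastforce
  obtain b1 where b1: "b1 \<in> B" "b1 \<noteq> b0" 
    using infinite_imp_nonempty[of "B - {b0}"] assms(2) by auto
  define k where "k = rec_tree (\<lambda>s. pr (b0, f s)) (\<lambda>_ _ l r. pr (b1, pr (l, r)))"
  have k: "k (Lf s) = pr (b0, f s)" "k (Nd l r) = pr (b1, pr (k l, k r))" for s l r by (simp_all add: k_def)
  have prB: "pr (a, b) \<in> B" if "a \<in> B" "b \<in> B" for a b using pr(2) that by blast
  have pr_eq: "pr (a, b) = pr (c, d) \<longleftrightarrow> a = c \<and> b = d" if "a \<in> B" "b \<in> B" "c \<in> B" "d \<in> B" for a b c d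
    using inj_on_eq_iff[OF pr(1), of "(a, b)" "(c, d)"] that by simp
  have kB: "set_tree t \<subseteq> S \<Longrightarrow> k t \<in> B" for t
    using f(2) b0 b1 by (induction t) (auto simp: k intro!: prB)
  have "set_tree t \<subseteq> S \<Longrightarrow> set_tree t' \<subseteq> S \<Longrightarrow> k t = k t' \<Longrightarrow> t = t'" for t t'
  proof (induction t arbitrary: t')
    case (Lf s)
    then show ?case using f b0 b1 kB
      by (cases t') (auto simp: k pr_eq prB image_subset_iff inj_on_eq_iff)
  next
    case (Nd l r)
    show ?case
    proof (cases t')
      case (Lf s)
      then show ?thesis using Nd.prems f(2) b0 b1 kB by (auto simp: k pr_eq prB image_subset_iff)
    next
      case (Nd l' r')
      have B: "k l \<in> B" "k r \<in> B" "k l' \<in> B" "k r' \<in> B" using Nd.prems \<open>t' = _\<close> kB by auto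
      then have "k l = k l'" "k r = k r'" using Nd.prems(3) \<open>t' = _\<close> b1 by (simp_all add: k pr_eq prB)
      then show ?thesis using Nd.IH(1)[of l'] Nd.IH(2)[of r'] Nd.prems \<open>t' = _\<close> by simp
    qed
  qed
  then have "inj_on k {t. set_tree t \<subseteq> S}" by (auto simp: inj_on_def)
  moreover have "k ` {t. set_tree t \<subseteq> S} \<subseteq> B" using kB by blast
  ultimately show ?thesis by (rule lepollI)
qed

lemma hcs_lepoll_Form: "(\<Union>n. hcs \<sigma> n) \<lesssim> Form \<sigma>"
proof -
  have "(\<Union>n. hcs \<sigma> n) \<lesssim> {t. set_tree t \<subseteq> toks \<sigma>}"
    unfolding lepoll_def by (intro exI[of _ enc_hc]) (auto intro: inj_on_subset[OF inj_enc_hc] dest: set_tree_enc_hc)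
  then show ?thesis using trees_lepoll[OF toks_lepoll_Form infinite_Form] by (rule lepoll_trans)
qed

lemma lang_lepoll_Form: "(\<Union>n. lang \<sigma> n) \<lesssim> Form \<sigma>"
proof -
  let ?f = "\<lambda>\<Phi>. enc_fm (map_fm id enc_hc \<Phi>)"
  have "inj ?f" by (rule injI) (simp add: injD[OF fm.inj_map[OF inj_on_id inj_enc_hc]])
  moreover have "set_tree (?f \<Phi>) \<subseteq> toks \<sigma>" if \<Phi>: "\<Phi> \<in> lang \<sigma> n" for \<Phi> n
  proof (rule set_tree_enc_fm)
    show "set1_fm (map_fm id enc_hc \<Phi>) \<subseteq> psyms \<sigma>"
      using set1_fm_wf[of "hsig \<sigma>" \<Phi>] \<Phi> by (simp add: fm.set_map lang_def Sent_def Form_def)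
    fix t assume "t \<in> set2_fm (map_fm id enc_hc \<Phi>)"
    then obtain c where "t = enc_hc c" "c \<in> hcs \<sigma> n" using \<Phi> by (auto simp: fm.set_map lang_def)
    then show "set_tree t \<subseteq> toks \<sigma>" using set_tree_enc_hc by blast
  qed
  ultimately have "(\<Union>n. lang \<sigma> n) \<lesssim> {t. set_tree t \<subseteq> toks \<sigma>}"
    unfolding lepoll_def by (intro exI[of _ ?f]) (auto intro: inj_on_subset)
  then show ?thesis using trees_lepoll[OF toks_lepoll_Form infinite_Form] by (rule lepoll_trans)
qed

text \<open>A world is a number together with a set of sentences; this is the origin of the power
  set in the size condition on \<open>'w\<close>.\<close>

lemma cworlds_lepoll: "cworlds \<sigma> \<lesssim> Pow (Form \<sigma>)"
proof -
  let ?B = "Form \<sigma>" and ?L = "\<Union>n. lang \<sigma> n"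
  obtain f where f: "inj_on f ?L" "f ` ?L \<subseteq> ?B" using lang_lepoll_Form by (rule lepollE)
  have "inj_on (image f) (Pow ?L)" using f(1) by (rule inj_on_image_Pow)
  moreover have "image f ` Pow ?L \<subseteq> Pow ?B" using f(2) by blast
  ultimately have L: "Pow ?L \<lesssim> Pow ?B" by (rule lepollI)
  have "(UNIV :: nat set) \<lesssim> ?B" using infinite_Form[of \<sigma>] by (simp add: infinite_le_lepoll)
  then have N: "(UNIV :: nat set) \<lesssim> Pow ?B" using lepoll_Pow_self by (rule lepoll_trans)
  have "infinite (Pow ?B)" using infinite_Form[of \<sigma>] by simp
  then have P: "Pow ?B \<times> Pow ?B \<lesssim> Pow ?B"
    using card_of_Times_same_infinite eqpoll_iff_card_of_ordIso eqpoll_imp_lepoll by blast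
  have "cworlds \<sigma> \<subseteq> UNIV \<times> Pow ?L" by (auto simp: cworlds_def mcs_def)
  then have "cworlds \<sigma> \<lesssim> (UNIV :: nat set) \<times> Pow ?L" by (rule subset_imp_lepoll)
  also have "\<dots> \<lesssim> Pow ?B \<times> Pow ?B" using N L by (rule times_lepoll_mono)
  finally show ?thesis using P by (rule lepoll_trans)
qed

section \<open>Completeness\<close>

lemma disj_Form: "set \<Phi>s \<subseteq> Form \<sigma> \<Longrightarrow> disj \<Phi>s \<in> Form \<sigma>"
  by (induction \<Phi>s rule: disj.induct) auto

lemma mpc_disjI: "\<Phi> \<in> mpc \<sigma> \<Gamma> \<Longrightarrow> \<Phi> \<in> set \<Phi>s \<Longrightarrow> set \<Phi>s \<subseteq> Form \<sigma> \<Longrightarrow> disj \<Phi>s \<in> mpc \<sigma> \<Gamma>"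
proof (induction \<Phi>s rule: disj.induct)
  case (3 \<Phi>' \<Psi> \<Theta>s)
  have F: "\<Phi>' \<in> Form \<sigma>" "disj (\<Psi> # \<Theta>s) \<in> Form \<sigma>" using 3(4) by (auto intro!: disj_Form)
  have "\<Phi>' \<in> mpc \<sigma> \<Gamma> \<or> disj (\<Psi> # \<Theta>s) \<in> mpc \<sigma> \<Gamma>"
    using 3 by (cases "\<Phi> = \<Phi>'") auto
  then show ?case using F mpc_DisI by (simp only: disj.simps)
qed auto

text \<open>The negated disjunction derives each negated disjunct, so the inconsistency persists
  when the disjuncts' negations are replaced by it; classical reasoning finishes.\<close>

lemma mpc_disj_of_inconsistent:
  assumes bot: "\<^bold>\<bottom> \<in> mpc \<sigma> (\<Gamma> \<union> Neg ` set \<Phi>s)" and \<Gamma>: "\<Gamma> \<subseteq> Form \<sigma>" and \<Phi>s: "set \<Phi>s \<subseteq> Form \<sigma>"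
  shows "disj \<Phi>s \<in> mpc \<sigma> \<Gamma>"
proof (rule mpc_ccontr)
  let ?\<Gamma> = "insert (\<^bold>\<not> disj \<Phi>s) \<Gamma>"
  have D: "disj \<Phi>s \<in> Form \<sigma>" using \<Phi>s by (rule disj_Form)
  have "\<^bold>\<not> \<Phi> \<in> mpc \<sigma> ?\<Gamma>" if "\<Phi> \<in> set \<Phi>s" for \<Phi>
  proof (rule mpc_deduction)
    have "disj \<Phi>s \<in> mpc \<sigma> (insert \<Phi> ?\<Gamma>)"
      by (rule mpc_disjI[of \<Phi>]) (use that \<Phi>s in \<open>auto intro: mpc.Hyp\<close>)
    then show "\<^bold>\<bottom> \<in> mpc \<sigma> (insert \<Phi> ?\<Gamma>)" by (rule mpc.MP) (simp add: mpc.Hyp)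
  qed (use that \<Gamma> \<Phi>s D in auto)
  then have "\<Gamma> \<union> Neg ` set \<Phi>s \<subseteq> mpc \<sigma> ?\<Gamma>" by (auto intro: mpc.Hyp)
  with bot show "\<^bold>\<bottom> \<in> mpc \<sigma> ?\<Gamma>" by (rule mpc_trans)
qed (use \<Gamma> disj_Form[OF \<Phi>s] in auto)

section \<open>Return from the Henkin language to the original signature\<close>

lemma set2_fm_map_Orig: "set2_fm (map_fm id Orig \<Phi>) = Orig ` set2_fm \<Phi>"
  by (simp add: fm.set_map)

lemma map_Orig_Form:
  fixes \<sigma> :: "('p, 'c) signature"
  assumes "\<Phi> \<in> Form \<sigma>"
  shows "map_fm id Orig \<Phi> \<in> Form (hsig \<sigma>)" "set2_fm (map_fm id Orig \<Phi>) \<subseteq> hcs \<sigma> n"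
proof -
  let ?o = "Orig :: 'c \<Rightarrow> ('p, 'c) hc"
  have "csub (Const \<circ> ?o) \<Phi> \<in> Form (hsig \<sigma>)"
    using assms wf_fm_csub[of \<sigma> \<Phi> "hsig \<sigma>" "Const \<circ> ?o"] by (simp add: Form_def)
  moreover have "csub (Const \<circ> ?o) \<Phi> = map_fm id ?o \<Phi>"
    unfolding csub_map_fm[symmetric] by (rule csub_id) simp
  ultimately show "map_fm id Orig \<Phi> \<in> Form (hsig \<sigma>)" by simp
  have "set2_fm \<Phi> \<subseteq> used_csyms \<sigma>"
    using assms wf_fm_iff[of \<sigma> \<Phi>] by (auto simp: used_csyms_def Form_def)
  then show "set2_fm (map_fm id Orig \<Phi>) \<subseteq> hcs \<sigma> n" by (auto simp: set2_fm_map_Orig intro: hcs.Orig)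
qed

text \<open>The constants \<open>Fv x\<close> are turned back into variables one at a time by
  generalization; the absence of all \<open>Fv\<close> constants from \<Phi> and \<Gamma> keeps the
  remaining ones fresh.\<close>

lemma mpc_hsig_generalize:
  fixes \<sigma> :: "('p, 'c) signature"
  assumes "finite X"
  shows "subst (\<lambda>x. if x \<in> X then Const (Fv x) else Var x) \<Phi> \<in> mpc (hsig \<sigma>) \<Gamma> \<Longrightarrow> \<Gamma> \<subseteq> Sent (hsig \<sigma>) \<Longrightarrow>
    \<Phi> \<in> Form (hsig \<sigma>) \<Longrightarrow> (\<And>x \<Psi>. \<Psi> \<in> insert \<Phi> \<Gamma> \<Longrightarrow> Fv x \<notin> set2_fm \<Psi>) \<Longrightarrow> \<Phi> \<in> mpc (hsig \<sigma>) \<Gamma>"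
  using assms
proof (induction X rule: finite_induct)
  case empty
  then show ?case by simp
next
  case (insert y X)
  let ?s = "\<lambda>X x. if x \<in> X then Const (Fv x) else Var x :: ('p, 'c) hc trm"
  let ?c = "Var(y := Const (Fv y)) :: nat \<Rightarrow> ('p, 'c) hc trm"
  have "subst (?s X) \<Phi> \<in> mpc (hsig \<sigma>) \<Gamma>"
  proof (rule mpc_generalize_constant)
    have "tsubst ?c \<circ> ?s X = ?s (insert y X)" using insert.hyps by auto
    moreover have "subst ?c (subst (?s X) \<Phi>) = subst (tsubst ?c \<circ> ?s X) \<Phi>"
      by (rule subst_subst) auto
    ultimately have "inst (subst (?s X) \<Phi>) y (Const (Fv y)) = subst (?s (insert y X)) \<Phi>"
      by (simp only: inst_def)
    then show "inst (subst (?s X) \<Phi>) y (Const (Fv y)) \<in> mpc (hsig \<sigma>) \<Gamma>" using insert.prems(1) by simp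
    show "subst (?s X) \<Phi> \<in> Form (hsig \<sigma>)" using insert.prems(3) by (simp add: Form_def wf_fm_subst)
    have "Fv y \<notin> set2_fm \<Phi>" using insert.prems(4) by blast
    then show "Fv y \<notin> set2_fm (subst (?s X) \<Phi>)"
      using set2_fm_subst[of "?s X" \<Phi>] insert.hyps by (auto split: if_splits)
    show "Fv y \<notin> set2_fm \<Psi>" if "\<Psi> \<in> \<Gamma>" for \<Psi> using insert.prems(4) that by blast
  qed (rule insert.prems(2))
  then show ?case using insert.IH insert.prems by blast
qed

text \<open>The \<open>Fv\<close> constants standing for free variables are removed from the
  conclusion first. The derivation may still pass through other Henkin constants, and a translation
  of constants into terms of \<sigma> eliminates these.\<close>

lemma mpc_hsig_conservative:
  assumes \<chi>: "\<chi> \<in> Form \<sigma>" and \<Gamma>: "\<Gamma> \<subseteq> Sent \<sigma>"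
    and d: "subst (Const \<circ> Fv) (map_fm id Orig \<chi>) \<in> mpc (hsig \<sigma>) (map_fm id Orig ` \<Gamma>)"
  shows "\<chi> \<in> mpc \<sigma> \<Gamma>"
proof -
  let ?\<chi> = "map_fm id Orig \<chi> :: ('a, ('a, 'b) hc) fm" and ?\<Gamma> = "map_fm id Orig ` \<Gamma> :: ('a, ('a, 'b) hc) fm set"
  have "subst (Const \<circ> Fv) ?\<chi> = subst (\<lambda>x. if x \<in> fv ?\<chi> then Const (Fv x) else Var x) ?\<chi>"
    by (rule subst_cong) auto
  with d have d': "subst (\<lambda>x. if x \<in> fv ?\<chi> then Const (Fv x) else Var x) ?\<chi> \<in> mpc (hsig \<sigma>) ?\<Gamma>"
    by (simp only:)
  have "?\<chi> \<in> mpc (hsig \<sigma>) ?\<Gamma>"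
  proof (rule mpc_hsig_generalize[OF _ d'])
    show "finite (fv ?\<chi>)" using fv_subset_vars finite_vars by (rule finite_subset)
    show "?\<Gamma> \<subseteq> Sent (hsig \<sigma>)" using map_Orig_Form(1)[of _ \<sigma>] \<Gamma> by (auto simp: Sent_def)
    show "Fv x \<notin> set2_fm \<Psi>" if "\<Psi> \<in> insert ?\<chi> ?\<Gamma>" for x \<Psi>
      using that by (auto simp: set2_fm_map_Orig)
  qed (rule map_Orig_Form(1)[OF \<chi>])
  \<comment> \<open>Foreign constants become a fresh variable rather than a constant, because
    \<sigma> may have no constants at all.\<close>
  define g where "g y h = (case h of Orig c \<Rightarrow> if c \<in> csyms \<sigma> then Const c else Var y | _ \<Rightarrow> Var y)"
    for y and h :: "('a, 'b) hc"
  have "\<forall>\<^sub>F y in sequentially. csub (g y) ?\<chi> \<in> mpc \<sigma> (csub (g y) ` ?\<Gamma>)"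
    by (rule csub_mpc[OF _ _ _ _ \<open>?\<chi> \<in> mpc (hsig \<sigma>) ?\<Gamma>\<close>]) (auto simp: g_def split: hc.splits)
  then obtain y where y: "csub (g y) ?\<chi> \<in> mpc \<sigma> (csub (g y) ` ?\<Gamma>)" by (auto dest: eventually_happens)
  have id: "csub (g y) (map_fm id Orig \<Phi>) = \<Phi>" if "\<Phi> \<in> Form \<sigma>" for \<Phi>
    unfolding csub_map_fm by (rule csub_id) (use that wf_fm_iff[of \<sigma> \<Phi>] in \<open>auto simp: Form_def g_def\<close>)
  have "csub (g y) ` ?\<Gamma> = \<Gamma>"
    unfolding image_image using id \<Gamma> by (force simp: Sent_def)
  then show ?thesis using y id[OF \<chi>] by simp
qed

lemma subst_map_disj:
  "subst s (map_fm id f (disj \<Phi>s)) = disj (map (\<lambda>\<Phi>. subst s (map_fm id f \<Phi>)) \<Phi>s)"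
  by (induction \<Phi>s rule: disj.induct) auto

text \<open>By compactness an inconsistency involves finitely many negated conclusions, and the
  disjunction of the corresponding elements of \<Delta> would be derivable from \<Gamma>, contrary
  to assumption.\<close>

lemma canonical_base_consistent:
  fixes \<sigma> :: "('p, 'c) signature"
  assumes \<Gamma>: "\<Gamma> \<subseteq> Sent \<sigma>" and \<Delta>: "\<Delta> \<subseteq> Form \<sigma>" and nd: "\<not> QBKo_derives \<sigma> \<Gamma> \<Delta>"
  shows "consistent (hsig \<sigma>)
    (map_fm id Orig ` \<Gamma> \<union> (\<lambda>\<Psi>. \<^bold>\<not> subst (Const \<circ> Fv) (map_fm id Orig \<Psi>)) ` \<Delta>)"
  unfolding consistent_def
proof
  let ?\<Gamma> = "map_fm id Orig ` \<Gamma> :: ('p, ('p, 'c) hc) fm set"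
  define \<delta> :: "('p, 'c) fm \<Rightarrow> ('p, ('p, 'c) hc) fm"
    where "\<delta> \<Psi> = subst (Const \<circ> Fv) (map_fm id Orig \<Psi>)" for \<Psi>
  assume "\<^bold>\<bottom> \<in> mpc (hsig \<sigma>) (?\<Gamma> \<union> (\<lambda>\<Psi>. \<^bold>\<not> subst (Const \<circ> Fv) (map_fm id Orig \<Psi>)) ` \<Delta>)"
  then have "\<^bold>\<bottom> \<in> mpc (hsig \<sigma>) (?\<Gamma> \<union> (\<lambda>\<Psi>. \<^bold>\<not> \<delta> \<Psi>) ` \<Delta>)" by (simp only: \<delta>_def)
  from mpc_compact[OF this] obtain S where S: "finite S" "S \<subseteq> ?\<Gamma> \<union> (\<lambda>\<Psi>. \<^bold>\<not> \<delta> \<Psi>) ` \<Delta>" "\<^bold>\<bottom> \<in> mpc (hsig \<sigma>) S"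
    by auto
  then have "finite (S - ?\<Gamma>)" "S - ?\<Gamma> \<subseteq> (\<lambda>\<Psi>. \<^bold>\<not> \<delta> \<Psi>) ` \<Delta>" by auto
  from finite_subset_image[OF this] obtain D where D: "D \<subseteq> \<Delta>" "finite D" "S - ?\<Gamma> = (\<lambda>\<Psi>. \<^bold>\<not> \<delta> \<Psi>) ` D" by auto
  obtain \<Psi>s where \<Psi>s: "set \<Psi>s = D" using finite_list[OF D(2)] by blast
  have "\<^bold>\<bottom> \<in> mpc (hsig \<sigma>) (?\<Gamma> \<union> Neg ` set (map \<delta> \<Psi>s))"
    by (rule mpc_mono[OF S(3)]) (use D(3) \<Psi>s in \<open>auto simp: image_image\<close>)
  moreover have "\<delta> \<Psi> \<in> Form (hsig \<sigma>)" if "\<Psi> \<in> \<Delta>" for \<Psi>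
    using map_Orig_Form(1)[of \<Psi> \<sigma>] that \<Delta> by (auto simp: \<delta>_def Form_def wf_fm_subst)
  moreover have "?\<Gamma> \<subseteq> Form (hsig \<sigma>)" using map_Orig_Form(1)[of _ \<sigma>] \<Gamma> by (auto simp: Sent_def)
  ultimately have "disj (map \<delta> \<Psi>s) \<in> mpc (hsig \<sigma>) ?\<Gamma>"
    using \<Psi>s D(1) by (intro mpc_disj_of_inconsistent) auto
  then have "subst (Const \<circ> Fv) (map_fm id Orig (disj \<Psi>s)) \<in> mpc (hsig \<sigma>) ?\<Gamma>"
    by (simp only: subst_map_disj \<delta>_def[symmetric])
  moreover have "disj \<Psi>s \<in> Form \<sigma>" using \<Psi>s D(1) \<Delta> by (intro disj_Form) auto
  ultimately have "disj \<Psi>s \<in> mpc \<sigma> \<Gamma>" using mpc_hsig_conservative \<Gamma> by blast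
  then have "disj \<Psi>s \<in> QBKo_closure \<sigma> \<Gamma>" using mpc_subset_closure by blast
  moreover have "disj \<Psi>s \<in> Disj \<Delta>" using \<Psi>s D(1) unfolding Disj_def by blast
  ultimately show False using nd unfolding QBKo_derives_def by blast
qed

theorem completeness:
  fixes \<sigma> :: "('p, 'c) signature"
  assumes \<Gamma>: "\<Gamma> \<subseteq> Sent \<sigma>" and \<Delta>: "\<Delta> \<subseteq> Form \<sigma>"
    and W: "Pow (Form \<sigma>) \<lesssim> (UNIV :: 'w set)" and A: "Form \<sigma> \<lesssim> (UNIV :: 'a set)"
    and ent: "QBKo_entails TYPE('w) TYPE('a) \<sigma> \<Gamma> \<Delta>"
  shows "QBKo_derives \<sigma> \<Gamma> \<Delta>"
proof (rule ccontr)
  assume nd: "\<not> QBKo_derives \<sigma> \<Gamma> \<Delta>"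
  \<comment> \<open>The size conditions on \<open>'w\<close> and \<open>'a\<close> enter here and in
    the choice of \<open>i\<close>, as injections that copy the canonical model.\<close>
  obtain j :: "nat \<times> ('p, ('p, 'c) hc) fm set \<Rightarrow> 'w" where j: "inj_on j (cworlds \<sigma>)"
    using lepoll_trans[OF cworlds_lepoll W] by (rule lepollE)
  obtain i :: "('p, 'c) hc \<Rightarrow> 'a" where i: "inj_on i (\<Union>n. hcs \<sigma> n)"
    using lepoll_trans[OF hcs_lepoll_Form A] by (rule lepollE)
  define \<delta> :: "('p, 'c) fm \<Rightarrow> ('p, ('p, 'c) hc) fm"
    where "\<delta> \<Psi> = subst (Const \<circ> Fv) (map_fm id Orig \<Psi>)" for \<Psi>
  have \<delta>: "\<delta> \<Psi> \<in> lang \<sigma> 0" if "\<Psi> \<in> Form \<sigma>" for \<Psi>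
    unfolding \<delta>_def by (rule subst_lang) (use map_Orig_Form[OF that] hcs.Fv in auto)
  have \<delta>_Wit: "Wit n x \<Phi> \<notin> set2_fm (\<delta> \<Psi>)" for n x \<Phi> \<Psi>
    using set2_fm_subst_Const[of "map_fm id Orig \<Psi>" "range Orig \<union> range Fv" Fv]
    by (auto simp: \<delta>_def set2_fm_map_Orig simp del: comp_apply)
  have \<Gamma>\<delta>: "map_fm id Orig \<Phi> = \<delta> \<Phi>" if "\<Phi> \<in> \<Gamma>" for \<Phi>
    using \<Gamma> that by (auto simp: \<delta>_def Sent_def subst_sentence)
  have "\<exists>T. \<delta> ` \<Gamma> \<union> (\<lambda>\<Psi>. \<^bold>\<not> \<delta> \<Psi>) ` \<Delta> \<subseteq> T \<and> (0, T) \<in> cworlds \<sigma>"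
  proof (rule henkin_extension)
    show "\<delta> ` \<Gamma> \<union> (\<lambda>\<Psi>. \<^bold>\<not> \<delta> \<Psi>) ` \<Delta> \<subseteq> lang \<sigma> 0"
      using \<delta> \<Gamma> \<Delta> by (auto simp: Sent_def)
    have "map_fm id Orig ` \<Gamma> = \<delta> ` \<Gamma>" using \<Gamma>\<delta> by (rule image_cong[OF refl])
    then show "consistent (hsig \<sigma>) (\<delta> ` \<Gamma> \<union> (\<lambda>\<Psi>. \<^bold>\<not> \<delta> \<Psi>) ` \<Delta>)"
      using canonical_base_consistent[OF \<Gamma> \<Delta> nd] by (simp only: \<delta>_def)
    show "Wit 0 x \<Phi> \<notin> set2_fm \<Psi>" if "\<Psi> \<in> \<delta> ` \<Gamma> \<union> (\<lambda>\<Psi>. \<^bold>\<not> \<delta> \<Psi>) ` \<Delta>" for \<Psi> x \<Phi>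
      using that \<delta>_Wit by auto
  qed
  then obtain T where T: "\<delta> ` \<Gamma> \<subseteq> T" "(\<lambda>\<Psi>. \<^bold>\<not> \<delta> \<Psi>) ` \<Delta> \<subseteq> T" and world: "(0, T) \<in> cworlds \<sigma>" by auto
  let ?M = "cmodel \<sigma> j i" and ?w = "j (0, T)"
  have M: "QBKo_model \<sigma> ?M" using cmodel_QBKo_model[OF j i] world by blast
  then have M': "QBK_model \<sigma> ?M" by (simp add: QBKo_model_def)
  have w: "?w \<in> worlds ?M" using world by (simp add: cmodel_def)
  have pos: "pos ?M ?w = cstruc \<sigma> i True (0, T)" by (rule cmodel_struc(1)[OF j i world])
  have sat: "sat ?M (cint (pos ?M ?w)) \<Phi> True ?w (i \<circ> Fv) \<longleftrightarrow> \<delta> \<Phi> \<in> T" if \<Phi>: "\<Phi> \<in> Form \<sigma>" for \<Phi>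
  proof -
    \<comment> \<open>\<open>cint\<close> agrees with \<open>i \<circ> Orig\<close> only on the used
      constants, and these are all that \<Phi> can contain.\<close>
    have "set2_fm \<Phi> \<subseteq> used_csyms \<sigma>"
      using \<Phi> wf_fm_iff[of \<sigma> \<Phi>] by (auto simp: used_csyms_def Form_def)
    then have "sat ?M (cint (pos ?M ?w)) \<Phi> True ?w (i \<circ> Fv) \<longleftrightarrow> sat ?M (i \<circ> Orig) \<Phi> True ?w (i \<circ> Fv)"
      by (intro sat_cong) (auto simp: pos)
    also have "\<dots> \<longleftrightarrow> sat ?M i (map_fm id Orig \<Phi>) True ?w (i \<circ> Fv)" by (simp only: sat_map_fm)
    also have "\<dots> \<longleftrightarrow> \<delta> \<Phi> \<in> T"
      unfolding \<delta>_def using truth_lemma[OF j i map_Orig_Form(1)[OF \<Phi>] world map_Orig_Form(2)[OF \<Phi>], of Fv]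
      by (simp add: hcs.Fv del: comp_apply)
    finally show ?thesis .
  qed
  \<comment> \<open>The variable \<open>x\<close> is sent to the name of the copy of
    \<open>Fv x\<close>, the constant that replaced it in \<Delta>.\<close>
  have "ground_subst (univ (pos ?M ?w)) (Const \<circ> (Inr \<circ> (i \<circ> Fv)))"
    by (auto simp: ground_subst_def pos intro: hcs.Fv)
  moreover have "\<forall>\<Phi>\<in>\<Gamma>. verifies ?M ?w (embed \<Phi>)"
  proof
    fix \<Phi> assume "\<Phi> \<in> \<Gamma>"
    then have "\<Phi> \<in> Sent \<sigma>" "\<Phi> \<in> Form \<sigma>" "\<delta> \<Phi> \<in> T" using \<Gamma> T(1) by (auto simp: Sent_def)
    then show "verifies ?M ?w (embed \<Phi>)"
      using verifies_sat_sentence[OF M' _ w, of \<Phi> "i \<circ> Fv"] sat by blast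
  qed
  ultimately obtain \<Psi> where \<Psi>: "\<Psi> \<in> \<Delta>" "verifies ?M ?w (subst (Const \<circ> (Inr \<circ> (i \<circ> Fv))) (embed \<Psi>))"
    using ent M w unfolding QBKo_entails_def by blast
  then have "\<Psi> \<in> Form \<sigma>" using \<Delta> by blast
  then have "\<delta> \<Psi> \<in> T" using \<Psi>(2) verifies_sat[OF M' _ w] sat by blast
  moreover have "\<^bold>\<not> \<delta> \<Psi> \<in> T" using \<Psi>(1) T(2) by blast
  ultimately show False using cworld_Neg[OF world, of "\<delta> \<Psi>"] \<delta>[OF \<open>\<Psi> \<in> Form \<sigma>\<close>] by simp
qed

text \<open>Consequence is relative to the types \<open>'w\<close> and \<open>'a\<close>. Soundness
  holds for every choice, while the converse asks that a canonical model fit into them;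
  \<open>('p, 'c) fm set\<close> for worlds and \<open>('p, 'c) fm\<close> for individuals are
  always large enough.\<close>

theorem theorem16:
  fixes \<sigma> :: "('p, 'c) signature" and \<Gamma> \<Delta> :: "('p, 'c) fm set"
  assumes "\<Gamma> \<subseteq> Sent \<sigma>" and "\<Delta> \<subseteq> Form \<sigma>"
  shows "(QBKo_derives \<sigma> \<Gamma> \<Delta> \<longrightarrow> QBKo_entails TYPE('w) TYPE('a) \<sigma> \<Gamma> \<Delta>) \<and>
    (Pow (Form \<sigma>) \<lesssim> (UNIV :: 'w set) \<and> Form \<sigma> \<lesssim> (UNIV :: 'a set) \<longrightarrow>
       (QBKo_derives \<sigma> \<Gamma> \<Delta> \<longleftrightarrow> QBKo_entails TYPE('w) TYPE('a) \<sigma> \<Gamma> \<Delta>))"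
  using soundness[OF assms] completeness[OF assms] by blast

end
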